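(* Let $\varphi\in\mathcal{C}$, $K,L\in\mathcal{K}_o^n$ and $1\leq j\leq n$. Then $$\Phi_{n-j}(K)^{n+1}\,\Phi_{\varphi,n-j}(K,L)^{-n}=\frac{\varphi'(1^-)}{j}\,\lim_{\varepsilon\to0^+}\frac{\Phi_{n-j}(K+_\varphi\varepsilon\cdot L)-\Phi_{n-j}(K)}{\varepsilon},$$ where $\varphi'(1^-)$ is the left derivative of $\varphi$ at $1$.
   Context: $\mathcal{K}_o^n$ is the class of all compact convex subsets of $\mathbb{R}^n$ containing the origin in their interior. $h_K(x)=\sup_{y\in K}\langle x,y\rangle$ is the support function of $K$. $\mathcal{C}$ is the class of all increasing convex functions $\varphi:[0,\infty)\to[0,\infty)$ with $\varphi(0)=0$ and $\varphi(1)=1$. $G_{n,j}$ is the Grassmannian of $j$-dimensional linear subspaces of $\mathbb{R}^n$, $\nu_{n,j}$ its Haar (rotation-invariant) probability measure, $K|\xi$ the orthogonal projection of $K$ onto $\xi\in G_{n,j}$, $\mathrm{vol}_j$ the $j$-dimensional volume, and $\omega_i$ the volume of the Euclidean unit ball of $\mathbb{R}^i$. Orlicz linear combination: for $K,L\in\mathcal{K}_o^n$ and $\varepsilon>0$, $K+_\varphi\varepsilon\cdot L\in\mathcal{K}_o^n$ is the convex body with support function $$h_{K+_\varphi\varepsilon\cdot L}(x)=\inf\left\{\lambda>0:\ \varphi\left(\frac{h_K(x)}{\lambda}\right)+\varepsilon\,\varphi\left(\frac{h_L(x)}{\lambda}\right)\le1\right\}.$$ Orlicz mixed volume: for $\xi\in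 G_{n,j}$ and compact convex sets $A,B\subset\xi$ containing the origin in their interior relative to $\xi$, $$V_\varphi^{(j)}(A,B)=\frac1j\int_{\mathbb{S}^{n-1}\cap\xi}\varphi\left(\frac{h_B(u)}{h_A(u)}\right)h_A(u)\,dS_\xi(A,u),$$ where $S_\xi(A,\cdot)$ is the surface area measure of $A$ as a convex body in $\xi\cong\mathbb{R}^j$ (for $j=1$ it is the counting measure on the two unit vectors of $\xi$). Affine quermassintegrals: for $1\le j\le n$, $$\Phi_{n-j}(K)=\frac{\omega_n}{\omega_j}\left(\int_{G_{n,j}}\mathrm{vol}_j(K|\xi)^{-n}\,d\nu_{n,j}(\xi)\right)^{-1/n}$$ (for $j=n$ this is the volume of $K$). Orlicz mixed affine quermassintegrals: for $K,L\in\mathcal{K}_o^n$, $\varphi\in\mathcal{C}$, $1\le j\le n$, $$\Phi_{\varphi,n-j}(K,L)=\frac{\omega_n}{\omega_j}\left(\int_{G_{n,j}}V_\varphi^{(j)}(K|\xi,L|\xi)\,\mathrm{vol}_j(K|\xi)^{-n-1}\,d\nu_{n,j}(\xi)\right)^{-1/n}.$$ If the integral vanishes, this is read as $+\infty$, with $(+\infty)^{-n}=0$. *)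

theory Defs
  imports "HOL-Analysis.Analysis"
begin

subsection \<open>Convex bodies and Orlicz functions\<close>

definition convex_bodies_o :: "(real^'n) set set" where
  "convex_bodies_o = {K. compact K \<and> convex K \<and> 0 \<in> interior K}"

definition support_fun :: "(real^'n) set \<Rightarrow> real^'n \<Rightarrow> real" where
  "support_fun K x = (SUP y\<in>K. x \<bullet> y)"

(* Only the values on [0,\<infinity>) matter.  "Increasing" is meant in the weak sense: such a function may
   vanish near 0, which is why the mixed integral below can be 0. *)
definition orlicz_functions :: "(real \<Rightarrow> real) set" where
  "orlicz_functions =
     {\<phi>. (\<forall>t\<ge>0. 0 \<le> \<phi> t) \<and> mono_on {0..} \<phi> \<and> convex_on {0..} \<phi> \<and> \<phi> 0 = 0 \<and> \<phi> 1 = 1}"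

definition left_deriv :: "(real \<Rightarrow> real) \<Rightarrow> real \<Rightarrow> real" where
  "left_deriv f x = (THE d. (f has_real_derivative d) (at_left x))"

definition orlicz_comb :: "(real \<Rightarrow> real) \<Rightarrow> real \<Rightarrow> (real^'n) set \<Rightarrow> (real^'n) set \<Rightarrow> (real^'n) set" where
  "orlicz_comb \<phi> \<epsilon> K L =
     (THE M. M \<in> convex_bodies_o \<and>
        (\<forall>x. support_fun M x =
           Inf {r. r > 0 \<and> \<phi> (support_fun K x / r) + \<epsilon> * \<phi> (support_fun L x / r) \<le> 1}))"

subsection \<open>Grassmannian\<close>

definition orth_proj :: "(real^'n) set \<Rightarrow> real^'n \<Rightarrow> real^'n" where
  "orth_proj \<xi> x = (THE y. y \<in> \<xi> \<and> (\<forall>z\<in>\<xi>. orthogonal (x - y) z))"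

definition grassmannian :: "nat \<Rightarrow> (real^'n) set set" where
  "grassmannian j = {\<xi>. subspace \<xi> \<and> dim \<xi> = j}"

(* The topology of the Grassmannian is the one in which a subspace depends on its matrix of
   orthogonal projection homeomorphically, so its Borel sets are the preimages of the Borel sets
   of matrices. *)
definition grassmannian_borel :: "nat \<Rightarrow> (real^'n) set measure" where
  "grassmannian_borel j = vimage_algebra (grassmannian j) (\<lambda>\<xi>. matrix (orth_proj \<xi>)) borel"

definition haar_prob_grassmannian :: "nat \<Rightarrow> (real^'n) set measure \<Rightarrow> bool" where
  "haar_prob_grassmannian j \<nu> \<longleftrightarrow>
     space \<nu> = grassmannian j \<and> sets \<nu> = sets (grassmannian_borel j) \<and>
     emeasure \<nu> (space \<nu>) = 1 \<and>
     (\<forall>R :: real^'n^'n. rotation_matrix R \<longrightarrow> distr \<nu> \<nu> (\<lambda>\<xi>. (*v) R ` \<xi>) = \<nu>)"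

subsection \<open>Volume in a subspace, Hausdorff measure, surface area measure\<close>

(* Same construction as lborel, with an orthonormal basis of the subspace in place of Basis;
   the result does not depend on the basis chosen. *)
definition subspace_lborel :: "(real^'n) set \<Rightarrow> (real^'n) measure" where
  "subspace_lborel \<xi> =
     (let B = (SOME B. B \<subseteq> \<xi> \<and> pairwise orthogonal B \<and> (\<forall>b\<in>B. norm b = 1) \<and> span B = \<xi>)
      in distr (\<Pi>\<^sub>M b\<in>B. lborel) borel (\<lambda>c. \<Sum>b\<in>B. c b *\<^sub>R b))"

definition vol_in :: "(real^'n) set \<Rightarrow> (real^'n) set \<Rightarrow> real" where
  "vol_in \<xi> A = measure (subspace_lborel \<xi>) A"

(* Hausdorff measure normalised to agree with Lebesgue measure.  The empty set needs its own case
   because x ^ 0 = 1 for every x; for d = 0 one gets the counting measure. *)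
definition hausdorff_pre :: "nat \<Rightarrow> real \<Rightarrow> (real^'n) set \<Rightarrow> ennreal" where
  "hausdorff_pre d \<delta> S =
     (INF C \<in> {C :: nat \<Rightarrow> (real^'n) set.
                 S \<subseteq> (\<Union>i. C i) \<and> (\<forall>i. bounded (C i) \<and> diameter (C i) \<le> \<delta>)}.
        \<Sum>i. if C i = {} then 0 else ennreal (unit_ball_vol (real d) * (diameter (C i) / 2) ^ d))"

definition hausdorff_outer :: "nat \<Rightarrow> (real^'n) set \<Rightarrow> ennreal" where
  "hausdorff_outer d S = (SUP \<delta>\<in>{0<..}. hausdorff_pre d \<delta> S)"

(* Boundary points of A relative to its affine hull (which is \<xi> whenever A has interior points in
   \<xi>) that admit an outer unit normal in \<omega>. *)
definition rev_spherical_image :: "(real^'n) set \<Rightarrow> (real^'n) set \<Rightarrow> (real^'n) set" where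
  "rev_spherical_image A \<omega> = {x \<in> rel_frontier A. \<exists>u\<in>\<omega>. \<forall>y\<in>A. u \<bullet> y \<le> u \<bullet> x}"

(* For dim \<xi> = 1 this is the counting measure on the two unit vectors of \<xi>. *)
definition surface_area_measure :: "(real^'n) set \<Rightarrow> (real^'n) set \<Rightarrow> (real^'n) measure" where
  "surface_area_measure \<xi> A =
     measure_of (sphere 0 1 \<inter> \<xi>) (sets (restrict_space borel (sphere 0 1 \<inter> \<xi>)))
       (\<lambda>\<omega>. hausdorff_outer (dim \<xi> - 1) (rev_spherical_image A \<omega>))"

subsection \<open>Orlicz mixed volume and affine quermassintegrals\<close>

definition orlicz_mixed_vol ::
    "(real \<Rightarrow> real) \<Rightarrow> (real^'n) set \<Rightarrow> (real^'n) set \<Rightarrow> (real^'n) set \<Rightarrow> real" where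
  "orlicz_mixed_vol \<phi> \<xi> A B =
     1 / real (dim \<xi>) *
     (LINT u | surface_area_measure \<xi> A. \<phi> (support_fun B u / support_fun A u) * support_fun A u)"

(* Both functionals are indexed by the dimension j of the projections: the values are
   \<Phi>_{n-j}(K) and \<Phi>_{\<phi>,n-j}(K,L), with \<nu> the Haar probability measure of the Grassmannian. *)
definition affine_quermass :: "(real^'n) set measure \<Rightarrow> nat \<Rightarrow> (real^'n) set \<Rightarrow> real" where
  "affine_quermass \<nu> j K =
     unit_ball_vol (real CARD('n)) / unit_ball_vol (real j) *
     (LINT \<xi> | \<nu>. inverse (vol_in \<xi> (orth_proj \<xi> ` K) ^ CARD('n))) powr (- 1 / real CARD('n))"

definition orlicz_mixed_affine_quermass ::
    "(real \<Rightarrow> real) \<Rightarrow> (real^'n) set measure \<Rightarrow> nat \<Rightarrow> (real^'n) set \<Rightarrow> (real^'n) set \<Rightarrow> ereal" where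
  "orlicz_mixed_affine_quermass \<phi> \<nu> j K L =
     (let I = (LINT \<xi> | \<nu>. orlicz_mixed_vol \<phi> \<xi> (orth_proj \<xi> ` K) (orth_proj \<xi> ` L) *
                            inverse (vol_in \<xi> (orth_proj \<xi> ` K) ^ (CARD('n) + 1)))
      in if I = 0 then \<infinity>
         else ereal (unit_ball_vol (real CARD('n)) / unit_ball_vol (real j) *
                     I powr (- 1 / real CARD('n))))"

end

theory Submission
  imports Defs
begin

text \<open>
  Up to a constant, the affine quermassintegral of \<open>K\<close> is \<open>J powr (- 1 / n)\<close>, where \<open>J\<close> is the
  integral over the Grassmannian of the power \<open>- n\<close> of the projection volumes. By the chain
  rule the theorem therefore follows from two facts about the Orlicz combinations \<open>K\<^sub>\<epsilon>\<close> of \<open>K\<close>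
  and \<open>L\<close>. For each fixed subspace \<open>\<xi>\<close> of dimension \<open>j\<close>, the volume of the projection of \<open>K\<^sub>\<epsilon>\<close>
  to \<open>\<xi>\<close> has at \<open>\<epsilon> = 0\<close> the right derivative \<open>j / \<phi>'(1-)\<close> times the Orlicz mixed volume of the
  projections of \<open>K\<close> and \<open>L\<close>; and this differentiation may be carried out under the integral
  that defines \<open>J\<close>.

  The second fact is dominated convergence. For small \<open>\<epsilon>\<close> one has \<open>K \<subseteq> K\<^sub>\<epsilon> \<subseteq> (1 + c \<epsilon>) K\<close> with
  \<open>c\<close> depending only on \<open>\<phi>\<close> and on the radii of balls inside and around the two bodies
  (\<open>orlicz_value_growth\<close>), so the difference quotients of the integrand are bounded uniformly
  in \<open>\<xi>\<close>. The projection volume depends measurably on \<open>\<xi>\<close> because, up to a constant factor, it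
  is the volume of a fibre of a closed set of pairs of a matrix and a point
  (\<open>measurable_projection_volume\<close>). The mixed volume is then measurable as a limit of
  difference quotients.

  For the first fact, projecting a body only restricts its support function. On the unit
  sphere, the support function of \<open>K\<^sub>\<epsilon>\<close> solves \<open>\<phi> (h\<^sub>K / \<rho>) + \<epsilon> \<phi> (h\<^sub>L / \<rho>) = 1\<close> for \<open>\<rho>\<close>, and
  expanding \<open>\<phi>\<close> to first order at \<open>1\<close> shows that it has the right derivative
  \<open>h\<^sub>K \<phi> (h\<^sub>L / h\<^sub>K) / \<phi>'(1-)\<close> (\<open>orlicz_value_quotient_limit\<close>). What remains is the first
  variation of volume (\<open>volume_variation\<close>): if support functions change at the rate \<open>g\<close>, then
  volume changes at the rate \<open>\<integral> g dS\<close>, where \<open>S\<close> is the surface area measure.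

  To see this, write the volume of a body of dimension \<open>j\<close> as \<open>(j + 1) \<integral> max 0 (1 - G)\<close> with
  its gauge \<open>G\<close>. As \<open>G x\<close> is the maximum of \<open>(x \<bullet> u) / h u\<close> over unit vectors \<open>u\<close>, its
  derivative with respect to \<open>h\<close> is given by the envelope theorem (\<open>danskin\<close>) at every \<open>x\<close>
  whose maximising \<open>u\<close> is unique, that is, at almost every \<open>x\<close> (\<open>AE_dir_deriv_opposite\<close>).
  Hence the derivative of the volume is the integral of \<open>g\<close> with respect to the image of a
  weighted Lebesgue measure under the Gauss map \<open>x \<mapsto> u\<close>.

  This image measure has to be identified with the surface area measure, which is defined by
  Hausdorff measure on the boundary (\<open>surface_area_measure_eq\<close>). A piece of the boundary whose
  normals are close to one vector \<open>u\<close> is nearly flat: central projection to the hyperplane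
  \<open>x \<bullet> u = h u\<close> distorts its distances by a factor close to \<open>1\<close>. In a hyperplane, Hausdorff
  measure is Lebesgue measure (\<open>hausdorff_outer_eq_frame\<close>, from the isodiametric inequality
  and Vitali's covering theorem), and the Lebesgue measure of the base of a cone determines
  the volume of the cone. Cutting the boundary into ever flatter pieces makes the errors
  disappear.
\<close>

section \<open>Lebesgue measure on the span of an orthonormal set\<close>

definition orthonormal_set :: "'a::euclidean_space set \<Rightarrow> bool" where
  "orthonormal_set B \<longleftrightarrow> pairwise orthogonal B \<and> (\<forall>b\<in>B. norm b = 1)"

lemma orthonormal_set_finite: "orthonormal_set B \<Longrightarrow> finite B"
  unfolding orthonormal_set_def by (rule pairwise_orthogonal_imp_finite) simp

lemma orthonormal_set_mono: "orthonormal_set B \<Longrightarrow> C \<subseteq> B \<Longrightarrow> orthonormal_set C"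
  unfolding orthonormal_set_def by (meson pairwise_mono subset_iff)

lemma orthonormal_set_inner:
  "orthonormal_set B \<Longrightarrow> b \<in> B \<Longrightarrow> c \<in> B \<Longrightarrow> b \<bullet> c = (if b = c then 1 else 0)"
  by (auto simp: orthonormal_set_def pairwise_def orthogonal_def norm_eq_1)

lemma orthonormal_set_independent: "orthonormal_set B \<Longrightarrow> independent B"
  unfolding orthonormal_set_def
  by (rule pairwise_orthogonal_independent) auto

lemma orthonormal_set_card: "orthonormal_set B \<Longrightarrow> dim (span B) = card B"
  by (simp add: orthonormal_set_independent dim_eq_card_independent dim_span)

lemma orthonormal_set_expand:
  assumes "orthonormal_set B" "x \<in> span B"
  shows "(\<Sum>b\<in>B. (x \<bullet> b) *\<^sub>R b) = x"
  using assms orthonormal_set_finite orthonormal_basis_expand unfolding orthonormal_set_def by blast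

lemma orthonormal_set_inner_sum:
  assumes "orthonormal_set B" "b \<in> B" "C \<subseteq> B"
  shows "(\<Sum>c\<in>C. f c *\<^sub>R c) \<bullet> b = (if b \<in> C then f b else 0)"
proof -
  have "(\<Sum>c\<in>C. f c *\<^sub>R c) \<bullet> b = (\<Sum>c\<in>C. if c = b then f c else 0)"
    unfolding inner_sum_left using assms
    by (intro sum.cong) (auto simp: orthonormal_set_inner subset_iff)
  also have "\<dots> = (if b \<in> C then f b else 0)"
    using finite_subset[OF assms(3) orthonormal_set_finite[OF assms(1)]] by simp
  finally show ?thesis .
qed

lemma orthonormal_set_norm_sum:
  assumes "orthonormal_set B"
  shows "norm (\<Sum>b\<in>B. f b *\<^sub>R b) = sqrt (\<Sum>b\<in>B. (f b)\<^sup>2)"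
proof -
  have "(\<Sum>b\<in>B. f b *\<^sub>R b) \<bullet> (\<Sum>b\<in>B. f b *\<^sub>R b) = (\<Sum>b\<in>B. (f b)\<^sup>2)"
    by (subst inner_sum_right)
       (simp add: orthonormal_set_inner_sum[OF assms] power2_eq_square)
  then show ?thesis by (simp add: norm_eq_sqrt_inner)
qed

lemma orthonormal_basis_through:
  fixes \<xi> :: "'a::euclidean_space set"
  assumes "subspace \<xi>" "u \<in> \<xi>" "norm u = 1"
  obtains B where "orthonormal_set (insert u B)" "u \<notin> B" "span (insert u B) = \<xi>"
proof -
  have sub: "subspace {x\<in>\<xi>. u \<bullet> x = 0}"
    using assms(1) by (auto simp: subspace_def inner_right_distrib)
  obtain B0 where B0: "B0 \<subseteq> {x\<in>\<xi>. u \<bullet> x = 0}" "pairwise orthogonal B0" "\<And>x. x \<in> B0 \<Longrightarrow> norm x = 1"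
    "independent B0" "card B0 = dim {x\<in>\<xi>. u \<bullet> x = 0}" "span B0 = {x\<in>\<xi>. u \<bullet> x = 0}"
    by (rule orthonormal_basis_subspace[OF sub]) blast
  have nB: "u \<notin> B0" using B0(1) assms(3) by (auto simp: norm_eq_1)
  have 1: "orthonormal_set (insert u B0)"
    using B0(1,2,3) assms(3) unfolding orthonormal_set_def
    by (auto simp: pairwise_insert orthogonal_def inner_commute)
  have "\<xi> \<subseteq> span (insert u B0)"
  proof
    fix x assume x: "x \<in> \<xi>"
    then have "x - (u \<bullet> x) *\<^sub>R u \<in> span B0"
      using assms by (simp add: B0(6) subspace_diff subspace_scale inner_diff_right norm_eq_1)
    then show "x \<in> span (insert u B0)" using span_breakdown_eq by metis
  qed
  moreover have "span (insert u B0) \<subseteq> \<xi>"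
    using B0(1) assms by (intro span_minimal) auto
  ultimately show ?thesis using that 1 nB by blast
qed

text \<open>
  Lebesgue measure on \<open>span B\<close>, as a measure on the ambient space. Using an explicit
  orthonormal set instead of a chosen basis of a subspace permits induction on \<open>B\<close> and
  splitting off a single direction. That only the span of \<open>B\<close> matters is shown below by
  translation invariance.
\<close>

definition frame_lborel :: "'a::euclidean_space set \<Rightarrow> 'a measure" where
  "frame_lborel B = distr (\<Pi>\<^sub>M b\<in>B. lborel) borel (\<lambda>c. \<Sum>b\<in>B. c b *\<^sub>R b)"

lemma sets_frame_lborel [simp, measurable_cong]: "sets (frame_lborel B) = sets borel"
  and space_frame_lborel [simp]: "space (frame_lborel B) = UNIV"
  by (simp_all add: frame_lborel_def)

lemma measurable_frame_sum [measurable]: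
  fixes B :: "'a::euclidean_space set"
  shows "(\<lambda>c. \<Sum>b\<in>B. c b *\<^sub>R b) \<in> borel_measurable (\<Pi>\<^sub>M b\<in>B. (lborel :: real measure))"
  by (intro borel_measurable_sum borel_measurable_scaleR borel_measurable_const)
     (use measurable_component_singleton[of _ B "\<lambda>_. lborel :: real measure"] in simp)

lemma AE_frame_lborel_span: "AE x in frame_lborel B. x \<in> span B"
proof -
  have [measurable]: "span B \<in> sets borel"
    by (rule borel_closed) (rule closed_span)
  show ?thesis unfolding frame_lborel_def
    by (subst AE_distr_iff) (auto intro!: AE_I2 span_sum span_scale simp: span_base)
qed

lemma emeasure_frame_cball_0:
  fixes B :: "'a::euclidean_space set"
  assumes "orthonormal_set B" "r > 0"
  shows "emeasure (frame_lborel B) (cball 0 r) = ennreal (unit_ball_vol (card B) * r ^ card B)"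
proof -
  have "emeasure (frame_lborel B) (cball 0 r) = emeasure (Pi\<^sub>M B (\<lambda>_. lborel))
      ((\<lambda>c. \<Sum>b\<in>B. c b *\<^sub>R b) -` cball 0 r \<inter> space (Pi\<^sub>M B (\<lambda>_. lborel)))"
    unfolding frame_lborel_def by (subst emeasure_distr) auto
  also have "(\<lambda>c. \<Sum>b\<in>B. c b *\<^sub>R b) -` cball 0 r = {f. sqrt (\<Sum>i\<in>B. (f i)\<^sup>2) \<le> r}"
    by (auto simp: orthonormal_set_norm_sum[OF assms(1)])
  finally show ?thesis using emeasure_cball_aux[OF orthonormal_set_finite[OF assms(1)] assms(2)] by simp
qed

lemma emeasure_frame_bounded:
  assumes "orthonormal_set B" "bounded S"
  shows "emeasure (frame_lborel B) S < \<infinity>"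
proof -
  obtain r where r: "r > 0" "S \<subseteq> cball 0 r"
    using assms(2) bounded_pos[of S] by (auto simp: subset_iff)
  have "emeasure (frame_lborel B) S \<le> emeasure (frame_lborel B) (cball 0 r)"
    using r by (intro emeasure_mono) auto
  then show ?thesis using emeasure_frame_cball_0[OF assms(1) r(1)] by (simp add: le_less_trans)
qed

lemma sigma_finite_frame_lborel:
  fixes B :: "'a::euclidean_space set"
  assumes "orthonormal_set B"
  shows "sigma_finite_measure (frame_lborel B)"
proof
  have "(\<Union>n::nat. cball 0 (real n)) = (UNIV :: 'a set)"
    using real_arch_simple by auto
  then show "\<exists>A. countable A \<and> A \<subseteq> sets (frame_lborel B) \<and> \<Union> A = space (frame_lborel B) \<and>
             (\<forall>a\<in>A. emeasure (frame_lborel B) a \<noteq> \<infinity>)"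
    using emeasure_frame_bounded[OF assms, of "cball 0 (real _)"]
    by (intro exI[of _ "range (\<lambda>n::nat. cball 0 (real n))"]) (auto simp: less_top)
qed

lemma nn_integral_frame_insert:
  fixes B :: "'a::euclidean_space set"
  assumes "orthonormal_set (insert b B)" "b \<notin> B" and f [measurable]: "f \<in> borel_measurable borel"
  shows "(\<integral>\<^sup>+x. f x \<partial>frame_lborel (insert b B)) =
           (\<integral>\<^sup>+t. \<integral>\<^sup>+y. f (t *\<^sub>R b + y) \<partial>frame_lborel B \<partial>lborel)"
proof -
  interpret product_sigma_finite "\<lambda>_::'a. lborel :: real measure" ..
  have fin: "finite B" using orthonormal_set_finite[OF assms(1)] by simp
  have "(\<integral>\<^sup>+x. f x \<partial>frame_lborel (insert b B)) =
      (\<integral>\<^sup>+c. f (\<Sum>i\<in>insert b B. c i *\<^sub>R i) \<partial>Pi\<^sub>M (insert b B) (\<lambda>_. lborel))"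
    unfolding frame_lborel_def by (subst nn_integral_distr) auto
  also have "\<dots> = (\<integral>\<^sup>+t. \<integral>\<^sup>+c. f (\<Sum>i\<in>insert b B. (c(b := t)) i *\<^sub>R i) \<partial>Pi\<^sub>M B (\<lambda>_. lborel) \<partial>lborel)"
    by (rule product_nn_integral_insert_rev) (use assms fin in auto)
  also have "\<dots> = (\<integral>\<^sup>+t. \<integral>\<^sup>+c. f (t *\<^sub>R b + (\<Sum>i\<in>B. c i *\<^sub>R i)) \<partial>Pi\<^sub>M B (\<lambda>_. lborel) \<partial>lborel)"
  proof (intro nn_integral_cong arg_cong[of _ _ f])
    fix t :: real and c :: "'a \<Rightarrow> real"
    have "(\<Sum>i\<in>B. (c(b := t)) i *\<^sub>R i) = (\<Sum>i\<in>B. c i *\<^sub>R i)"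
      using assms(2) by (intro sum.cong) auto
    then show "(\<Sum>i\<in>insert b B. (c(b := t)) i *\<^sub>R i) = t *\<^sub>R b + (\<Sum>i\<in>B. c i *\<^sub>R i)"
      using fin assms(2) by simp
  qed
  also have "\<dots> = (\<integral>\<^sup>+t. \<integral>\<^sup>+y. f (t *\<^sub>R b + y) \<partial>frame_lborel B \<partial>lborel)"
    unfolding frame_lborel_def by (subst nn_integral_distr) auto
  finally show ?thesis .
qed

lemma nn_integral_frame_empty:
  assumes [measurable]: "f \<in> borel_measurable borel"
  shows "(\<integral>\<^sup>+x. f x \<partial>frame_lborel {}) = f 0"
  unfolding frame_lborel_def
  by (subst nn_integral_distr) (auto simp: PiM_empty nn_integral_count_space_finite)

lemma nn_integral_lborel_translate:
  fixes f :: "'a::euclidean_space \<Rightarrow> ennreal"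
  assumes [measurable]: "f \<in> borel_measurable borel"
  shows "(\<integral>\<^sup>+x. f (v + x) \<partial>lborel) = (\<integral>\<^sup>+x. f x \<partial>lborel)"
  by (subst (2) lborel_distr_plus[of v, symmetric], subst nn_integral_distr) auto

lemma nn_integral_frame_translate:
  fixes B :: "'a::euclidean_space set"
  assumes "orthonormal_set B" "v \<in> span B" and [measurable]: "f \<in> borel_measurable borel"
  shows "(\<integral>\<^sup>+x. f (v + x) \<partial>frame_lborel B) = (\<integral>\<^sup>+x. f x \<partial>frame_lborel B)"
  using orthonormal_set_finite[OF assms(1)] assms
proof (induction B arbitrary: v f rule: finite_induct)
  case empty
  then show ?case by simp
next
  case (insert b B)
  note [measurable] = insert.prems(3)
  have oB: "orthonormal_set B" using insert.prems(1) by (rule orthonormal_set_mono) auto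
  obtain k where k: "v - k *\<^sub>R b \<in> span B" using insert.prems(2) span_breakdown_eq by metis
  interpret frame: sigma_finite_measure "frame_lborel B" by (rule sigma_finite_frame_lborel[OF oB])
  define g where "g s = (\<integral>\<^sup>+y. f (s *\<^sub>R b + y) \<partial>frame_lborel B)" for s
  have g [measurable]: "g \<in> borel_measurable borel" unfolding g_def by measurable
  have "(\<integral>\<^sup>+x. f (v + x) \<partial>frame_lborel (insert b B)) =
     (\<integral>\<^sup>+t. \<integral>\<^sup>+y. f (v + (t *\<^sub>R b + y)) \<partial>frame_lborel B \<partial>lborel)"
    by (rule nn_integral_frame_insert) (use insert in auto)
  also have "\<dots> = (\<integral>\<^sup>+t. \<integral>\<^sup>+y. f ((k + t) *\<^sub>R b + ((v - k *\<^sub>R b) + y)) \<partial>frame_lborel B \<partial>lborel)"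
    by (simp add: algebra_simps)
  also have "\<dots> = (\<integral>\<^sup>+t. g (k + t) \<partial>lborel)"
    unfolding g_def
    by (intro nn_integral_cong insert.IH[OF oB k, where f = "\<lambda>y. f ((k + _) *\<^sub>R b + y)"]) auto
  also have "\<dots> = (\<integral>\<^sup>+t. g t \<partial>lborel)" by (rule nn_integral_lborel_translate) auto
  also have "\<dots> = (\<integral>\<^sup>+x. f x \<partial>frame_lborel (insert b B))"
    unfolding g_def by (rule nn_integral_frame_insert[symmetric]) (use insert in auto)
  finally show ?case .
qed

lemma emeasure_frame_translate:
  fixes B :: "'a::euclidean_space set"
  assumes "orthonormal_set B" "v \<in> span B" and [measurable]: "A \<in> sets borel"
  shows "emeasure (frame_lborel B) {x. v + x \<in> A} = emeasure (frame_lborel B) A"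
proof -
  have "(\<integral>\<^sup>+x. indicator A (v + x) \<partial>frame_lborel B) = emeasure (frame_lborel B) A"
    by (subst nn_integral_frame_translate[OF assms(1,2)]) auto
  moreover have "(\<integral>\<^sup>+x. indicator A (v + x) \<partial>frame_lborel B) = (\<integral>\<^sup>+x. indicator {x. v + x \<in> A} x \<partial>frame_lborel B)"
    by (intro nn_integral_cong) (auto simp: indicator_def)
  moreover have "{x. v + x \<in> A} \<in> sets borel"
  proof -
    have "{x\<in>space borel. v + x \<in> A} \<in> sets borel" by measurable
    then show ?thesis by simp
  qed
  ultimately show ?thesis by simp
qed

lemma nn_integral_frame_scale:
  fixes B :: "'a::euclidean_space set"
  assumes "orthonormal_set B" "c > 0" and [measurable]: "f \<in> borel_measurable borel"
  shows "(\<integral>\<^sup>+x. f x \<partial>frame_lborel B) = ennreal (c ^ card B) * (\<integral>\<^sup>+x. f (c *\<^sub>R x) \<partial>frame_lborel B)"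
  using orthonormal_set_finite[OF assms(1)] assms
proof (induction B arbitrary: f rule: finite_induct)
  case empty
  then show ?case by (simp add: nn_integral_frame_empty)
next
  case (insert b B)
  note [measurable] = insert.prems(3)
  have oB: "orthonormal_set B" using insert.prems(1) by (rule orthonormal_set_mono) auto
  interpret frame: sigma_finite_measure "frame_lborel B" by (rule sigma_finite_frame_lborel[OF oB])
  have "(\<integral>\<^sup>+x. f x \<partial>frame_lborel (insert b B)) =
     (\<integral>\<^sup>+t. \<integral>\<^sup>+y. f (t *\<^sub>R b + y) \<partial>frame_lborel B \<partial>lborel)"
    by (rule nn_integral_frame_insert) (use insert in auto)
  also have "\<dots> = (\<integral>\<^sup>+t. ennreal (c ^ card B) * (\<integral>\<^sup>+y. f (t *\<^sub>R b + c *\<^sub>R y) \<partial>frame_lborel B) \<partial>lborel)"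
    by (intro nn_integral_cong insert.IH[OF oB insert.prems(2)]) auto
  also have "\<dots> = ennreal \<bar>c\<bar> * (\<integral>\<^sup>+t. ennreal (c ^ card B) * (\<integral>\<^sup>+y. f ((0 + c * t) *\<^sub>R b + c *\<^sub>R y) \<partial>frame_lborel B) \<partial>lborel)"
    by (rule nn_integral_real_affine) (use insert.prems(2) in auto)
  also have "\<dots> = ennreal (c ^ card (insert b B)) * (\<integral>\<^sup>+t. (\<integral>\<^sup>+y. f (c *\<^sub>R (t *\<^sub>R b + y)) \<partial>frame_lborel B) \<partial>lborel)"
    using insert.prems(2) insert.hyps
    by (subst nn_integral_cmult) (auto simp: ennreal_mult scaleR_add_right mult.assoc)
  also have "(\<integral>\<^sup>+t. (\<integral>\<^sup>+y. f (c *\<^sub>R (t *\<^sub>R b + y)) \<partial>frame_lborel B) \<partial>lborel) =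
      (\<integral>\<^sup>+x. f (c *\<^sub>R x) \<partial>frame_lborel (insert b B))"
    by (rule nn_integral_frame_insert[symmetric]) (use insert in auto)
  finally show ?case .
qed

lemma emeasure_frame_scale:
  fixes B :: "'a::euclidean_space set"
  assumes "orthonormal_set B" "c > 0" and [measurable]: "A \<in> sets borel"
  shows "emeasure (frame_lborel B) A = ennreal (c ^ card B) * emeasure (frame_lborel B) {x. c *\<^sub>R x \<in> A}"
proof -
  have "{x\<in>space borel. c *\<^sub>R x \<in> A} \<in> sets borel" by measurable
  then have [measurable]: "{x. c *\<^sub>R x \<in> A} \<in> sets borel" by simp
  have "emeasure (frame_lborel B) A = (\<integral>\<^sup>+x. indicator A x \<partial>frame_lborel B)" by simp
  also have "\<dots> = ennreal (c ^ card B) * (\<integral>\<^sup>+x. indicator A (c *\<^sub>R x) \<partial>frame_lborel B)"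
    by (rule nn_integral_frame_scale[OF assms(1,2)]) auto
  also have "(\<integral>\<^sup>+x. indicator A (c *\<^sub>R x) \<partial>frame_lborel B) = (\<integral>\<^sup>+x. indicator {x. c *\<^sub>R x \<in> A} x \<partial>frame_lborel B)"
    by (intro nn_integral_cong) (auto simp: indicator_def)
  finally show ?thesis by simp
qed

lemma emeasure_frame_cball:
  fixes B :: "'a::euclidean_space set"
  assumes "orthonormal_set B" "x \<in> span B" "r > 0"
  shows "emeasure (frame_lborel B) (cball x r) = ennreal (unit_ball_vol (card B) * r ^ card B)"
proof -
  have "emeasure (frame_lborel B) {y. x + y \<in> cball x r} = emeasure (frame_lborel B) (cball x r)"
    by (rule emeasure_frame_translate) (use assms in auto)
  moreover have "{y. x + y \<in> cball x r} = cball 0 r" by (auto simp: dist_norm)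
  ultimately show ?thesis using emeasure_frame_cball_0[OF assms(1,3)] by simp
qed

text \<open>
  The usual proof that Haar measure is unique: integrating \<open>1\<^sub>A(x) 1\<^sub>C(y - x)\<close> with \<open>C\<close> the
  unit ball over both variables gives \<open>M A * N C\<close> if \<open>y\<close> is shifted by \<open>x\<close>, and \<open>N A * M C\<close> if
  \<open>x\<close> is shifted by \<open>y\<close>. The ball is symmetric, so the sign of its argument does not matter.
\<close>

lemma translation_invariant_measure_unique:
  fixes M N :: "'a::euclidean_space measure"
  assumes "sigma_finite_measure M" "sigma_finite_measure N"
    and sets [measurable_cong, simp]: "sets M = sets borel" "sets N = sets borel"
    and AE: "AE x in M. x \<in> V" "AE x in N. x \<in> V" and V: "subspace V"
    and tM: "\<And>v f. v \<in> V \<Longrightarrow> f \<in> borel_measurable borel \<Longrightarrow> (\<integral>\<^sup>+x. f (v + x) \<partial>M) = (\<integral>\<^sup>+x. f x \<partial>M)"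
    and tN: "\<And>v f. v \<in> V \<Longrightarrow> f \<in> borel_measurable borel \<Longrightarrow> (\<integral>\<^sup>+x. f (v + x) \<partial>N) = (\<integral>\<^sup>+x. f x \<partial>N)"
    and ball: "emeasure M (cball 0 1) = emeasure N (cball 0 1)"
      "emeasure M (cball 0 1) \<noteq> 0" "emeasure M (cball 0 1) \<noteq> \<infinity>"
  shows "M = N"
proof (rule measure_eqI)
  fix A assume "A \<in> sets M"
  then have [measurable]: "A \<in> sets borel" by simp
  interpret M: sigma_finite_measure M by fact
  interpret N: sigma_finite_measure N by fact
  interpret MN: pair_sigma_finite M N ..
  let ?C = "indicator (cball 0 1) :: 'a \<Rightarrow> ennreal"
  let ?A = "indicator A :: 'a \<Rightarrow> ennreal"
  have [measurable]: "cball (0::'a) 1 \<in> sets borel" by simp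
  have mC: "?C \<in> borel_measurable borel" and mA: "?A \<in> borel_measurable borel" by (auto intro!: borel_measurable_indicator)
  have "emeasure M A * emeasure N (cball 0 1) = (\<integral>\<^sup>+x. ?A x * (\<integral>\<^sup>+y. ?C y \<partial>N) \<partial>M)"
    by (simp add: nn_integral_multc)
  also have "\<dots> = (\<integral>\<^sup>+x. (\<integral>\<^sup>+y. ?A x * ?C (y - x) \<partial>N) \<partial>M)"
  proof (rule nn_integral_cong_AE)
    show "AE x in M. ?A x * (\<integral>\<^sup>+y. ?C y \<partial>N) = (\<integral>\<^sup>+y. ?A x * ?C (y - x) \<partial>N)"
      using AE(1)
    proof eventually_elim
      case (elim x)
      then have "-x \<in> V" using V subspace_neg by blast
      from tN[OF this mC] have "(\<integral>\<^sup>+y. ?C (y - x) \<partial>N) = (\<integral>\<^sup>+y. ?C y \<partial>N)" by simp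
      moreover have "(\<lambda>y. ?C (y - x)) \<in> borel_measurable N" by measurable
      ultimately show ?case by (simp add: nn_integral_cmult)
    qed
  qed
  also have "\<dots> = (\<integral>\<^sup>+y. (\<integral>\<^sup>+x. ?A x * ?C (y - x) \<partial>M) \<partial>N)"
    by (rule MN.Fubini'[symmetric]) measurable
  also have "\<dots> = (\<integral>\<^sup>+y. (\<integral>\<^sup>+z. ?A (y + z) * ?C (- z) \<partial>M) \<partial>N)"
  proof (rule nn_integral_cong_AE)
    show "AE y in N. (\<integral>\<^sup>+x. ?A x * ?C (y - x) \<partial>M) = (\<integral>\<^sup>+z. ?A (y + z) * ?C (- z) \<partial>M)"
      using AE(2)
    proof eventually_elim
      case (elim y)
      from tM[OF this, of "\<lambda>x. ?A x * ?C (y - x)"] show ?case by simp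
    qed
  qed
  also have "\<dots> = (\<integral>\<^sup>+z. (\<integral>\<^sup>+y. ?A (y + z) * ?C (- z) \<partial>N) \<partial>M)"
    by (rule MN.Fubini') measurable
  also have "\<dots> = (\<integral>\<^sup>+z. emeasure N A * ?C (- z) \<partial>M)"
  proof (rule nn_integral_cong_AE)
    show "AE z in M. (\<integral>\<^sup>+y. ?A (y + z) * ?C (- z) \<partial>N) = emeasure N A * ?C (- z)"
      using AE(1)
    proof eventually_elim
      case (elim z)
      from tN[OF this mA] have "(\<integral>\<^sup>+y. ?A (y + z) \<partial>N) = emeasure N A"
        by (simp add: add.commute)
      then show ?case by (subst nn_integral_multc) simp_all
    qed
  qed
  also have "\<dots> = (\<integral>\<^sup>+z. emeasure N A * ?C z \<partial>M)"
    by (intro nn_integral_cong) (auto simp: indicator_def)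
  also have "\<dots> = emeasure N A * emeasure M (cball 0 1)"
    by (subst nn_integral_cmult) auto
  finally show "emeasure M A = emeasure N A"
    using ball by (metis ennreal_mult_divide_eq infinity_ennreal_def)
qed simp

lemma frame_lborel_cong_span:
  fixes B C :: "'a::euclidean_space set"
  assumes "orthonormal_set B" "orthonormal_set C" "span B = span C"
  shows "frame_lborel B = frame_lborel C"
proof (rule translation_invariant_measure_unique[where V = "span B"])
  have c: "card B = card C" using assms orthonormal_set_card by metis
  show "emeasure (frame_lborel B) (cball 0 1) = emeasure (frame_lborel C) (cball 0 1)"
    "emeasure (frame_lborel B) (cball 0 1) \<noteq> 0"
    "emeasure (frame_lborel B) (cball 0 1) \<noteq> \<infinity>"
    using assms c unit_ball_vol_pos[of "card C"] by (simp_all add: emeasure_frame_cball_0 less_imp_neq[symmetric])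
qed (use assms AE_frame_lborel_span[of B] AE_frame_lborel_span[of C] in
     \<open>auto intro: sigma_finite_frame_lborel nn_integral_frame_translate\<close>)

lemma frame_lborel_UNIV:
  fixes B :: "'a::euclidean_space set"
  assumes "orthonormal_set B" "span B = UNIV"
  shows "frame_lborel B = lborel"
proof (rule translation_invariant_measure_unique[where V = UNIV])
  have c: "card B = DIM('a)" using assms orthonormal_set_card dim_UNIV by metis
  show "emeasure (frame_lborel B) (cball 0 1) = emeasure lborel (cball 0 1 :: 'a set)"
    "emeasure (frame_lborel B) (cball 0 1) \<noteq> 0"
    "emeasure (frame_lborel B) (cball 0 1) \<noteq> \<infinity>"
    using assms c unit_ball_vol_pos[of "DIM('a)"] by (simp_all add: emeasure_frame_cball_0 emeasure_cball less_imp_neq[symmetric])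
qed (use assms in \<open>auto intro: sigma_finite_frame_lborel nn_integral_frame_translate
       nn_integral_lborel_translate lborel.sigma_finite_measure_axioms\<close>)

lemma nn_integral_frame_Un:
  fixes B C :: "'a::euclidean_space set"
  assumes "orthonormal_set (B \<union> C)" "B \<inter> C = {}" and [measurable]: "f \<in> borel_measurable borel"
  shows "(\<integral>\<^sup>+x. f x \<partial>frame_lborel (B \<union> C)) = (\<integral>\<^sup>+x. \<integral>\<^sup>+y. f (x + y) \<partial>frame_lborel C \<partial>frame_lborel B)"
proof -
  have "finite B" using orthonormal_set_finite[OF assms(1)] by simp
  then show ?thesis using assms
  proof (induction B arbitrary: f rule: finite_induct)
    case empty
    note [measurable] = empty.prems(3)
    interpret C: sigma_finite_measure "frame_lborel C"
      by (rule sigma_finite_frame_lborel) (use empty in simp)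
    show ?case by (simp add: nn_integral_frame_empty)
  next
    case (insert b B)
    note [measurable] = insert.prems(3)
    have o: "orthonormal_set (B \<union> C)" "orthonormal_set C" "orthonormal_set (insert b B)"
      using insert.prems(1) by (auto elim: orthonormal_set_mono)
    interpret C: sigma_finite_measure "frame_lborel C"
      by (rule sigma_finite_frame_lborel[OF o(2)])
    have "(\<integral>\<^sup>+x. f x \<partial>frame_lborel (insert b B \<union> C)) = (\<integral>\<^sup>+t. \<integral>\<^sup>+y. f (t *\<^sub>R b + y) \<partial>frame_lborel (B \<union> C) \<partial>lborel)"
      using insert by (simp add: nn_integral_frame_insert)
    also have "\<dots> = (\<integral>\<^sup>+t. \<integral>\<^sup>+x. \<integral>\<^sup>+y. f (t *\<^sub>R b + (x + y)) \<partial>frame_lborel C \<partial>frame_lborel B \<partial>lborel)"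
      by (intro nn_integral_cong insert.IH[OF o(1)]) (use insert in auto)
    also have "\<dots> = (\<integral>\<^sup>+t. \<integral>\<^sup>+x. \<integral>\<^sup>+y. f ((t *\<^sub>R b + x) + y) \<partial>frame_lborel C \<partial>frame_lborel B \<partial>lborel)"
      by (simp add: add.assoc)
    also have "\<dots> = (\<integral>\<^sup>+x. \<integral>\<^sup>+y. f (x + y) \<partial>frame_lborel C \<partial>frame_lborel (insert b B))"
      using insert o by (intro nn_integral_frame_insert[symmetric]) auto
    finally show ?case .
  qed
qed

lemma subspace_lborel_eq_frame:
  fixes B :: "(real^'n) set"
  assumes "orthonormal_set B" "span B = \<xi>"
  shows "subspace_lborel \<xi> = frame_lborel B"
proof -
  let ?P = "\<lambda>B. B \<subseteq> \<xi> \<and> pairwise orthogonal B \<and> (\<forall>b\<in>B. norm b = 1) \<and> span B = \<xi>"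
  have "?P (SOME B. ?P B)"
    using assms span_superset[of B] by (intro someI[of ?P B]) (auto simp: orthonormal_set_def)
  then have "frame_lborel (SOME B. ?P B) = frame_lborel B"
    using assms by (intro frame_lborel_cong_span) (auto simp: orthonormal_set_def)
  then show ?thesis by (simp add: subspace_lborel_def frame_lborel_def Let_def)
qed

section \<open>The isodiametric inequality in a subspace\<close>

lemma nn_integral_frame_insert_rev:
  fixes B :: "'a::euclidean_space set"
  assumes o: "orthonormal_set (insert b B)" and b: "b \<notin> B" and f [measurable]: "f \<in> borel_measurable borel"
  shows "(\<integral>\<^sup>+x. f x \<partial>frame_lborel (insert b B)) =
           (\<integral>\<^sup>+y. \<integral>\<^sup>+t. f (t *\<^sub>R b + y) \<partial>lborel \<partial>frame_lborel B)"
proof -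
  interpret B: sigma_finite_measure "frame_lborel B"
    by (rule sigma_finite_frame_lborel) (use orthonormal_set_mono[OF o] in blast)
  interpret pair_sigma_finite lborel "frame_lborel B" ..
  show ?thesis
    unfolding nn_integral_frame_insert[OF o b f] by (rule Fubini'[symmetric]) measurable
qed

text \<open>
  The length of the section of \<open>C\<close> by the line through \<open>x\<close> in direction \<open>b\<close>. The line is
  parametrised so that the parameter is the inner product with \<open>b\<close>; hence all points of one
  line have the same value.
\<close>

definition steiner_len :: "'a::euclidean_space \<Rightarrow> 'a set \<Rightarrow> 'a \<Rightarrow> ennreal" where
  "steiner_len b C x = (\<integral>\<^sup>+s. indicator C (x + (s - x \<bullet> b) *\<^sub>R b) \<partial>lborel)"

text \<open>
  Each section of \<open>C\<close> in direction \<open>b\<close> is replaced by a centred interval of the same length.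
  With the strict inequality this interval is open, so it is nonempty exactly where the
  section of \<open>C\<close> has positive length.
\<close>

definition steiner_sym :: "'a::euclidean_space \<Rightarrow> 'a set \<Rightarrow> 'a set" where
  "steiner_sym b C = {x. ennreal (2 * \<bar>x \<bullet> b\<bar>) < steiner_len b C x}"

lemma measurable_steiner_len [measurable]:
  assumes [measurable]: "C \<in> sets borel"
  shows "steiner_len b C \<in> borel_measurable borel"
  unfolding steiner_len_def by measurable

lemma steiner_sym_measurable:
  assumes [measurable]: "C \<in> sets borel"
  shows "steiner_sym b C \<in> sets borel"
proof -
  have "{x\<in>space borel. ennreal (2 * \<bar>x \<bullet> b\<bar>) < steiner_len b C x} \<in> sets borel" by measurable
  then show ?thesis by (simp add: steiner_sym_def)
qed

lemma emeasure_centred_interval: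
  fixes l :: ennreal
  shows "(\<integral>\<^sup>+t. indicator {t. ennreal (2 * \<bar>t\<bar>) < l} t \<partial>lborel) = l"
proof (cases l)
  case (real r)
  then have "{t::real. ennreal (2 * \<bar>t\<bar>) < l} = {-(r/2)<..<r/2}"
    by (auto simp: ennreal_less_iff)
  then show ?thesis using real by (simp add: field_simps)
next
  case top
  then have "{t::real. ennreal (2 * \<bar>t\<bar>) < l} = UNIV" by auto
  then show ?thesis using top by simp
qed

lemma emeasure_steiner_sym:
  fixes B :: "'a::euclidean_space set"
  assumes o: "orthonormal_set B" and b: "b \<in> B" and [measurable]: "C \<in> sets borel"
  shows "emeasure (frame_lborel B) (steiner_sym b C) = emeasure (frame_lborel B) C"
proof -
  define B' where "B' = B - {b}"
  have B: "B = insert b B'" "b \<notin> B'" using b by (auto simp: B'_def)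
  have oB: "orthonormal_set (insert b B')" using o B by simp
  have [measurable]: "steiner_sym b C \<in> sets borel" by (rule steiner_sym_measurable) simp
  have 1: "(\<integral>\<^sup>+t. indicator (steiner_sym b C) (t *\<^sub>R b + y) \<partial>lborel) =
           (\<integral>\<^sup>+s. indicator C (s *\<^sub>R b + y) \<partial>lborel)" if y: "y \<in> span B'" for y
  proof -
    have "\<forall>c\<in>B'. orthogonal b c"
      using oB B(2) by (auto simp: orthonormal_set_def pairwise_insert)
    then have yb: "y \<bullet> b = 0" using orthogonal_to_span[OF y] by (simp add: orthogonal_def inner_commute)
    have bb: "b \<bullet> b = 1" using oB by (auto simp: orthonormal_set_def norm_eq_1)
    have "steiner_len b C (t *\<^sub>R b + y) = (\<integral>\<^sup>+s. indicator C (s *\<^sub>R b + y) \<partial>lborel)" for t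
      unfolding steiner_len_def using yb bb by (simp add: inner_add_left algebra_simps)
    then have "(\<lambda>t. indicator (steiner_sym b C) (t *\<^sub>R b + y) :: ennreal) =
        indicator {t. ennreal (2 * \<bar>t\<bar>) < (\<integral>\<^sup>+s. indicator C (s *\<^sub>R b + y) \<partial>lborel)}"
      using yb bb by (auto simp: fun_eq_iff indicator_def steiner_sym_def inner_add_left)
    then show ?thesis using emeasure_centred_interval by simp
  qed
  have "emeasure (frame_lborel B) (steiner_sym b C) =
      (\<integral>\<^sup>+y. \<integral>\<^sup>+t. indicator (steiner_sym b C) (t *\<^sub>R b + y) \<partial>lborel \<partial>frame_lborel B')"
    unfolding B(1) by (subst nn_integral_frame_insert_rev[OF oB B(2), symmetric]) auto
  also have "\<dots> = (\<integral>\<^sup>+y. \<integral>\<^sup>+t. indicator C (t *\<^sub>R b + y) \<partial>lborel \<partial>frame_lborel B')"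
    using AE_frame_lborel_span[of B'] by (intro nn_integral_cong_AE) (auto elim!: eventually_mono simp: 1)
  also have "\<dots> = emeasure (frame_lborel B) C"
    unfolding B(1) by (subst nn_integral_frame_insert_rev[OF oB B(2), symmetric]) auto
  finally show ?thesis .
qed

text \<open>
  The largest distance between points of two sets on the line is at least the mean of their
  lengths, because \<open>(Sup S - Inf T) + (Sup T - Inf S)\<close> is the sum of their diameters. For this
  reason Steiner symmetrisation does not increase the diameter.
\<close>

lemma emeasure_lborel_pair_le:
  fixes S T :: "real set"
  assumes "S \<noteq> {}" "T \<noteq> {}" and K: "\<And>s t. s \<in> S \<Longrightarrow> t \<in> T \<Longrightarrow> \<bar>s - t\<bar> \<le> K"
    and ab: "ennreal a < emeasure lborel S" "ennreal b < emeasure lborel T" "0 \<le> a" "0 \<le> b"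
  shows "a + b \<le> 2 * K"
proof -
  obtain s0 t0 where st: "s0 \<in> S" "t0 \<in> T" using assms by auto
  have S: "bdd_above S" "bdd_below S"
    using K[OF _ st(2)] by (auto simp: abs_le_iff intro!: bdd_aboveI[of _ "t0 + K"] bdd_belowI[of _ "t0 - K"]) (smt (verit))+
  have T: "bdd_above T" "bdd_below T"
    using K[OF st(1)] by (auto simp: abs_le_iff intro!: bdd_aboveI[of _ "s0 + K"] bdd_belowI[of _ "s0 - K"]) (smt (verit))+
  have len: "e < Sup U - Inf U" if U: "U \<noteq> {}" "bdd_above U" "bdd_below U" "ennreal e < emeasure lborel U" "0 \<le> e" for e and U :: "real set"
  proof -
    have "U \<subseteq> {Inf U..Sup U}" using U by (auto intro: cInf_lower cSup_upper)
    then have "emeasure lborel U \<le> emeasure lborel {Inf U..Sup U}" by (intro emeasure_mono) auto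
    also have "\<dots> = ennreal (Sup U - Inf U)" using U by (simp add: cInf_le_cSup)
    finally have "ennreal e < ennreal (Sup U - Inf U)" using U by simp
    then show ?thesis using U by (simp add: ennreal_less_iff)
  qed
  have d: "Sup U - Inf V \<le> K" if UV: "U \<noteq> {}" "V \<noteq> {}" "\<And>s t. s \<in> U \<Longrightarrow> t \<in> V \<Longrightarrow> \<bar>s - t\<bar> \<le> K" for U V :: "real set"
  proof -
    have "Sup U \<le> t + K" if "t \<in> V" for t
      using UV(3)[OF _ that] by (intro cSup_least UV) (smt (verit))
    then have "Sup U - K \<le> Inf V" by (intro cInf_greatest UV) (smt (verit))
    then show ?thesis by simp
  qed
  have "Sup S - Inf T \<le> K" using assms by (intro d) auto
  moreover have "Sup T - Inf S \<le> K"
    by (rule d[OF assms(2,1)]) (metis K abs_minus_commute)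
  ultimately show ?thesis using len[of S a] len[of T b] S T assms by linarith
qed

lemma norm_pythagoras_line:
  fixes b :: "'a::euclidean_space"
  assumes "norm b = 1" "p \<bullet> b = 0"
  shows "(norm (p + s *\<^sub>R b))\<^sup>2 = (norm p)\<^sup>2 + s\<^sup>2"
proof -
  have "b \<bullet> b = 1" "b \<bullet> p = 0" using assms by (simp_all add: norm_eq_1 inner_commute)
  then show ?thesis using assms(2) unfolding power2_norm_eq_inner
    by (simp add: inner_add power2_eq_square)
qed

text \<open>
  Two points of the symmetrised set lie on two parallel lines. By the previous estimate, the
  sections of \<open>C\<close> on these lines contain points that are, up to an arbitrarily small error, at
  least as far apart in direction \<open>b\<close>; the component orthogonal to \<open>b\<close> depends on the lines
  only.
\<close>

lemma steiner_sym_dist_le: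
  fixes b :: "'a::euclidean_space"
  assumes b: "norm b = 1" and D: "\<And>x y. x \<in> C \<Longrightarrow> y \<in> C \<Longrightarrow> norm (x - y) \<le> D"
    and C [measurable]: "C \<in> sets borel"
    and x: "x \<in> steiner_sym b C" and y: "y \<in> steiner_sym b C"
  shows "norm (x - y) \<le> D"
proof -
  define sec where "sec z = {s. z + (s - z \<bullet> b) *\<^sub>R b \<in> C}" for z
  have bb: "b \<bullet> b = 1" using b by (simp add: norm_eq_1)
  have secm: "sec z \<in> sets borel" for z
  proof -
    have "{s\<in>space borel. z + (s - z \<bullet> b) *\<^sub>R b \<in> C} \<in> sets borel" by measurable
    then show ?thesis by (simp add: sec_def)
  qed
  have len: "steiner_len b C z = emeasure lborel (sec z)" for z
  proof -
    have "steiner_len b C z = (\<integral>\<^sup>+s. indicator (sec z) s \<partial>lborel)"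
      unfolding steiner_len_def sec_def by (intro nn_integral_cong) (auto simp: indicator_def)
    then show ?thesis using secm[of z] by simp
  qed
  have pos: "ennreal (2 * \<bar>z \<bullet> b\<bar>) < emeasure lborel (sec z)" if "z \<in> steiner_sym b C" for z
    using that by (simp add: steiner_sym_def len)
  have ne: "sec z \<noteq> {}" if "z \<in> steiner_sym b C" for z
    using pos[OF that] by auto
  \<comment> \<open>the part of \<open>x - y\<close> orthogonal to \<open>b\<close>; any two points of the two lines differ by \<open>q\<close>
    and a multiple of \<open>b\<close>\<close>
  define q where "q = (x - (x \<bullet> b) *\<^sub>R b) - (y - (y \<bullet> b) *\<^sub>R b)"
  have qb: "q \<bullet> b = 0" by (simp add: q_def inner_diff_left bb)
  define K where "K = sqrt (D\<^sup>2 - (norm q)\<^sup>2)"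
  have sq: "(norm q)\<^sup>2 + (s - t)\<^sup>2 \<le> D\<^sup>2" if "s \<in> sec x" "t \<in> sec y" for s t
  proof -
    have "norm ((x + (s - x \<bullet> b) *\<^sub>R b) - (y + (t - y \<bullet> b) *\<^sub>R b)) \<le> D"
      using that by (intro D) (auto simp: sec_def)
    moreover have "(x + (s - x \<bullet> b) *\<^sub>R b) - (y + (t - y \<bullet> b) *\<^sub>R b) = q + (s - t) *\<^sub>R b"
      by (simp add: q_def algebra_simps)
    ultimately have "norm (q + (s - t) *\<^sub>R b) \<le> D" by simp
    then have "(norm (q + (s - t) *\<^sub>R b))\<^sup>2 \<le> D\<^sup>2" by (simp add: power_mono)
    then show ?thesis using norm_pythagoras_line[OF b qb] by simp
  qed
  have K: "\<bar>s - t\<bar> \<le> K" if "s \<in> sec x" "t \<in> sec y" for s t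
    using sq[OF that] unfolding K_def by (intro real_le_rsqrt) simp
  have "2 * \<bar>x \<bullet> b\<bar> + 2 * \<bar>y \<bullet> b\<bar> \<le> 2 * K"
    by (rule emeasure_lborel_pair_le[OF ne[OF x] ne[OF y] K pos[OF x] pos[OF y]]) auto
  then have k: "\<bar>x \<bullet> b - y \<bullet> b\<bar> \<le> K" by linarith
  obtain s t where st: "s \<in> sec x" "t \<in> sec y" using ne x y by blast
  have nn: "0 \<le> D\<^sup>2 - (norm q)\<^sup>2" using sq[OF st] zero_le_power2[of "s - t"] by linarith
  have "(x \<bullet> b - y \<bullet> b)\<^sup>2 \<le> K\<^sup>2" using k by (simp add: abs_le_square_iff[symmetric])
  then have "(norm q)\<^sup>2 + (x \<bullet> b - y \<bullet> b)\<^sup>2 \<le> D\<^sup>2" using nn by (simp add: K_def)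
  moreover have "x - y = q + (x \<bullet> b - y \<bullet> b) *\<^sub>R b" by (simp add: q_def algebra_simps)
  ultimately have "(norm (x - y))\<^sup>2 \<le> D\<^sup>2" using norm_pythagoras_line[OF b qb] by simp
  moreover have "0 \<le> D"
    using D[of "x + (s - x \<bullet> b) *\<^sub>R b" "x + (s - x \<bullet> b) *\<^sub>R b"] st by (simp add: sec_def)
  ultimately show ?thesis by (simp add: power2_le_iff_abs_le)
qed

definition refl_along :: "'a::euclidean_space \<Rightarrow> 'a \<Rightarrow> 'a" where
  "refl_along b x = x - (2 * (x \<bullet> b)) *\<^sub>R b"

lemma refl_along_invol: "norm b = 1 \<Longrightarrow> refl_along b (refl_along b x) = x"
proof -
  assume "norm b = 1"
  then have "refl_along b (refl_along b x) = x + (- 2 * (x \<bullet> b) + 2 * (x \<bullet> b)) *\<^sub>R b"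
    unfolding refl_along_def by (simp add: inner_diff_left norm_eq_1 algebra_simps)
  then show ?thesis by simp
qed

lemma refl_along_steiner_sym:
  assumes "norm b = 1" "x \<in> steiner_sym b C"
  shows "refl_along b x \<in> steiner_sym b C"
proof -
  have i: "refl_along b x \<bullet> b = - (x \<bullet> b)"
    using assms(1) by (simp add: refl_along_def inner_diff_left norm_eq_1)
  have "refl_along b x + (s + x \<bullet> b) *\<^sub>R b = x + (s - x \<bullet> b) *\<^sub>R b" for s
    unfolding refl_along_def by (simp add: algebra_simps flip: scaleR_add_left)
  then show ?thesis using assms(2) by (simp add: steiner_sym_def steiner_len_def i)
qed

text \<open>
  Symmetrising in a further orthogonal direction keeps the symmetries obtained before.
\<close>

lemma refl_along_steiner_sym_orth:
  assumes "norm c = 1" "b \<bullet> c = 0" and sym: "\<And>x. x \<in> C \<Longrightarrow> refl_along c x \<in> C"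
    and "x \<in> steiner_sym b C"
  shows "refl_along c x \<in> steiner_sym b C"
proof -
  have i: "refl_along c x \<bullet> b = x \<bullet> b"
    using assms(2) by (simp add: refl_along_def inner_diff_left inner_commute[of c b])
  have "refl_along c x + (s - x \<bullet> b) *\<^sub>R b = refl_along c (x + (s - x \<bullet> b) *\<^sub>R b)" for s
    using assms(2) by (simp add: refl_along_def inner_add_left algebra_simps)
  moreover have "refl_along c z \<in> C \<longleftrightarrow> z \<in> C" for z
    using sym refl_along_invol[OF assms(1)] by metis
  ultimately show ?thesis using assms(4) by (simp add: steiner_sym_def steiner_len_def i indicator_def)
qed

lemma steiner_sym_subset_span:
  assumes "b \<in> B" "C \<subseteq> span B"
  shows "steiner_sym b C \<subseteq> span B"
proof
  fix x assume "x \<in> steiner_sym b C"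
  then have "steiner_len b C x \<noteq> 0" by (auto simp: steiner_sym_def)
  have "\<exists>s. x + (s - x \<bullet> b) *\<^sub>R b \<in> C"
  proof (rule ccontr)
    assume "\<not> ?thesis"
    then have "steiner_len b C x = 0" by (simp add: steiner_len_def)
    with \<open>steiner_len b C x \<noteq> 0\<close> show False by simp
  qed
  then obtain s where "x + (s - x \<bullet> b) *\<^sub>R b \<in> C" by blast
  then have "x + (s - x \<bullet> b) *\<^sub>R b \<in> span B" using assms by blast
  moreover have "(s - x \<bullet> b) *\<^sub>R b \<in> span B" using assms by (simp add: span_base span_scale)
  ultimately show "x \<in> span B" using span_add_eq2 by blast
qed

lemma exists_symmetrization:
  fixes B :: "'a::euclidean_space set"
  assumes o: "orthonormal_set B" and F: "F \<subseteq> B" and C: "C \<in> sets borel" "C \<subseteq> span B"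
    and D: "\<And>x y. x \<in> C \<Longrightarrow> y \<in> C \<Longrightarrow> norm (x - y) \<le> D"
  shows "\<exists>C'\<in>sets borel. C' \<subseteq> span B \<and> (\<forall>x\<in>C'. \<forall>y\<in>C'. norm (x - y) \<le> D) \<and>
     emeasure (frame_lborel B) C' = emeasure (frame_lborel B) C \<and> (\<forall>b\<in>F. \<forall>x\<in>C'. refl_along b x \<in> C')"
  using finite_subset[OF F orthonormal_set_finite[OF o]] F
proof (induction F rule: finite_induct)
  case empty
  then show ?case using C D by blast
next
  case (insert b F)
  then have "F \<subseteq> B" by simp
  from insert.IH[OF this] obtain C' where C': "C' \<in> sets borel" "C' \<subseteq> span B" "\<forall>x\<in>C'. \<forall>y\<in>C'. norm (x - y) \<le> D"
     "emeasure (frame_lborel B) C' = emeasure (frame_lborel B) C" "\<forall>b\<in>F. \<forall>x\<in>C'. refl_along b x \<in> C'"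
    by (elim bexE conjE) (rule that)
  have b: "b \<in> B" "norm b = 1" using insert o by (auto simp: orthonormal_set_def)
  show ?case
  proof (rule bexI[where x = "steiner_sym b C'"], intro conjI ballI)
    show "steiner_sym b C' \<in> sets borel" by (rule steiner_sym_measurable) fact
    show "steiner_sym b C' \<subseteq> span B" using b C' by (intro steiner_sym_subset_span)
    show "norm (x - y) \<le> D" if "x \<in> steiner_sym b C'" "y \<in> steiner_sym b C'" for x y
      by (rule steiner_sym_dist_le[OF b(2) _ C'(1) that]) (use C'(3) in blast)
    show "emeasure (frame_lborel B) (steiner_sym b C') = emeasure (frame_lborel B) C"
      using emeasure_steiner_sym[OF o b(1) C'(1)] C'(4) by simp
    fix c x assume c: "c \<in> insert b F" and x: "x \<in> steiner_sym b C'"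
    show "refl_along c x \<in> steiner_sym b C'"
    proof (cases "c = b")
      case True
      then show ?thesis using refl_along_steiner_sym[OF b(2) x] by simp
    next
      case False
      then have "c \<in> F" "c \<in> B" using c insert by auto
      then have "norm c = 1" "b \<bullet> c = 0"
        using o b(1) False by (auto simp: orthonormal_set_def orthonormal_set_inner[OF o])
      then show ?thesis
        by (rule refl_along_steiner_sym_orth[OF _ _ _ x]) (use \<open>c \<in> F\<close> C'(5) in blast)
    qed
  qed
qed

text \<open>
  After symmetrisation in all directions of \<open>B\<close> the set is invariant under every reflection
  \<open>refl_along b\<close>, hence under their composition \<open>x \<mapsto> - x\<close>. A set of diameter at most \<open>D\<close> that
  contains \<open>- x\<close> with \<open>x\<close> lies in the ball of radius \<open>D / 2\<close> around \<open>0\<close>.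
\<close>

lemma isodiametric_pos:
  fixes B :: "'a::euclidean_space set"
  assumes o: "orthonormal_set B" and C: "C \<in> sets borel" "C \<subseteq> span B" and Dp: "D > 0"
    and D: "\<And>x y. x \<in> C \<Longrightarrow> y \<in> C \<Longrightarrow> norm (x - y) \<le> D"
  shows "emeasure (frame_lborel B) C \<le> ennreal (unit_ball_vol (card B) * (D / 2) ^ card B)"
proof -
  obtain C' where C': "C' \<in> sets borel" "C' \<subseteq> span B" "\<forall>x\<in>C'. \<forall>y\<in>C'. norm (x - y) \<le> D"
     "emeasure (frame_lborel B) C' = emeasure (frame_lborel B) C" "\<forall>b\<in>B. \<forall>x\<in>C'. refl_along b x \<in> C'"
    using exists_symmetrization[OF o order_refl C D] by blast
  have "C' \<subseteq> cball 0 (D / 2)"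
  proof
    fix x assume x: "x \<in> C'"
    \<comment> \<open>applying the reflections one after another flips the sign of one coordinate at a
      time\<close>
    have "x - 2 *\<^sub>R (\<Sum>b\<in>F. (x \<bullet> b) *\<^sub>R b) \<in> C'" if "F \<subseteq> B" for F
      using finite_subset[OF that orthonormal_set_finite[OF o]] that
    proof (induction F rule: finite_induct)
      case empty
      then show ?case using x by simp
    next
      case (insert c F)
      define z where "z = x - 2 *\<^sub>R (\<Sum>b\<in>F. (x \<bullet> b) *\<^sub>R b)"
      have "z \<bullet> c = x \<bullet> c"
        using orthonormal_set_inner_sum[OF o, of c F "\<lambda>b. x \<bullet> b"] insert
        by (simp add: z_def inner_diff_left)
      then have "refl_along c z = x - 2 *\<^sub>R (\<Sum>b\<in>insert c F. (x \<bullet> b) *\<^sub>R b)"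
        using insert by (simp add: refl_along_def z_def algebra_simps)
      moreover have "z \<in> C'" "c \<in> B" using insert by (auto simp: z_def)
      then have "refl_along c z \<in> C'" using C'(5) by blast
      ultimately show ?case by simp
    qed
    from this[OF order_refl] have "x - 2 *\<^sub>R x \<in> C'"
      using orthonormal_set_expand[OF o] C'(2) x by auto
    then have "norm (x - (x - 2 *\<^sub>R x)) \<le> D" using C'(3) x by blast
    then show "x \<in> cball 0 (D / 2)" by simp
  qed
  then have "emeasure (frame_lborel B) C' \<le> emeasure (frame_lborel B) (cball 0 (D / 2))"
    by (intro emeasure_mono) auto
  also have "\<dots> = ennreal (unit_ball_vol (card B) * (D / 2) ^ card B)"
    using Dp by (intro emeasure_frame_cball_0[OF o]) simp
  finally show ?thesis using C'(4) by simp
qed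

text \<open>
  Stated for the closure, because the set itself need not be measurable and the closure has
  the same diameter. The case of diameter \<open>0\<close> is a limit: for empty \<open>B\<close> the measure of a point
  is \<open>1\<close>, which agrees with \<open>0 ^ 0 = 1\<close>.
\<close>

theorem isodiametric_inequality:
  fixes B :: "'a::euclidean_space set"
  assumes o: "orthonormal_set B" and C: "bounded C"
  shows "emeasure (frame_lborel B) (closure C) \<le> ennreal (unit_ball_vol (card B) * (diameter C / 2) ^ card B)"
proof -
  have [measurable]: "span B \<in> sets borel" by (rule borel_closed) (rule closed_span)
  let ?C = "closure C \<inter> span B"
  have "emeasure (frame_lborel B) (closure C) = emeasure (frame_lborel B) ?C"
    using AE_frame_lborel_span[of B] by (intro emeasure_eq_AE) auto
  also have "\<dots> \<le> ennreal (unit_ball_vol (card B) * (diameter C / 2) ^ card B)"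
  proof (rule tendsto_lowerbound)
    let ?f = "\<lambda>D. ennreal (unit_ball_vol (card B) * (D / 2) ^ card B)"
    show "(?f \<longlongrightarrow> ?f (diameter C)) (at_right (diameter C))"
      by (intro tendsto_intros tendsto_ennrealI) simp
    show "\<forall>\<^sub>F D in at_right (diameter C). emeasure (frame_lborel B) ?C \<le> ?f D"
      unfolding eventually_at_right_field
    proof (intro exI[of _ "diameter C + 1"] conjI allI impI)
      fix D assume D: "diameter C < D" "D < diameter C + 1"
      show "emeasure (frame_lborel B) ?C \<le> ?f D"
      proof (rule isodiametric_pos[OF o])
        show "D > 0" using D diameter_ge_0[OF C] by simp
        fix x y assume "x \<in> ?C" "y \<in> ?C"
        then have "dist x y \<le> diameter (closure C)"
          using C by (intro diameter_bounded_bound) auto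
        then show "norm (x - y) \<le> D" using D diameter_closure[OF C] by (simp add: dist_norm)
      qed auto
    qed simp
  qed simp
  finally show ?thesis .
qed

section \<open>Hausdorff measure of flat sets\<close>

definition diam_cost :: "nat \<Rightarrow> (real^'n) set \<Rightarrow> ennreal" where
  "diam_cost d C = (if C = {} then 0 else ennreal (unit_ball_vol (real d) * (diameter C / 2) ^ d))"

definition fine_cover :: "real \<Rightarrow> (real^'n) set \<Rightarrow> (nat \<Rightarrow> (real^'n) set) \<Rightarrow> bool" where
  "fine_cover \<delta> S C \<longleftrightarrow> S \<subseteq> (\<Union>i. C i) \<and> (\<forall>i. bounded (C i) \<and> diameter (C i) \<le> \<delta>)"

lemma hausdorff_pre_alt: "hausdorff_pre d \<delta> S = (INF C\<in>Collect (fine_cover \<delta> S). \<Sum>i. diam_cost d (C i))"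
proof -
  have "Collect (fine_cover \<delta> S) =
      {C. S \<subseteq> (\<Union>i. C i) \<and> (\<forall>i. bounded (C i) \<and> diameter (C i) \<le> \<delta>)}"
    by (rule Collect_cong) (simp only: fine_cover_def)
  then show ?thesis by (simp add: hausdorff_pre_def diam_cost_def)
qed

lemma hausdorff_pre_le: "fine_cover \<delta> S C \<Longrightarrow> hausdorff_pre d \<delta> S \<le> (\<Sum>i. diam_cost d (C i))"
  unfolding hausdorff_pre_alt by (rule INF_lower) simp

lemma hausdorff_pre_greatest:
  "(\<And>C. fine_cover \<delta> S C \<Longrightarrow> y \<le> (\<Sum>i. diam_cost d (C i))) \<Longrightarrow> y \<le> hausdorff_pre d \<delta> S"
  unfolding hausdorff_pre_alt by (rule INF_greatest) simp

lemma hausdorff_pre_approx: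
  assumes "hausdorff_pre d \<delta> S < x"
  obtains C where "fine_cover \<delta> S C" "(\<Sum>i. diam_cost d (C i)) < x"
  using assms unfolding hausdorff_pre_alt INF_less_iff by blast

lemma hausdorff_pre_le_outer: "\<delta> > 0 \<Longrightarrow> hausdorff_pre d \<delta> S \<le> hausdorff_outer d S"
  unfolding hausdorff_outer_def by (rule SUP_upper) simp

lemma hausdorff_outer_least:
  "(\<And>\<delta>. \<delta> > 0 \<Longrightarrow> hausdorff_pre d \<delta> S \<le> y) \<Longrightarrow> hausdorff_outer d S \<le> y"
  unfolding hausdorff_outer_def by (rule SUP_least) simp

lemma hausdorff_pre_mono: "S \<subseteq> T \<Longrightarrow> hausdorff_pre d \<delta> S \<le> hausdorff_pre d \<delta> T"
  by (rule hausdorff_pre_greatest, rule hausdorff_pre_le) (auto simp: fine_cover_def)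

lemma hausdorff_pre_antimono: "\<delta> \<le> \<delta>' \<Longrightarrow> hausdorff_pre d \<delta>' S \<le> hausdorff_pre d \<delta> S"
  by (rule hausdorff_pre_greatest, rule hausdorff_pre_le) (meson fine_cover_def order_trans)

lemma hausdorff_outer_mono: "S \<subseteq> T \<Longrightarrow> hausdorff_outer d S \<le> hausdorff_outer d T"
  by (rule hausdorff_outer_least)
     (meson hausdorff_pre_mono hausdorff_pre_le_outer order_trans)

lemma diam_cost_empty [simp]: "diam_cost d {} = 0"
  by (simp add: diam_cost_def)

lemma hausdorff_outer_empty [simp]: "hausdorff_outer d {} = 0"
proof -
  have "hausdorff_pre d \<delta> {} \<le> 0" if "\<delta> > 0" for \<delta>
    using hausdorff_pre_le[of \<delta> "{}" "\<lambda>_. {}" d] that by (simp add: fine_cover_def)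
  then have "hausdorff_outer d {} \<le> 0" by (rule hausdorff_outer_least)
  then show ?thesis by simp
qed

text \<open>
  Covers are sequences; covers of two sets are combined by alternating between them.
\<close>

lemma suminf_interleave_le:
  fixes a b :: "nat \<Rightarrow> ennreal"
  shows "(\<Sum>i. if even i then a (i div 2) else b (i div 2)) \<le> suminf a + suminf b"
proof -
  let ?c = "\<lambda>i. if even i then a (i div 2) else b (i div 2)"
  have eq: "(\<Sum>i<2 * N. ?c i) = (\<Sum>i<N. a i) + (\<Sum>i<N. b i)" for N
    by (induction N) (simp_all add: algebra_simps)
  have "(\<Sum>i<N. ?c i) \<le> suminf a + suminf b" for N
  proof -
    have "(\<Sum>i<N. ?c i) \<le> (\<Sum>i<2 * N. ?c i)" by (intro sum_mono2) auto
    also have "\<dots> \<le> suminf a + suminf b"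
      unfolding eq by (intro add_mono sum_le_suminf) auto
    finally show ?thesis .
  qed
  then show ?thesis unfolding suminf_eq_SUP by (intro SUP_least) simp
qed

lemma hausdorff_pre_Un: "hausdorff_pre d \<delta> (S \<union> T) \<le> hausdorff_pre d \<delta> S + hausdorff_pre d \<delta> T"
proof (rule ennreal_le_epsilon)
  fix e :: real
  assume fin: "hausdorff_pre d \<delta> S + hausdorff_pre d \<delta> T < top" and e: "e > 0"
  have *: "x < x + ennreal (e / 2)" if "x < top" for x
    using that e by (cases x) (auto simp flip: ennreal_plus simp: ennreal_less_iff)
  have f: "hausdorff_pre d \<delta> S < top" "hausdorff_pre d \<delta> T < top" using fin by auto
  obtain C where C: "fine_cover \<delta> S C" "(\<Sum>i. diam_cost d (C i)) < hausdorff_pre d \<delta> S + ennreal (e / 2)"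
    using hausdorff_pre_approx[OF *[OF f(1)]] by blast
  obtain D where D: "fine_cover \<delta> T D" "(\<Sum>i. diam_cost d (D i)) < hausdorff_pre d \<delta> T + ennreal (e / 2)"
    using hausdorff_pre_approx[OF *[OF f(2)]] by blast
  let ?E = "\<lambda>i. if even i then C (i div 2) else D (i div 2)"
  have "S \<union> T \<subseteq> (\<Union>i. ?E i)"
  proof
    fix x assume "x \<in> S \<union> T"
    then consider i where "x \<in> C i" | i where "x \<in> D i" using C(1) D(1) unfolding fine_cover_def by blast
    then show "x \<in> (\<Union>i. ?E i)"
    proof cases
      case 1
      then have "x \<in> ?E (2 * i)" by simp
      then show ?thesis by blast
    next
      case 2
      then have "x \<in> ?E (2 * i + 1)" by simp
      then show ?thesis by blast
    qed
  qed
  then have "fine_cover \<delta> (S \<union> T) ?E" using C(1) D(1) by (simp add: fine_cover_def)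
  then have "hausdorff_pre d \<delta> (S \<union> T) \<le> (\<Sum>i. diam_cost d (?E i))" by (rule hausdorff_pre_le)
  also have "\<dots> = (\<Sum>i. if even i then diam_cost d (C (i div 2)) else diam_cost d (D (i div 2)))"
    by (intro suminf_cong) simp
  also have "\<dots> \<le> (\<Sum>i. diam_cost d (C i)) + (\<Sum>i. diam_cost d (D i))" by (rule suminf_interleave_le)
  also have "\<dots> \<le> (hausdorff_pre d \<delta> S + ennreal (e / 2)) + (hausdorff_pre d \<delta> T + ennreal (e / 2))"
    using C D by (intro add_mono) (auto intro: less_imp_le)
  also have "\<dots> = hausdorff_pre d \<delta> S + hausdorff_pre d \<delta> T + ennreal (e / 2 + e / 2)"
    using e by (subst ennreal_plus) (auto simp: ac_simps)
  finally show "hausdorff_pre d \<delta> (S \<union> T) \<le> hausdorff_pre d \<delta> S + hausdorff_pre d \<delta> T + ennreal e" by simp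
qed

lemma hausdorff_outer_Un: "hausdorff_outer d (S \<union> T) \<le> hausdorff_outer d S + hausdorff_outer d T"
proof (rule hausdorff_outer_least)
  fix \<delta> :: real assume "\<delta> > 0"
  then show "hausdorff_pre d \<delta> (S \<union> T) \<le> hausdorff_outer d S + hausdorff_outer d T"
    by (intro order_trans[OF hausdorff_pre_Un] add_mono hausdorff_pre_le_outer)
qed

lemma hausdorff_outer_UN:
  "finite I \<Longrightarrow> hausdorff_outer d (\<Union>i\<in>I. S i) \<le> (\<Sum>i\<in>I. hausdorff_outer d (S i))"
proof (induction I rule: finite_induct)
  case (insert i I)
  have "hausdorff_outer d (\<Union>j\<in>insert i I. S j) \<le> hausdorff_outer d (S i) + hausdorff_outer d (\<Union>j\<in>I. S j)"
    using hausdorff_outer_Un by simp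
  then show ?case using insert by (simp add: order_trans add_left_mono)
qed simp

lemma hausdorff_outer_Lipschitz:
  fixes f :: "real^'n \<Rightarrow> real^'n"
  assumes L: "L > 0" and f: "\<And>x y. x \<in> S \<Longrightarrow> y \<in> S \<Longrightarrow> dist (f x) (f y) \<le> L * dist x y"
  shows "hausdorff_outer d (f ` S) \<le> ennreal (L ^ d) * hausdorff_outer d S"
proof (rule hausdorff_outer_least)
  fix \<delta> :: real assume \<delta>: "\<delta> > 0"
  have "hausdorff_pre d \<delta> (f ` S) / ennreal (L ^ d) \<le> hausdorff_pre d (\<delta> / L) S"
  proof (rule hausdorff_pre_greatest)
    fix C assume C: "fine_cover (\<delta> / L) S C"
    let ?D = "\<lambda>i. f ` (C i \<inter> S)"
    have dist: "dist x y \<le> L * diameter (C i)" if "x \<in> ?D i" "y \<in> ?D i" for x y i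
    proof -
      from that(1) obtain x' where x: "x = f x'" "x' \<in> C i" "x' \<in> S" by blast
      from that(2) obtain y' where y: "y = f y'" "y' \<in> C i" "y' \<in> S" by blast
      note xy = x y
      have "dist x y \<le> L * dist x' y'" using f xy by simp
      also have "\<dots> \<le> L * diameter (C i)"
        using C xy L by (intro mult_left_mono diameter_bounded_bound) (auto simp: fine_cover_def)
      finally show ?thesis .
    qed
    have dn: "0 \<le> diameter (C i)" for i
      using C by (intro diameter_ge_0) (simp add: fine_cover_def)
    have diam: "diameter (?D i) \<le> L * diameter (C i)" for i
      using dist[of _ i] L dn[of i] by (intro diameter_le) (auto simp: dist_norm)
    have bdd: "bounded (?D i)" for i
    proof (cases "?D i = {}")
      case False
      then obtain z where "z \<in> ?D i" by blast
      then show ?thesis using dist[of z i] unfolding bounded_def by blast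
    qed simp
    have "fine_cover \<delta> (f ` S) ?D"
      unfolding fine_cover_def
    proof (intro conjI allI bdd)
      show "f ` S \<subseteq> (\<Union>i. ?D i)" using C unfolding fine_cover_def by blast
      fix i
      have "diameter (C i) \<le> \<delta> / L" using C by (simp add: fine_cover_def)
      then have "L * diameter (C i) \<le> \<delta>" using L by (simp add: field_simps)
      then show "diameter (?D i) \<le> \<delta>" using diam[of i] by simp
    qed
    then have "hausdorff_pre d \<delta> (f ` S) \<le> (\<Sum>i. diam_cost d (?D i))" by (rule hausdorff_pre_le)
    also have "\<dots> \<le> (\<Sum>i. ennreal (L ^ d) * diam_cost d (C i))"
    proof (intro suminf_le summableI)
      fix i
      show "diam_cost d (?D i) \<le> ennreal (L ^ d) * diam_cost d (C i)"
      proof (cases "?D i = {}")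
        case False
        then have ne: "C i \<noteq> {}" by blast
        have "(diameter (?D i) / 2) ^ d \<le> (L * (diameter (C i) / 2)) ^ d"
          using diam[of i] diameter_ge_0[OF bdd[of i]] by (intro power_mono) auto
        also have "\<dots> = L ^ d * (diameter (C i) / 2) ^ d" by (rule power_mult_distrib)
        finally have "unit_ball_vol (real d) * (diameter (?D i) / 2) ^ d \<le>
            unit_ball_vol (real d) * (L ^ d * (diameter (C i) / 2) ^ d)"
          by (rule mult_left_mono) simp
        then have "unit_ball_vol (real d) * (diameter (?D i) / 2) ^ d \<le>
            L ^ d * (unit_ball_vol (real d) * (diameter (C i) / 2) ^ d)"
          by (simp only: mult.left_commute)
        moreover have "ennreal (L ^ d) * diam_cost d (C i) =
           ennreal (L ^ d * (unit_ball_vol (real d) * (diameter (C i) / 2) ^ d))"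
          using ne L dn[of i] by (simp add: diam_cost_def ennreal_mult)
        ultimately show ?thesis using False by (simp add: diam_cost_def ennreal_leI)
      qed (simp add: diam_cost_def)
    qed
    also have "\<dots> = (\<Sum>i. diam_cost d (C i)) * ennreal (L ^ d)" by (simp add: mult.commute)
    finally show "hausdorff_pre d \<delta> (f ` S) / ennreal (L ^ d) \<le> (\<Sum>i. diam_cost d (C i))"
      using L by (intro divide_le_posI_ennreal) (auto simp: ennreal_less_iff mult.commute)
  qed
  also have "\<dots> \<le> hausdorff_outer d S" using \<delta> L by (intro hausdorff_pre_le_outer) simp
  finally have "hausdorff_pre d \<delta> (f ` S) / ennreal (L ^ d) \<le> hausdorff_outer d S" .
  then have "ennreal (L ^ d) * (hausdorff_pre d \<delta> (f ` S) / ennreal (L ^ d)) \<le> ennreal (L ^ d) * hausdorff_outer d S"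
    by (rule mult_left_mono) simp
  moreover have "ennreal (L ^ d) * (hausdorff_pre d \<delta> (f ` S) / ennreal (L ^ d)) = hausdorff_pre d \<delta> (f ` S)"
    using L ennreal_mult_divide_eq[of "ennreal (L ^ d)" "hausdorff_pre d \<delta> (f ` S)"]
    by (simp add: ennreal_times_divide mult.commute)
  ultimately show "hausdorff_pre d \<delta> (f ` S) \<le> ennreal (L ^ d) * hausdorff_outer d S" by simp
qed

text \<open>
  Disjoint compact sets have positive distance, so a cover by smaller sets splits into a cover
  of each. In place of measurability in the sense of Caratheodory, this additivity on compact
  sets suffices for the comparison with other measures by inner regularity.
\<close>

lemma hausdorff_outer_separated:
  assumes "compact A" "compact B" "A \<inter> B = {}"
  shows "hausdorff_outer d A + hausdorff_outer d B \<le> hausdorff_outer d (A \<union> B)"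
proof -
  obtain \<rho> where \<rho>: "\<rho> > 0" "\<And>x y. x \<in> A \<Longrightarrow> y \<in> B \<Longrightarrow> \<rho> \<le> dist x y"
    using separate_compact_closed[OF assms(1) compact_imp_closed[OF assms(2)] assms(3)] by blast
  have key: "hausdorff_pre d \<delta> A + hausdorff_pre d \<delta> B \<le> hausdorff_outer d (A \<union> B)"
    if \<delta>: "0 < \<delta>" "\<delta> < \<rho>" for \<delta>
  proof -
    have "hausdorff_pre d \<delta> A + hausdorff_pre d \<delta> B \<le> hausdorff_pre d \<delta> (A \<union> B)"
    proof (rule hausdorff_pre_greatest)
      fix C assume C: "fine_cover \<delta> (A \<union> B) C"
      let ?C1 = "\<lambda>i. if C i \<inter> A = {} then {} else C i"
      let ?C2 = "\<lambda>i. if C i \<inter> B = {} then {} else C i"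
      have excl: "C i \<inter> A = {} \<or> C i \<inter> B = {}" for i
      proof (rule ccontr)
        assume "\<not> ?thesis"
        then obtain x y where xy: "x \<in> C i" "x \<in> A" "y \<in> C i" "y \<in> B" by blast
        then have "dist x y \<le> diameter (C i)"
          using C by (intro diameter_bounded_bound) (auto simp: fine_cover_def)
        moreover have "diameter (C i) \<le> \<delta>" using C by (simp add: fine_cover_def)
        ultimately show False using \<rho>(2)[OF xy(2,4)] \<delta> by simp
      qed
      have "fine_cover \<delta> A ?C1" "fine_cover \<delta> B ?C2"
        using C \<delta> unfolding fine_cover_def by (auto, blast+)
      then have "hausdorff_pre d \<delta> A + hausdorff_pre d \<delta> B \<le>
          (\<Sum>i. diam_cost d (?C1 i)) + (\<Sum>i. diam_cost d (?C2 i))"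
        by (intro add_mono hausdorff_pre_le)
      also have "\<dots> = (\<Sum>i. diam_cost d (?C1 i) + diam_cost d (?C2 i))"
        by (intro suminf_add) auto
      also have "\<dots> \<le> (\<Sum>i. diam_cost d (C i))"
      proof (intro suminf_le summableI)
        fix i show "diam_cost d (?C1 i) + diam_cost d (?C2 i) \<le> diam_cost d (C i)"
          using excl[of i] by auto
      qed
      finally show "hausdorff_pre d \<delta> A + hausdorff_pre d \<delta> B \<le> (\<Sum>i. diam_cost d (C i))" .
    qed
    then show ?thesis using hausdorff_pre_le_outer[OF \<delta>(1)] order_trans by blast
  qed
  have "hausdorff_outer d A + hausdorff_outer d B =
      (SUP \<delta>\<in>{0<..}. hausdorff_pre d \<delta> A + hausdorff_pre d \<delta> B)"
    unfolding hausdorff_outer_def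
  proof (rule SUP_add_directed_ennreal[symmetric])
    fix i j :: real assume "i \<in> {0<..}" "j \<in> {0<..}"
    then show "\<exists>k\<in>{0<..}. hausdorff_pre d i A + hausdorff_pre d j B \<le> hausdorff_pre d k A + hausdorff_pre d k B"
      by (intro bexI[of _ "min i j"] add_mono hausdorff_pre_antimono) auto
  qed
  also have "\<dots> \<le> hausdorff_outer d (A \<union> B)"
  proof (rule SUP_least)
    fix \<delta> :: real assume "\<delta> \<in> {0<..}"
    then have "hausdorff_pre d \<delta> A + hausdorff_pre d \<delta> B \<le>
        hausdorff_pre d (min \<delta> (\<rho> / 2)) A + hausdorff_pre d (min \<delta> (\<rho> / 2)) B"
      by (intro add_mono hausdorff_pre_antimono) auto
    also have "\<dots> \<le> hausdorff_outer d (A \<union> B)" using \<open>\<delta> \<in> {0<..}\<close> \<rho>(1) by (intro key) auto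
    finally show "hausdorff_pre d \<delta> A + hausdorff_pre d \<delta> B \<le> hausdorff_outer d (A \<union> B)" .
  qed
  finally show ?thesis .
qed

lemma hausdorff_outer_UN_compact:
  assumes "finite I" "\<And>i. i \<in> I \<Longrightarrow> compact (K i)" "disjoint_family_on K I"
  shows "(\<Sum>i\<in>I. hausdorff_outer d (K i)) \<le> hausdorff_outer d (\<Union>i\<in>I. K i)"
  using assms
proof (induction I rule: finite_induct)
  case (insert i I)
  have IH: "(\<Sum>i\<in>I. hausdorff_outer d (K i)) \<le> hausdorff_outer d (\<Union>i\<in>I. K i)"
    using insert.prems by (intro insert.IH) (auto simp: disjoint_family_on_def)
  have "K i \<inter> (\<Union>j\<in>I. K j) = {}"
    using insert.prems(2) insert.hyps unfolding disjoint_family_on_def by fastforce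
  then have "hausdorff_outer d (K i) + hausdorff_outer d (\<Union>j\<in>I. K j) \<le> hausdorff_outer d (K i \<union> (\<Union>j\<in>I. K j))"
    using insert.prems(1) insert.hyps by (intro hausdorff_outer_separated compact_UN) auto
  then show ?case using IH insert.hyps by (simp add: order_trans[OF add_left_mono])
qed simp

text \<open>
  By the isodiametric inequality no covering set has more Lebesgue measure than its cost. Here
  it matters that the normalising constant of Hausdorff measure is exact.
\<close>

lemma frame_le_hausdorff_outer:
  fixes B :: "(real^'n) set"
  assumes o: "orthonormal_set B" and F: "F \<in> sets borel"
  shows "emeasure (frame_lborel B) F \<le> hausdorff_outer (card B) F"
proof -
  have "emeasure (frame_lborel B) F \<le> hausdorff_pre (card B) 1 F"
  proof (rule hausdorff_pre_greatest)
    fix C assume C: "fine_cover 1 F C"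
    have "F \<subseteq> (\<Union>i. closure (C i))" 
      using C UN_mono[OF order_refl[of UNIV] closure_subset, of C] unfolding fine_cover_def by blast
    then have "emeasure (frame_lborel B) F \<le> emeasure (frame_lborel B) (\<Union>i. closure (C i))"
      by (intro emeasure_mono) auto
    also have "\<dots> \<le> (\<Sum>i. emeasure (frame_lborel B) (closure (C i)))"
      by (rule emeasure_subadditive_countably) auto
    also have "\<dots> \<le> (\<Sum>i. diam_cost (card B) (C i))"
    proof (intro suminf_le summableI)
      fix i show "emeasure (frame_lborel B) (closure (C i)) \<le> diam_cost (card B) (C i)"
        using isodiametric_inequality[OF o, of "C i"] C by (auto simp: diam_cost_def fine_cover_def)
    qed
    finally show "emeasure (frame_lborel B) F \<le> (\<Sum>i. diam_cost (card B) (C i))" .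
  qed
  also have "\<dots> \<le> hausdorff_outer (card B) F" by (rule hausdorff_pre_le_outer) simp
  finally show ?thesis .
qed

text \<open>
  Vitali covering: small disjoint balls inside \<open>U\<close> have total cost at most the measure of \<open>U\<close>,
  and their enlargements by the factor \<open>5\<close> cover \<open>F\<close>. Enlarging all balls would lose the
  constant, but it is enough to enlarge all except finitely many of them: a point outside
  those closed balls has a neighbourhood missing them, so it is covered by the enlargement of
  one of the others, and the tail of a convergent series remains small after multiplication by
  \<open>5 ^ d\<close>.
\<close>

lemma hausdorff_pre_le_open:
  fixes B :: "(real^'n) set"
  assumes o: "orthonormal_set B" and F: "F \<subseteq> U" "F \<subseteq> span B" and U: "open U" "bounded U" and \<delta>: "\<delta> > 0"
  shows "hausdorff_pre (card B) \<delta> F \<le> emeasure (frame_lborel B) U"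
proof (rule ennreal_le_epsilon)
  fix e :: real assume e: "e > 0"
  let ?M = "frame_lborel B" and ?d = "card B"
  have Ufin: "emeasure ?M U < \<infinity>" by (rule emeasure_frame_bounded[OF o U(2)])
  define K where "K = {(x, r). x \<in> F \<and> 0 < r \<and> r \<le> \<delta> / 10 \<and> cball x r \<subseteq> U}"
  have Kr: "\<And>c. c \<in> K \<Longrightarrow> 0 < snd c \<and> snd c \<le> \<delta> / 10" by (auto simp: K_def)
  obtain C where C: "countable C" "C \<subseteq> K"
    "pairwise (\<lambda>i j. disjnt (cball (fst i) (snd i)) (cball (fst j) (snd j))) C"
    "\<And>i. i \<in> K \<Longrightarrow> \<exists>j. j \<in> C \<and> \<not> disjnt (cball (fst i) (snd i)) (cball (fst j) (snd j)) \<and>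
                        cball (fst i) (snd i) \<subseteq> ball (fst j) (5 * snd j)"
    by (rule Vitali_covering_lemma_cballs_balls[of K snd "\<delta> / 10" fst, OF Kr]) (assumption | rule that)+
  \<comment> \<open>\<open>X n\<close> has at most one element, so that \<open>bb k\<close> is a sequence of balls or empty sets,
    also for finite \<open>C\<close>\<close>
  define X where "X n = {c \<in> C. to_nat_on C c = n}" for n
  define bb where "bb k n = (\<Union>c\<in>X n. cball (fst c) (k * snd c))" for k n
  have X: "X n = {} \<or> (\<exists>c\<in>K. X n = {c})" for n
  proof (cases "X n = {}")
    case False
    then obtain c where c: "c \<in> C" "to_nat_on C c = n" by (auto simp: X_def)
    have "X n = {c}"
      using c inj_on_to_nat_on[OF C(1)] by (auto simp: X_def inj_on_def)
    then show ?thesis using c C(2) by blast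
  qed simp
  have bb_cases: "bb k n = {} \<or> (\<exists>c\<in>K. bb k n = cball (fst c) (k * snd c) \<and> bb 1 n = cball (fst c) (snd c))" for k n
    using X[of n]
  proof
    assume "\<exists>c\<in>K. X n = {c}"
    then obtain c where "c \<in> K" "X n = {c}" by blast
    then show ?thesis by (intro disjI2 bexI[of _ c]) (simp_all add: bb_def)
  qed (simp add: bb_def)
  have closed_bb: "closed (bb k n)" for k n using bb_cases[of k n] by auto
  have bbU: "bb 1 n \<subseteq> U" for n using bb_cases[of 1 n] by (auto simp: K_def)
  have disj: "disjoint_family (bb 1)"
    unfolding disjoint_family_on_def
  proof (intro ballI impI)
    fix m n :: nat assume "m \<noteq> n"
    show "bb 1 m \<inter> bb 1 n = {}"
    proof (rule ccontr)
      assume "bb 1 m \<inter> bb 1 n \<noteq> {}"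
      then obtain c c' x where c: "c \<in> X m" "c' \<in> X n" "x \<in> cball (fst c) (snd c)" "x \<in> cball (fst c') (snd c')"
        by (auto simp: bb_def)
      then have "c \<noteq> c'" "c \<in> C" "c' \<in> C" using \<open>m \<noteq> n\<close> by (auto simp: X_def)
      then have "disjnt (cball (fst c) (snd c)) (cball (fst c') (snd c'))"
        using C(3) unfolding pairwise_def by blast
      then show False using c unfolding disjnt_def by blast
    qed
  qed
  define g where "g n = emeasure ?M (bb 1 n)" for n
  have sumg: "(\<Sum>n. g n) \<le> emeasure ?M U"
  proof -
    have "(\<Sum>n. g n) = emeasure ?M (\<Union>n. bb 1 n)"
      unfolding g_def by (rule suminf_emeasure[OF _ disj]) (auto simp: closed_bb)
    also have "\<dots> \<le> emeasure ?M U" using bbU U(1) by (intro emeasure_mono) auto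
    finally show ?thesis .
  qed
  define g' where "g' n = enn2real (g n)" for n
  have gfin: "g n < \<infinity>" for n
    using emeasure_mono[OF bbU[of n], of ?M] U(1) Ufin unfolding g_def by (simp add: le_less_trans)
  have gg': "g n = ennreal (g' n)" "0 \<le> g' n" for n using gfin[of n] by (auto simp: g'_def less_top)
  have "(\<Sum>n. ennreal (g' n)) \<noteq> top"
    using sumg Ufin by (simp add: gg'(1)[symmetric])
  then have smg': "summable g'" using gg'(2) by (intro summable_suminf_not_top)
  obtain N where N: "(\<Sum>n. g' (n + N)) < e / 5 ^ ?d"
    using suminf_exist_split[of "e / 5 ^ ?d" g'] smg' e by (auto simp: abs_less_iff)
  \<comment> \<open>the first \<open>N\<close> balls keep their size, the others are enlarged\<close>
  define D where "D n = (if n < N then bb 1 n else bb 5 n)" for n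
  have cost: "diam_cost ?d (bb k n) \<le> ennreal (k ^ ?d) * g n" if k: "k > 0" for k n
  proof (cases "bb k n = {}")
    case False
    then obtain c where c: "c \<in> K" "bb k n = cball (fst c) (k * snd c)" "bb 1 n = cball (fst c) (snd c)"
      using bb_cases[of k n] by auto
    have "fst c \<in> span B" "snd c > 0" using c(1) F by (auto simp: K_def)
    then have "g n = ennreal (unit_ball_vol ?d * snd c ^ ?d)"
      unfolding g_def c(3) by (intro emeasure_frame_cball[OF o])
    moreover have "diam_cost ?d (bb k n) = ennreal (unit_ball_vol ?d * (k * snd c) ^ ?d)"
      using \<open>snd c > 0\<close> k False unfolding diam_cost_def c(2) by simp
    ultimately show ?thesis using k \<open>snd c > 0\<close>
      by (simp add: power_mult_distrib ennreal_mult[symmetric] mult.left_commute)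
  qed simp
  have diam: "bounded (bb k n) \<and> diameter (bb k n) \<le> \<delta>" if k: "0 < k" "k \<le> 5" for k n
  proof (cases "bb k n = {}")
    case False
    then obtain c where c: "c \<in> K" "bb k n = cball (fst c) (k * snd c)"
      using bb_cases[of k n] by auto
    have "k * snd c \<le> 5 * (\<delta> / 10)" using Kr[OF c(1)] k by (intro mult_mono) auto
    then show ?thesis using Kr[OF c(1)] k \<delta> by (simp add: c(2))
  qed (use \<delta> in simp)
  have cover: "F \<subseteq> (\<Union>n. D n)"
  proof
    fix x assume x: "x \<in> F"
    let ?V = "\<Union>n<N. bb 1 n"
    show "x \<in> (\<Union>n. D n)"
    proof (cases "x \<in> ?V")
      case True
      then obtain n where "n < N" "x \<in> bb 1 n" by blast
      then have "x \<in> D n" by (simp add: D_def)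
      then show ?thesis by blast
    next
      case False
      have "open (U - ?V)" using U(1) closed_bb by (intro open_Diff closed_UN) auto
      moreover have "x \<in> U - ?V" using x F False by blast
      ultimately obtain r where r: "r > 0" "cball x r \<subseteq> U - ?V" by (meson open_contains_cball)
      define r' where "r' = min r (\<delta> / 10)"
      have r': "r' > 0" "cball x r' \<subseteq> U - ?V" using r \<delta> by (auto simp: r'_def)
      have "(x, r') \<in> K" using x r' by (auto simp: K_def r'_def)
      from C(4)[OF this] obtain c where c: "c \<in> C" "\<not> disjnt (cball x r') (cball (fst c) (snd c))"
        "cball x r' \<subseteq> ball (fst c) (5 * snd c)" by auto
      define n where "n = to_nat_on C c"
      have cX: "c \<in> X n" using c(1) by (simp add: X_def n_def)
      have "cball (fst c) (snd c) \<subseteq> bb 1 n" using cX by (auto simp: bb_def)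
      moreover have "n \<ge> N"
      proof (rule ccontr)
        assume "\<not> n \<ge> N"
        then have "bb 1 n \<subseteq> ?V" by (intro UN_upper) simp
        with \<open>cball (fst c) (snd c) \<subseteq> bb 1 n\<close> r'(2) have "disjnt (cball x r') (cball (fst c) (snd c))"
          unfolding disjnt_def by blast
        with c(2) show False by contradiction
      qed
      moreover have "x \<in> cball (fst c) (5 * snd c)"
        using c(3) r'(1) ball_subset_cball[of "fst c" "5 * snd c"] centre_in_cball[of x r'] by (meson less_imp_le subsetD)
      then have "x \<in> bb 5 n" using cX unfolding bb_def by blast
      ultimately have "x \<in> D n" by (simp add: D_def)
      then show ?thesis by blast
    qed
  qed
  have "fine_cover \<delta> F D" unfolding fine_cover_def using cover diam[of 1] diam[of 5] by (auto simp: D_def)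
  then have "hausdorff_pre ?d \<delta> F \<le> (\<Sum>n. diam_cost ?d (D n))" by (rule hausdorff_pre_le)
  also have "\<dots> \<le> (\<Sum>n. g n + ennreal (if n < N then 0 else 5 ^ ?d * g' n))"
  proof (intro suminf_le summableI)
    fix n
    show "diam_cost ?d (D n) \<le> g n + ennreal (if n < N then 0 else 5 ^ ?d * g' n)"
    proof (cases "n < N")
      case True
      then show ?thesis using cost[of 1 n] by (simp add: D_def)
    next
      case False
      have "diam_cost ?d (D n) \<le> ennreal (5 ^ ?d) * g n" using cost[of 5 n] False by (simp add: D_def)
      also have "\<dots> = ennreal (5 ^ ?d * g' n)" using gg'[of n] by (simp add: ennreal_mult)
      also have "\<dots> \<le> g n + ennreal (5 ^ ?d * g' n)" by simp
      finally show ?thesis using False by simp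
    qed
  qed
  also have "\<dots> = (\<Sum>n. g n) + (\<Sum>n. ennreal (if n < N then 0 else 5 ^ ?d * g' n))"
    by (intro suminf_add[symmetric]) auto
  also have "(\<Sum>n. ennreal (if n < N then 0 else 5 ^ ?d * g' n)) \<le> ennreal e"
  proof -
    let ?h = "\<lambda>n. if n < N then 0 else 5 ^ ?d * g' n"
    have sh: "summable ?h"
      by (rule summable_comparison_test'[OF summable_mult[OF smg', of "5 ^ ?d"], of 0]) (use gg' in auto)
    have "suminf ?h = (\<Sum>n. ?h (n + N)) + (\<Sum>n<N. ?h n)" by (rule suminf_split_initial_segment[OF sh])
    also have "\<dots> = 5 ^ ?d * (\<Sum>n. g' (n + N))"
      using smg' by (simp add: suminf_mult summable_iff_shift)
    also have "\<dots> \<le> e" using N by (simp add: field_simps)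
    finally have "suminf ?h \<le> e" .
    moreover have "(\<Sum>n. ennreal (?h n)) = ennreal (suminf ?h)"
      using sh gg' by (intro suminf_ennreal_eq summable_sums) auto
    ultimately show ?thesis by (simp add: ennreal_leI)
  qed
  also have "(\<Sum>n. g n) \<le> emeasure ?M U" by (rule sumg)
  finally show "hausdorff_pre ?d \<delta> F \<le> emeasure ?M U + ennreal e"
    by (simp add: add_mono)
qed

theorem hausdorff_outer_eq_frame:
  fixes B :: "(real^'n) set"
  assumes o: "orthonormal_set B" and F: "F \<in> sets borel" "F \<subseteq> span B" "bounded F"
  shows "hausdorff_outer (card B) F = emeasure (frame_lborel B) F"
proof (rule antisym)
  obtain R where R: "F \<subseteq> ball 0 R"
    using F(3) bounded_subset_ballD[of F 0] by blast
  \<comment> \<open>outer regularity requires a finite measure, so attention is restricted to a ball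
    containing \<open>F\<close>\<close>
  let ?M = "density (frame_lborel B) (indicator (ball 0 R))"
  have em: "emeasure ?M A = emeasure (frame_lborel B) (ball 0 R \<inter> A)" if "A \<in> sets borel" for A
    using that by (intro emeasure_restricted) auto
  have "emeasure ?M (space ?M) \<noteq> \<infinity>"
    using emeasure_frame_bounded[OF o, of "ball 0 R"] em[of UNIV] by simp
  from outer_regular[OF _ this F(1)]
  have reg: "emeasure ?M F = (INF U \<in> {U. F \<subseteq> U \<and> open U}. emeasure ?M U)" by simp
  show "hausdorff_outer (card B) F \<le> emeasure (frame_lborel B) F"
  proof (rule hausdorff_outer_least)
    fix \<delta> :: real assume \<delta>: "\<delta> > 0"
    have "hausdorff_pre (card B) \<delta> F \<le> (INF U \<in> {U. F \<subseteq> U \<and> open U}. emeasure ?M U)"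
    proof (rule INF_greatest)
      fix U assume U: "U \<in> {U. F \<subseteq> U \<and> open U}"
      have "hausdorff_pre (card B) \<delta> F \<le> emeasure (frame_lborel B) (ball 0 R \<inter> U)"
        using U R F by (intro hausdorff_pre_le_open[OF o] \<delta>) (auto intro: bounded_subset[OF bounded_ball])
      then show "hausdorff_pre (card B) \<delta> F \<le> emeasure ?M U" using U em[of U] by simp
    qed
    also have "\<dots> = emeasure (frame_lborel B) F" using em[OF F(1)] reg R by (simp add: Int_absorb1)
    finally show "hausdorff_pre (card B) \<delta> F \<le> emeasure (frame_lborel B) F" .
  qed
qed (rule frame_le_hausdorff_outer[OF o F(1)])

section \<open>The gauge of a convex body and its normal directions\<close>

lemma compact_SUP_attained:
  fixes f :: "'a::topological_space \<Rightarrow> real"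
  assumes "compact X" "X \<noteq> {}" "continuous_on X f"
  shows "\<exists>u\<in>X. f u = (SUP v\<in>X. f v)" and "u \<in> X \<Longrightarrow> f u \<le> (SUP v\<in>X. f v)"
proof -
  obtain m where m: "m \<in> X" "\<And>v. v \<in> X \<Longrightarrow> f v \<le> f m"
    using continuous_attains_sup[OF assms] by blast
  have "(SUP v\<in>X. f v) = f m" using m by (intro cSup_eq_maximum) auto
  with m show "\<exists>u\<in>X. f u = (SUP v\<in>X. f v)" "u \<in> X \<Longrightarrow> f u \<le> (SUP v\<in>X. f v)" by auto
qed

text \<open>
  The envelope theorem: the derivative of a maximum is the largest derivative at a maximiser.
  Derivatives are taken along sequences, with a continuous form of convergence as hypothesis
  (\<open>quot\<close>: the quotients converge along convergent arguments). This is what the equation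
  defining the Orlicz combination provides directly, and it replaces uniform convergence in
  the compactness argument: maximisers \<open>w k\<close> for \<open>a k\<close> accumulate only at maximisers for \<open>a0\<close>.
\<close>

lemma danskin:
  fixes a :: "nat \<Rightarrow> 'a::metric_space \<Rightarrow> real" and a0 c :: "'a \<Rightarrow> real"
  assumes X: "compact X" "X \<noteq> {}" and a0: "continuous_on X a0" and a: "\<And>k. continuous_on X (a k)"
    and s: "\<And>k. s k > 0" "s \<longlonglongrightarrow> 0"
    and quot: "\<And>\<sigma> v u. strict_mono (\<sigma> :: nat \<Rightarrow> nat) \<Longrightarrow> (\<And>k. v k \<in> X) \<Longrightarrow> u \<in> X \<Longrightarrow> v \<longlonglongrightarrow> u \<Longrightarrow>
        (\<lambda>k. (a (\<sigma> k) (v k) - a0 (v k)) / s (\<sigma> k)) \<longlonglongrightarrow> c u"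
    and u0: "u0 \<in> X" "a0 u0 = (SUP v\<in>X. a0 v)" "c u0 = d"
    and max: "\<And>u. u \<in> X \<Longrightarrow> a0 u = (SUP v\<in>X. a0 v) \<Longrightarrow> c u \<le> d"
  shows "(\<lambda>k. ((SUP v\<in>X. a k v) - (SUP v\<in>X. a0 v)) / s k) \<longlonglongrightarrow> d"
proof -
  define q where "q k = ((SUP v\<in>X. a k v) - (SUP v\<in>X. a0 v)) / s k" for k
  have le: "a k u \<le> (SUP v\<in>X. a k v)" "a0 u \<le> (SUP v\<in>X. a0 v)" if "u \<in> X" for k u
    using compact_SUP_attained(2)[OF X a that] compact_SUP_attained(2)[OF X a0 that] by auto
  have "\<forall>k. \<exists>w\<in>X. a k w = (SUP v\<in>X. a k v)" using compact_SUP_attained(1)[OF X a] by blast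
  then obtain w where w: "\<And>k. w k \<in> X" "\<And>k. a k (w k) = (SUP v\<in>X. a k v)" by metis
  \<comment> \<open>the quotient lies between those at a maximiser of \<open>a0\<close> and at a maximiser of \<open>a k\<close>\<close>
  have lower: "(a k u0 - a0 u0) / s k \<le> q k" for k
    unfolding q_def using le(1)[OF u0(1), of k] u0(2) s(1)[of k] by (intro divide_right_mono) auto
  have upper: "q k \<le> (a k (w k) - a0 (w k)) / s k" for k
    unfolding q_def using le(2)[OF w(1)[of k]] w(2)[of k] s(1)[of k] by (intro divide_right_mono) auto
  have u0lim: "(\<lambda>k. (a k u0 - a0 u0) / s k) \<longlonglongrightarrow> d"
    using quot[of id "\<lambda>_. u0" u0] u0 by (simp add: strict_mono_id)
  have "q \<longlonglongrightarrow> d"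
  proof (rule order_tendstoI)
    fix y assume "y < d"
    then have "eventually (\<lambda>k. y < (a k u0 - a0 u0) / s k) sequentially" by (rule order_tendstoD(1)[OF u0lim])
    then show "eventually (\<lambda>k. y < q k) sequentially"
      using lower by (elim eventually_mono) (rule less_le_trans)
  next
    fix y assume y: "d < y"
    show "eventually (\<lambda>k. q k < y) sequentially"
    proof (rule ccontr)
      assume "\<not> ?thesis"
      \<comment> \<open>if the quotient exceeded \<open>y\<close> infinitely often, maximisers \<open>w\<close> would accumulate
        at some \<open>l\<close> with \<open>y \<le> c l\<close>; but \<open>l\<close> maximises \<open>a0\<close>\<close>
      then have "infinite {k. y \<le> q k}"
        unfolding not_eventually frequently_sequentially by (auto simp: infinite_nat_iff_unbounded_le not_less)
      from infinite_enumerate[OF this] obtain \<sigma>0 :: "nat \<Rightarrow> nat" where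
        "strict_mono \<sigma>0" "\<forall>k. \<sigma>0 k \<in> {k. y \<le> q k}" by blast
      then have \<sigma>0: "strict_mono \<sigma>0" "\<And>k. y \<le> q (\<sigma>0 k)" by simp_all
      obtain l \<tau> where l: "l \<in> X" "strict_mono \<tau>" "((w \<circ> \<sigma>0) \<circ> \<tau>) \<longlonglongrightarrow> l"
        by (rule seq_compactE[OF compact_imp_seq_compact[OF X(1)], of "w \<circ> \<sigma>0"]) (use w(1) in auto)
      define \<sigma> where "\<sigma> = \<sigma>0 \<circ> \<tau>"
      have \<sigma>: "strict_mono \<sigma>" unfolding \<sigma>_def using \<sigma>0 l by (intro strict_mono_o)
      have lim: "(\<lambda>k. w (\<sigma> k)) \<longlonglongrightarrow> l" using l(3) by (simp add: \<sigma>_def comp_def)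
      have wq: "(\<lambda>k. (a (\<sigma> k) (w (\<sigma> k)) - a0 (w (\<sigma> k))) / s (\<sigma> k)) \<longlonglongrightarrow> c l"
        using quot[OF \<sigma> w(1) l(1) lim] .
      have uq: "(\<lambda>k. (a (\<sigma> k) u0 - a0 u0) / s (\<sigma> k)) \<longlonglongrightarrow> d"
        using quot[OF \<sigma>, of "\<lambda>_. u0" u0] u0 by simp
      have s\<sigma>: "(\<lambda>k. s (\<sigma> k)) \<longlonglongrightarrow> 0" using LIMSEQ_subseq_LIMSEQ[OF s(2) \<sigma>] by (simp add: comp_def)
      have "(\<lambda>k. s (\<sigma> k) * ((a (\<sigma> k) (w (\<sigma> k)) - a0 (w (\<sigma> k))) / s (\<sigma> k))) \<longlonglongrightarrow> 0 * c l"
        by (intro tendsto_mult s\<sigma> wq)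
      then have 1: "(\<lambda>k. a (\<sigma> k) (w (\<sigma> k)) - a0 (w (\<sigma> k))) \<longlonglongrightarrow> 0"
        using s(1) by (simp add: less_imp_neq[symmetric])
      have "(\<lambda>k. s (\<sigma> k) * ((a (\<sigma> k) u0 - a0 u0) / s (\<sigma> k))) \<longlonglongrightarrow> 0 * d"
        by (intro tendsto_mult s\<sigma> uq)
      then have 2: "(\<lambda>k. a (\<sigma> k) u0 - a0 u0) \<longlonglongrightarrow> 0"
        using s(1) by (simp add: less_imp_neq[symmetric])
      have 3: "(\<lambda>k. a0 (w (\<sigma> k))) \<longlonglongrightarrow> a0 l"
        using continuous_on_tendsto_compose[OF a0 lim l(1)] w(1) by simp
      have "(\<lambda>k. a (\<sigma> k) (w (\<sigma> k)) - a0 (w (\<sigma> k)) + a0 (w (\<sigma> k)) - (a (\<sigma> k) u0 - a0 u0)) \<longlonglongrightarrow> 0 + a0 l - 0"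
        by (intro tendsto_diff tendsto_add 1 2 3)
      moreover have "a0 u0 \<le> a (\<sigma> k) (w (\<sigma> k)) - a0 (w (\<sigma> k)) + a0 (w (\<sigma> k)) - (a (\<sigma> k) u0 - a0 u0)" for k
        using le(1)[OF u0(1), of "\<sigma> k"] w(2)[of "\<sigma> k"] by simp
      ultimately have "a0 u0 \<le> 0 + a0 l - 0" by (intro LIMSEQ_le_const) auto
      then have "a0 l = (SUP v\<in>X. a0 v)" using u0(2) le(2)[OF l(1)] by simp
      then have "c l \<le> d" using max l(1) by simp
      moreover have "y \<le> c l"
      proof (rule LIMSEQ_le_const[OF wq], intro exI allI impI)
        fix k show "y \<le> (a (\<sigma> k) (w (\<sigma> k)) - a0 (w (\<sigma> k))) / s (\<sigma> k)"
          using upper[of "\<sigma> k"] \<sigma>0(2)[of "\<tau> k"] by (simp add: \<sigma>_def)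
      qed
      ultimately show False using y by simp
    qed
  qed
  then show ?thesis by (simp add: q_def[abs_def])
qed

lemma support_fun_attained:
  fixes A :: "(real^'n) set"
  assumes "compact A" "A \<noteq> {}"
  shows "\<exists>y\<in>A. x \<bullet> y = support_fun A x" and "y \<in> A \<Longrightarrow> x \<bullet> y \<le> support_fun A x"
proof -
  have c: "continuous_on A (\<lambda>y. x \<bullet> y)" by (intro continuous_intros)
  show "\<exists>y\<in>A. x \<bullet> y = support_fun A x" "y \<in> A \<Longrightarrow> x \<bullet> y \<le> support_fun A x"
    unfolding support_fun_def using compact_SUP_attained[OF assms c] by auto
qed

lemma support_fun_lipschitz:
  fixes A :: "(real^'n) set"
  assumes A: "compact A" "A \<noteq> {}" "A \<subseteq> cball 0 R"
  shows "\<bar>support_fun A x - support_fun A y\<bar> \<le> R * norm (x - y)"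
proof -
  have *: "support_fun A x - support_fun A y \<le> R * norm (x - y)" for x y
  proof -
    obtain z where z: "z \<in> A" "x \<bullet> z = support_fun A x" using support_fun_attained(1)[OF A(1,2)] by blast
    have "support_fun A x - support_fun A y \<le> (x - y) \<bullet> z"
      using support_fun_attained(2)[OF A(1,2) z(1), of y] z(2) by (simp add: inner_diff_left)
    also have "\<dots> \<le> norm (x - y) * norm z" by (rule norm_cauchy_schwarz)
    also have "\<dots> \<le> norm (x - y) * R" using z(1) A(3) by (intro mult_left_mono) auto
    finally show ?thesis by (simp add: mult.commute)
  qed
  show ?thesis using *[of x y] *[of y x] by (simp add: norm_minus_commute)
qed

text \<open>
  The Minkowski functional of \<open>A\<close> within \<open>\<xi>\<close>, written as the support function of the polar
  body. In this form its dependence on the support function of \<open>A\<close> is explicit.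
\<close>

definition gauge_on :: "(real^'n) set \<Rightarrow> (real^'n) set \<Rightarrow> real^'n \<Rightarrow> real" where
  "gauge_on \<xi> A x = (SUP u\<in>sphere 0 1 \<inter> \<xi>. (x \<bullet> u) / support_fun A u)"

text \<open>
  A convex body \<open>A\<close> in \<open>span B\<close> with balls inside and around it. Both radii are parameters,
  since the estimates for the projections of a body must be uniform over all subspaces.
\<close>

locale framed_body =
  fixes B A :: "(real^'n) set" and r R :: real
  assumes onb: "orthonormal_set B" and B_ne: "B \<noteq> {}"
    and compact_A: "compact A" and convex_A: "convex A" and A_sub: "A \<subseteq> span B"
    and r_pos: "r > 0" and ball_sub: "cball 0 r \<inter> span B \<subseteq> A" and A_ball: "A \<subseteq> cball 0 R"
begin

abbreviation "S \<equiv> sphere 0 1 \<inter> span B"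
abbreviation "h \<equiv> support_fun A"
abbreviation "G \<equiv> gauge_on (span B) A"
abbreviation "\<mu> \<equiv> frame_lborel B"

text \<open>
  For \<open>x\<close> on the relative boundary these are the outer unit normals at \<open>x\<close>. Along a ray from
  the origin the set does not change.
\<close>

definition "dual_face x = {u \<in> S. x \<bullet> u = G x * h u}"

lemma zero_in_A: "0 \<in> A" using ball_sub r_pos span_zero[of B] by auto
lemma A_ne: "A \<noteq> {}" using zero_in_A by auto

lemma subspace_span_B: "subspace (span B)" by (rule subspace_span)
lemma closed_span_B: "closed (span B)" by (rule closed_span)
lemma span_B_borel [measurable]: "span B \<in> sets borel" by (rule borel_closed[OF closed_span])

lemma B_sub_S: "B \<subseteq> S"
  using onb by (auto simp: orthonormal_set_def span_base)

lemma compact_S: "compact S" by (intro compact_Int_closed compact_sphere closed_span_B)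
lemma S_ne: "S \<noteq> {}" using B_sub_S B_ne by auto

lemma S_neg: "u \<in> S \<Longrightarrow> -u \<in> S" by (auto simp: span_neg)

lemma h_bounds: "u \<in> S \<Longrightarrow> r \<le> h u" "u \<in> S \<Longrightarrow> h u \<le> R"
proof -
  assume u: "u \<in> S"
  then have "r *\<^sub>R u \<in> A" using ball_sub r_pos by (auto simp: span_scale)
  from support_fun_attained(2)[OF compact_A A_ne this, of u] u
  show "r \<le> h u" by (simp add: norm_eq_1)
  obtain y where y: "y \<in> A" "u \<bullet> y = h u" using support_fun_attained(1)[OF compact_A A_ne] by blast
  have "u \<bullet> y \<le> norm u * norm y" by (rule norm_cauchy_schwarz)
  also have "\<dots> \<le> R" using y(1) A_ball u by auto
  finally show "h u \<le> R" using y by simp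
qed

lemma h_pos: "u \<in> S \<Longrightarrow> 0 < h u" using h_bounds(1)[of u] r_pos by simp

lemma R_ge_r: "r \<le> R" using h_bounds S_ne by (meson ex_in_conv order_trans)
lemma R_pos: "R > 0" using R_ge_r r_pos by simp

lemma h_lipschitz: "\<bar>h x - h y\<bar> \<le> R * norm (x - y)"
  by (rule support_fun_lipschitz[OF compact_A A_ne A_ball])

lemma continuous_h: "continuous_on X h"
proof (rule continuous_on_subset[of UNIV])
  show "continuous_on UNIV h"
    using h_lipschitz R_pos
    by (intro lipschitz_on_continuous_on[where L = R] lipschitz_onI) (auto simp: dist_norm)
qed simp

lemma continuous_ratio: "continuous_on S (\<lambda>u. (x \<bullet> u) / h u)"
  using h_pos by (intro continuous_intros continuous_h) (auto simp: less_imp_neq[symmetric])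

lemma G_attained: "\<exists>u\<in>S. x \<bullet> u / h u = G x"
  unfolding gauge_on_def by (rule compact_SUP_attained(1)[OF compact_S S_ne continuous_ratio])

lemma G_ge: "u \<in> S \<Longrightarrow> x \<bullet> u / h u \<le> G x"
  unfolding gauge_on_def by (rule compact_SUP_attained(2)[OF compact_S S_ne continuous_ratio])

lemma inner_le_G: "u \<in> S \<Longrightarrow> x \<bullet> u \<le> G x * h u"
  using G_ge[of u x] h_pos[of u] by (simp add: pos_divide_le_eq)

lemma dual_face_iff: "u \<in> dual_face x \<longleftrightarrow> u \<in> S \<and> x \<bullet> u / h u = G x"
  using h_pos[of u] by (auto simp: dual_face_def field_simps)

lemma dual_face_ne: "dual_face x \<noteq> {}"
  using G_attained[of x] dual_face_iff by blast

lemma G_le_iff: "G x \<le> c \<longleftrightarrow> (\<forall>u\<in>S. x \<bullet> u \<le> c * h u)"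
proof
  assume "G x \<le> c"
  then show "\<forall>u\<in>S. x \<bullet> u \<le> c * h u"
    using inner_le_G h_pos by (meson mult_right_mono order_trans less_imp_le)
next
  assume *: "\<forall>u\<in>S. x \<bullet> u \<le> c * h u"
  obtain u where "u \<in> S" "x \<bullet> u / h u = G x" using G_attained by blast
  then show "G x \<le> c" using * h_pos[of u] by (auto simp: pos_divide_le_eq dest!: sym[of _ "G x"])
qed

lemma G_nonneg: "0 \<le> G x"
proof -
  obtain u where u: "u \<in> S" using S_ne by blast
  show ?thesis
  proof (cases "0 \<le> x \<bullet> u")
    case True
    then have "0 \<le> x \<bullet> u / h u" using h_pos[OF u] by simp
    then show ?thesis using G_ge[OF u, of x] by simp
  next
    case False
    then have "0 \<le> x \<bullet> (-u)" by simp
    then have "0 \<le> x \<bullet> (-u) / h (-u)" using h_pos[OF S_neg[OF u]] by (rule divide_nonneg_pos)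
    then show ?thesis using G_ge[OF S_neg[OF u], of x] by simp
  qed
qed

lemma G_scale: "c \<ge> 0 \<Longrightarrow> G (c *\<^sub>R x) = c * G x"
proof (rule antisym)
  assume c: "c \<ge> 0"
  show "G (c *\<^sub>R x) \<le> c * G x"
    unfolding G_le_iff using inner_le_G[of _ x] c by (auto simp: mult.assoc intro: mult_left_mono)
  obtain u where u: "u \<in> S" "x \<bullet> u / h u = G x" using G_attained by blast
  show "c * G x \<le> G (c *\<^sub>R x)" 
    using G_ge[OF u(1), of "c *\<^sub>R x"] unfolding u(2)[symmetric] by simp
qed

lemma G_zero [simp]: "G 0 = 0" using G_scale[of 0 0] by simp

lemma G_lipschitz: "\<bar>G x - G y\<bar> \<le> norm (x - y) / r"
proof -
  have *: "G x - G y \<le> norm (x - y) / r" for x y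
  proof -
    obtain u where u: "u \<in> S" "x \<bullet> u / h u = G x" using G_attained by blast
    have "G x - G y \<le> (x - y) \<bullet> u / h u"
      using G_ge[OF u(1), of y] u(2) by (simp add: inner_diff_left diff_divide_distrib)
    also have "\<dots> \<le> norm (x - y) / h u"
      using norm_cauchy_schwarz[of "x - y" u] u h_pos[OF u(1)] by (intro divide_right_mono) auto
    also have "\<dots> \<le> norm (x - y) / r"
      using h_bounds(1)[OF u(1)] r_pos by (intro divide_left_mono) auto
    finally show ?thesis .
  qed
  show ?thesis using *[of x y] *[of y x] by (simp add: norm_minus_commute)
qed

lemma continuous_G: "continuous_on X G"
proof (rule continuous_on_subset[of UNIV])
  show "continuous_on UNIV G"
    using G_lipschitz r_pos
    by (intro lipschitz_on_continuous_on[where L = "1 / r"] lipschitz_onI) (auto simp: dist_norm)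
qed simp

lemma measurable_G [measurable]: "G \<in> borel_measurable borel"
  by (rule borel_measurable_continuous_onI[OF continuous_G])

lemma G_ge_norm: "x \<in> span B \<Longrightarrow> norm x / R \<le> G x"
proof (cases "x = 0")
  case False
  assume x: "x \<in> span B"
  let ?u = "x /\<^sub>R norm x"
  have u: "?u \<in> S" using x False by (auto simp: span_scale)
  have "x \<bullet> ?u = norm x" using False by (simp add: dot_square_norm power2_eq_square)
  then have "norm x / R \<le> x \<bullet> ?u / h ?u"
    using h_bounds[OF u] h_pos[OF u] R_pos by (simp add: divide_left_mono)
  then show ?thesis using G_ge[OF u, of x] by simp
qed simp

text \<open>
  Bipolar theorem: a point outside \<open>A\<close> is separated from \<open>A\<close> by a hyperplane, whose normal may
  be projected to \<open>span B\<close>.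
\<close>

lemma mem_A_iff: "x \<in> span B \<Longrightarrow> x \<in> A \<longleftrightarrow> G x \<le> 1"
proof
  assume "x \<in> A"
  have "x \<bullet> u \<le> 1 * h u" for u
    using support_fun_attained(2)[OF compact_A A_ne \<open>x \<in> A\<close>, of u] by (simp add: inner_commute)
  then show "G x \<le> 1" unfolding G_le_iff by blast
next
  assume x: "x \<in> span B" and G: "G x \<le> 1"
  show "x \<in> A"
  proof (rule ccontr)
    assume "x \<notin> A"
    then obtain a b where ab: "a \<bullet> x < b" "\<And>y. y \<in> A \<Longrightarrow> a \<bullet> y > b"
      using separating_hyperplane_closed_point[OF convex_A compact_imp_closed[OF compact_A]] by metis
    define p where "p = (\<Sum>b\<in>B. (a \<bullet> b) *\<^sub>R b)"
    have pin: "p \<in> span B" unfolding p_def by (intro span_sum span_scale span_base)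
    have pa: "p \<bullet> y = a \<bullet> y" if y: "y \<in> span B" for y
    proof -
      have "p \<bullet> y = (\<Sum>b\<in>B. (a \<bullet> b) * (b \<bullet> y))" by (simp add: p_def inner_sum_left)
      also have "\<dots> = a \<bullet> (\<Sum>b\<in>B. (y \<bullet> b) *\<^sub>R b)" by (simp add: inner_sum_right inner_commute mult.commute)
      finally show ?thesis using orthonormal_set_expand[OF onb y] by simp
    qed
    have "p \<noteq> 0" using ab pa[OF x] pa[of 0] zero_in_A ab(2)[OF zero_in_A] by auto
    let ?u = "- (p /\<^sub>R norm p)"
    have u: "?u \<in> S" using pin \<open>p \<noteq> 0\<close> by (auto simp: span_scale span_neg)
    obtain y where y: "y \<in> A" "?u \<bullet> y = h ?u" using support_fun_attained(1)[OF compact_A A_ne] by blast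
    have "x \<bullet> ?u \<le> h ?u" using bspec[OF iffD1[OF G_le_iff G] u] by simp
    then have "p \<bullet> y \<le> p \<bullet> x" using y(2) \<open>p \<noteq> 0\<close> by (simp add: inner_commute field_simps)
    then show False using ab(1) ab(2)[OF y(1)] pa[OF x] pa[of y] y(1) A_sub by auto
  qed
qed

lemma compact_dual_face: "compact (dual_face x)"
proof -
  have "dual_face x = S \<inter> {u. x \<bullet> u = G x * h u}" by (auto simp: dual_face_def)
  moreover have "closed {u. x \<bullet> u = G x * h u}"
    by (intro closed_Collect_eq continuous_intros continuous_h)
  ultimately show ?thesis using compact_Int_closed[OF compact_S] by metis
qed

lemma dual_face_scale: "c > 0 \<Longrightarrow> dual_face (c *\<^sub>R x) = dual_face x"
  by (auto simp: dual_face_def G_scale)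

text \<open>
  By the envelope theorem this is the one-sided derivative of \<open>G\<close> at \<open>x\<close> in direction \<open>b\<close>. It
  always exists; \<open>G\<close> is differentiable along \<open>b\<close> where the values for \<open>b\<close> and \<open>- b\<close> are
  opposite to each other.
\<close>

definition "dir_deriv b x = (SUP u\<in>dual_face x. (b \<bullet> u) / h u)"

lemma dir_deriv_attained: "\<exists>u\<in>dual_face x. b \<bullet> u / h u = dir_deriv b x"
  and dir_deriv_ge: "u \<in> dual_face x \<Longrightarrow> b \<bullet> u / h u \<le> dir_deriv b x"
proof -
  have "continuous_on (dual_face x) (\<lambda>u. b \<bullet> u / h u)"
    by (rule continuous_on_subset[OF continuous_ratio]) (auto simp: dual_face_def)
  from compact_SUP_attained[OF compact_dual_face dual_face_ne this]
  show "\<exists>u\<in>dual_face x. b \<bullet> u / h u = dir_deriv b x" 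
    "u \<in> dual_face x \<Longrightarrow> b \<bullet> u / h u \<le> dir_deriv b x"
    unfolding dir_deriv_def by auto
qed

lemma dir_deriv_limit:
  assumes s: "\<And>k. s k > 0" "s \<longlonglongrightarrow> 0"
  shows "(\<lambda>k. (G (x + s k *\<^sub>R b) - G x) / s k) \<longlonglongrightarrow> dir_deriv b x"
proof -
  obtain u0 where u0: "u0 \<in> dual_face x" "b \<bullet> u0 / h u0 = dir_deriv b x"
    using dir_deriv_attained by blast
  show ?thesis
    unfolding gauge_on_def
  proof (rule danskin[where c = "\<lambda>u. b \<bullet> u / h u" and ?u0.0 = u0])
    show "compact S" "S \<noteq> {}" by (rule compact_S S_ne)+
    show "continuous_on S (\<lambda>u. x \<bullet> u / h u)" by (rule continuous_ratio)
    show "continuous_on S (\<lambda>u. (x + s k *\<^sub>R b) \<bullet> u / h u)" for k by (rule continuous_ratio)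
    show "u0 \<in> S" "x \<bullet> u0 / h u0 = (SUP v\<in>S. x \<bullet> v / h v)" "b \<bullet> u0 / h u0 = dir_deriv b x"
      using u0 unfolding dual_face_iff gauge_on_def by auto
    show "b \<bullet> u / h u \<le> dir_deriv b x" if "u \<in> S" "x \<bullet> u / h u = (SUP v\<in>S. x \<bullet> v / h v)" for u
      using that by (intro dir_deriv_ge) (simp add: dual_face_iff gauge_on_def)
    fix \<sigma> :: "nat \<Rightarrow> nat" and v u
    assume v: "\<And>k. v k \<in> S" "u \<in> S" "v \<longlonglongrightarrow> u"
    have "((x + s (\<sigma> k) *\<^sub>R b) \<bullet> v k / h (v k) - x \<bullet> v k / h (v k)) / s (\<sigma> k) = b \<bullet> v k / h (v k)" for k
      using s(1)[of "\<sigma> k"] by (simp add: inner_add_left add_divide_distrib)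
    moreover have "(\<lambda>k. b \<bullet> v k / h (v k)) \<longlonglongrightarrow> b \<bullet> u / h u"
      using continuous_on_tendsto_compose[OF continuous_ratio[of b] v(3,2)] v(1) by simp
    ultimately show "(\<lambda>k. ((x + s (\<sigma> k) *\<^sub>R b) \<bullet> v k / h (v k) - x \<bullet> v k / h (v k)) / s (\<sigma> k)) \<longlonglongrightarrow> b \<bullet> u / h u"
      by simp
  qed (use s in auto)
qed

lemma measurable_dir_deriv [measurable]: "dir_deriv b \<in> borel_measurable borel"
proof (rule borel_measurable_LIMSEQ_real)
  show "(\<lambda>k. (G (x + (1 / real (Suc k)) *\<^sub>R b) - G x) / (1 / real (Suc k))) \<longlonglongrightarrow> dir_deriv b x" for x
    by (rule dir_deriv_limit, simp, rule LIMSEQ_Suc[OF lim_1_over_n])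
qed measurable

lemma dir_deriv_scale: "c > 0 \<Longrightarrow> dir_deriv b (c *\<^sub>R x) = dir_deriv b x"
  by (simp add: dir_deriv_def dual_face_scale)

lemma dir_deriv_add_nonneg: "0 \<le> dir_deriv b x + dir_deriv (- b) x"
proof -
  obtain u where "u \<in> dual_face x" using dual_face_ne by blast
  from dir_deriv_ge[OF this, of b] dir_deriv_ge[OF this, of "-b"] show ?thesis by simp
qed

lemma distr_frame_translate:
  assumes "v \<in> span B"
  shows "distr \<mu> borel (\<lambda>x. v + x) = \<mu>"
proof (rule measure_eqI)
  fix X assume "X \<in> sets (distr \<mu> borel (\<lambda>x. v + x))"
  then have X: "X \<in> sets borel" by simp
  have "emeasure (distr \<mu> borel (\<lambda>x. v + x)) X = emeasure \<mu> {x. v + x \<in> X}"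
    using X by (subst emeasure_distr) (auto simp: vimage_def)
  then show "emeasure (distr \<mu> borel (\<lambda>x. v + x)) X = emeasure \<mu> X"
    using emeasure_frame_translate[OF onb assms X] by simp
qed simp

lemma integrable_indicator_cball: "integrable \<mu> (\<lambda>x. c * indicator (cball 0 \<rho>) x :: real)"
  using emeasure_frame_bounded[OF onb, of "cball 0 \<rho>"]
  by (intro integrable_mult_right integrable_real_indicator) auto

lemma integrable_bounded_support:
  fixes f :: "real^'n \<Rightarrow> real"
  assumes [measurable]: "f \<in> borel_measurable borel" and "\<And>x. \<bar>f x\<bar> \<le> c * indicator (cball 0 \<rho>) x"
  shows "integrable \<mu> f"
proof (rule Bochner_Integration.integrable_bound)
  show "integrable \<mu> (\<lambda>x. c * indicator (cball 0 \<rho>) x)" by (rule integrable_indicator_cball)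
  show "AE x in \<mu>. norm (f x) \<le> norm (c * indicator (cball 0 \<rho>) x)"
    using assms(2) by (auto intro!: AE_I2 order_trans[OF _ abs_ge_self])
qed simp

text \<open>
  A weak form of Rademacher's theorem for \<open>G\<close>. The sum of the two one-sided derivatives is
  nonnegative, so it is enough that its integral against a positive weight vanishes. For
  difference quotients with step \<open>s\<close>, shifting the variable by \<open>s b\<close> turns the quotient in
  direction \<open>- b\<close> into the negative of the one in direction \<open>b\<close>, at the cost of shifting the
  weight. As the weight is Lipschitz, the integral is of order \<open>s\<close>.
\<close>

lemma AE_dir_deriv_opposite:
  assumes b: "b \<in> span B" "norm b \<le> 1"
  shows "AE x in \<mu>. dir_deriv b x + dir_deriv (- b) x = 0"
proof -
  define s where "s k = 1 / real (Suc k)" for k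
  have s: "s k > 0" "s k \<le> 1" "s \<longlonglongrightarrow> 0" for k
    unfolding s_def[abs_def] by (simp, simp, rule LIMSEQ_Suc[OF lim_1_over_n])
  have AEm: "AE x in \<mu>. norm x < real m \<longrightarrow> dir_deriv b x + dir_deriv (- b) x = 0" for m :: nat
  proof -
    \<comment> \<open>the weight, positive exactly on the open ball of radius \<open>m\<close>\<close>
    define \<phi> where "\<phi> x = max 0 (real m - norm x)" for x :: "real^'n"
    have [measurable]: "\<phi> \<in> borel_measurable borel" unfolding \<phi>_def[abs_def] by measurable
    define q where "q k c x = (G (x + s k *\<^sub>R c) - G x) / s k" for k c x
    have [measurable]: "q k c \<in> borel_measurable borel" for k c unfolding q_def[abs_def] by measurable
    have q_le: "\<bar>q k c x\<bar> \<le> 1 / r" if "norm c \<le> 1" for k c x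
    proof -
      have "\<bar>G (x + s k *\<^sub>R c) - G x\<bar> \<le> s k * norm c / r"
        using G_lipschitz[of "x + s k *\<^sub>R c" x] s(1)[of k] by simp
      also have "\<dots> \<le> s k * 1 / r"
        using that s(1)[of k] r_pos by (intro divide_right_mono mult_left_mono) auto
      finally show ?thesis using s(1)[of k] by (simp add: q_def abs_mult field_simps)
    qed
    have phi_le: "\<bar>\<phi> x\<bar> \<le> real m * indicator (cball 0 (real m)) x" for x
      by (auto simp: \<phi>_def indicator_def)
    have int: "integrable \<mu> (\<lambda>x. \<phi> x * q k c x)" if "norm c \<le> 1" for k c
    proof (rule integrable_bounded_support)
      show "\<bar>\<phi> x * q k c x\<bar> \<le> (real m * (1 / r)) * indicator (cball 0 (real m)) x" for x
        using mult_mono[OF phi_le[of x] q_le[OF that, of k x]] by (simp add: abs_mult mult.commute mult.left_commute)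
    qed measurable
    have trans: "(\<integral>x. \<phi> x * q k (- b) x \<partial>\<mu>) = - (\<integral>x. \<phi> (s k *\<^sub>R b + x) * q k b x \<partial>\<mu>)" for k
    proof -
      have "(\<integral>x. \<phi> x * q k (- b) x \<partial>\<mu>) = (\<integral>x. \<phi> x * q k (- b) x \<partial>distr \<mu> borel (\<lambda>x. s k *\<^sub>R b + x))"
        using distr_frame_translate[of "s k *\<^sub>R b"] b(1) by (simp add: span_scale)
      also have "\<dots> = (\<integral>x. \<phi> (s k *\<^sub>R b + x) * q k (- b) (s k *\<^sub>R b + x) \<partial>\<mu>)"
        by (rule integral_distr) auto
      also have "\<dots> = (\<integral>x. - (\<phi> (s k *\<^sub>R b + x) * q k b x) \<partial>\<mu>)"
      proof (rule Bochner_Integration.integral_cong[OF refl])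
        fix x
        have "q k (- b) (s k *\<^sub>R b + x) = - q k b x"
          by (simp add: q_def add.commute minus_divide_left)
        then show "\<phi> (s k *\<^sub>R b + x) * q k (- b) (s k *\<^sub>R b + x) = - (\<phi> (s k *\<^sub>R b + x) * q k b x)"
          by simp
      qed
      finally show ?thesis by simp
    qed
    have phi_diff: "\<bar>\<phi> x - \<phi> (s k *\<^sub>R b + x)\<bar> \<le> s k * indicator (cball 0 (real m + 1)) x" for k x
    proof -
      have nb: "norm (s k *\<^sub>R b) \<le> s k" using b(2) s(1)[of k] by (simp add: mult_left_le)
      have 1: "\<bar>norm x - norm (s k *\<^sub>R b + x)\<bar> \<le> s k"
        using norm_triangle_ineq3[of x "s k *\<^sub>R b + x"] nb by simp
      show ?thesis
      proof (cases "norm x \<le> real m + 1")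
        case True
        then show ?thesis using 1 by (auto simp: \<phi>_def)
      next
        case False
        then have "norm (s k *\<^sub>R b + x) \<ge> real m" using 1 s(2)[of k] by linarith
        then show ?thesis using False by (simp add: \<phi>_def)
      qed
    qed
    have int2: "integrable \<mu> (\<lambda>x. \<phi> (s k *\<^sub>R b + x) * q k b x)" for k
    proof (rule integrable_bounded_support)
      show "\<bar>\<phi> (s k *\<^sub>R b + x) * q k b x\<bar> \<le> ((real m + 1) * (1 / r)) * indicator (cball 0 (real m + 1)) x" for x
      proof -
        have "\<bar>\<phi> (s k *\<^sub>R b + x)\<bar> \<le> (real m + 1) * indicator (cball 0 (real m + 1)) x"
        proof (cases "norm x \<le> real m + 1")
          case True
          moreover have "0 \<le> norm (s k *\<^sub>R b + x)" by (rule norm_ge_zero)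
          ultimately show ?thesis unfolding \<phi>_def by (simp del: norm_ge_zero)
        next
          case False
          then show ?thesis using phi_diff[of x k] phi_le[of x] by simp
        qed
        from mult_mono[OF this q_le[OF b(2), of k x]]
        show ?thesis by (simp add: abs_mult mult.commute mult.left_commute)
      qed
    qed measurable
    have eq: "(\<integral>x. \<phi> x * (q k b x + q k (- b) x) \<partial>\<mu>) = (\<integral>x. (\<phi> x - \<phi> (s k *\<^sub>R b + x)) * q k b x \<partial>\<mu>)" for k
      using int[OF b(2), of k] int[of "-b" k] b(2) trans[of k] int2[of k]
      by (simp add: distrib_left left_diff_distrib)
    have lim0: "(\<lambda>k. \<integral>x. (\<phi> x - \<phi> (s k *\<^sub>R b + x)) * q k b x \<partial>\<mu>) \<longlonglongrightarrow> (\<integral>x. 0 \<partial>\<mu>)"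
    proof (rule integral_dominated_convergence[where w = "\<lambda>x. (1 / r) * indicator (cball 0 (real m + 1)) x"])
      have bd: "\<bar>(\<phi> x - \<phi> (s k *\<^sub>R b + x)) * q k b x\<bar> \<le> s k * ((1 / r) * indicator (cball 0 (real m + 1)) x)" for k x
        using mult_mono[OF phi_diff[of x k] q_le[OF b(2), of k x]] s(1)[of k]
        by (simp add: abs_mult mult.commute mult.left_commute)
      show "AE x in \<mu>. norm ((\<phi> x - \<phi> (s k *\<^sub>R b + x)) * q k b x) \<le> (1 / r) * indicator (cball 0 (real m + 1)) x" for k
      proof (rule AE_I2)
        fix x :: "real^'n"
        have "s k * ((1 / r) * indicator (cball 0 (real m + 1)) x) \<le> (1 / r) * indicator (cball 0 (real m + 1)) x"
          using s(1,2)[of k] r_pos by (intro mult_left_le_one_le) auto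
        then show "norm ((\<phi> x - \<phi> (s k *\<^sub>R b + x)) * q k b x) \<le> (1 / r) * indicator (cball 0 (real m + 1)) x"
          using bd[of x k] by simp
      qed
      show "AE x in \<mu>. (\<lambda>k. (\<phi> x - \<phi> (s k *\<^sub>R b + x)) * q k b x) \<longlonglongrightarrow> 0"
      proof (rule AE_I2)
        fix x :: "real^'n"
        have "(\<lambda>k. s k * ((1 / r) * indicator (cball 0 (real m + 1)) x)) \<longlonglongrightarrow> 0"
          using tendsto_mult_left_zero[OF s(3)] by blast
        then show "(\<lambda>k. (\<phi> x - \<phi> (s k *\<^sub>R b + x)) * q k b x) \<longlonglongrightarrow> 0"
          by (rule Lim_null_comparison[rotated]) (use bd[of x] in simp)
      qed
      show "integrable \<mu> (\<lambda>x. (1 / r) * indicator (cball 0 (real m + 1)) x)"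
        by (rule integrable_indicator_cball)
    qed measurable
    define D where "D x = \<phi> x * (dir_deriv b x + dir_deriv (- b) x)" for x
    have [measurable]: "D \<in> borel_measurable borel" unfolding D_def[abs_def] by measurable
    have D_nonneg: "0 \<le> D x" for x unfolding D_def using dir_deriv_add_nonneg by (simp add: \<phi>_def)
    have bound: "\<bar>\<phi> x * (q k b x + q k (- b) x)\<bar> \<le> (real m * (2 / r)) * indicator (cball 0 (real m)) x" for k x
    proof -
      have "\<bar>q k b x + q k (- b) x\<bar> \<le> 2 / r" using q_le[OF b(2), of k x] q_le[of "-b" k x] b(2) by simp
      from mult_mono[OF phi_le[of x] this] show ?thesis by (simp add: abs_mult mult.commute mult.left_commute)
    qed
    have plim: "(\<lambda>k. \<phi> x * (q k b x + q k (- b) x)) \<longlonglongrightarrow> D x" for x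
      unfolding D_def q_def by (intro tendsto_intros dir_deriv_limit s)
    have limD: "(\<lambda>k. \<integral>x. \<phi> x * (q k b x + q k (- b) x) \<partial>\<mu>) \<longlonglongrightarrow> (\<integral>x. D x \<partial>\<mu>)"
    proof (rule integral_dominated_convergence[where w = "\<lambda>x. (real m * (2 / r)) * indicator (cball 0 (real m)) x"])
      show "integrable \<mu> (\<lambda>x. (real m * (2 / r)) * indicator (cball 0 (real m)) x)"
        by (rule integrable_indicator_cball)
    qed (use bound plim in \<open>auto intro!: AE_I2\<close>)
    have intD: "integrable \<mu> D"
    proof (rule integrable_bounded_support)
      show "\<bar>D x\<bar> \<le> (real m * (2 / r)) * indicator (cball 0 (real m)) x" for x
        by (rule LIMSEQ_le_const2[OF tendsto_rabs[OF plim[of x]]]) (use bound in blast)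
    qed measurable
    have "(\<integral>x. D x \<partial>\<mu>) = 0" using LIMSEQ_unique[OF limD] lim0 unfolding eq by simp
    then have "AE x in \<mu>. D x = 0"
      using integral_nonneg_eq_0_iff_AE[OF intD] D_nonneg by auto
    then show ?thesis by eventually_elim (auto simp: D_def \<phi>_def split: if_splits)
  qed
  have "AE x in \<mu>. \<forall>m::nat. norm x < real m \<longrightarrow> dir_deriv b x + dir_deriv (- b) x = 0"
    unfolding AE_all_countable using AEm by blast
  then show ?thesis
  proof eventually_elim
    case (elim x)
    obtain m :: nat where "norm x < real m" using reals_Archimedean2 by blast
    then show ?case using elim by blast
  qed
qed

text \<open>
  By convexity it is enough to have derivatives along the finitely many directions of \<open>B\<close>;
  then the normal is unique.
\<close>

definition "regular_pt x \<longleftrightarrow> (\<forall>b\<in>B. dir_deriv b x + dir_deriv (- b) x = 0)"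

text \<open>
  At regular points the gradient of \<open>G\<close> is \<open>u / h u\<close> with \<open>u\<close> the unique normal. The default
  value at other points makes the map take values in the unit sphere of \<open>span B\<close> everywhere.
\<close>

definition "gauss x = (if regular_pt x then sgn (\<Sum>b\<in>B. dir_deriv b x *\<^sub>R b) else (SOME b. b \<in> B))"

lemma AE_regular: "AE x in \<mu>. regular_pt x"
  unfolding regular_pt_def
proof (rule AE_finite_allI[OF orthonormal_set_finite[OF onb]])
  fix b assume "b \<in> B"
  then show "AE x in \<mu>. dir_deriv b x + dir_deriv (- b) x = 0"
    using B_sub_S by (intro AE_dir_deriv_opposite) auto
qed

lemma measurable_regular [measurable]: "Measurable.pred borel regular_pt"
proof -
  have "finite B" by (rule orthonormal_set_finite[OF onb])
  then have "countable B" by (rule countable_finite)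
  then show ?thesis unfolding regular_pt_def[abs_def] by measurable
qed

lemma measurable_gauss [measurable]: "gauss \<in> borel_measurable borel"
proof -
  have [measurable]: "(sgn :: real^'n \<Rightarrow> real^'n) \<in> borel_measurable borel"
    unfolding sgn_div_norm[abs_def] by measurable
  show ?thesis unfolding gauss_def[abs_def] by measurable
qed

lemma regular_scale: "c > 0 \<Longrightarrow> regular_pt (c *\<^sub>R x) \<longleftrightarrow> regular_pt x"
  by (simp add: regular_pt_def dir_deriv_scale)

lemma gauss_scale: "c > 0 \<Longrightarrow> gauss (c *\<^sub>R x) = gauss x"
  by (simp add: gauss_def dir_deriv_scale regular_scale)

text \<open>
  Each \<open>u\<close> in the dual face yields a lower bound for both one-sided derivatives. If these are
  opposite to each other, they determine all coordinates of \<open>u / h u\<close>.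
\<close>

lemma regular_dual_face:
  assumes "regular_pt x"
  shows "dual_face x = {gauss x}"
proof -
  have "u = gauss x" if u: "u \<in> dual_face x" for u
  proof -
    have uS: "u \<in> S" using u by (simp add: dual_face_def)
    have "b \<bullet> u / h u = dir_deriv b x" if "b \<in> B" for b
    proof -
      have "b \<bullet> u / h u \<le> dir_deriv b x" "(-b) \<bullet> u / h u \<le> dir_deriv (-b) x"
        by (rule dir_deriv_ge[OF u])+
      moreover have "dir_deriv b x + dir_deriv (-b) x = 0" using assms that by (simp add: regular_pt_def)
      ultimately show ?thesis by simp
    qed
    then have "(\<Sum>b\<in>B. dir_deriv b x *\<^sub>R b) = (\<Sum>b\<in>B. (b \<bullet> u / h u) *\<^sub>R b)" by simp
    also have "\<dots> = (1 / h u) *\<^sub>R (\<Sum>b\<in>B. (u \<bullet> b) *\<^sub>R b)"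
      by (simp add: scaleR_sum_right inner_commute)
    also have "\<dots> = (1 / h u) *\<^sub>R u" using orthonormal_set_expand[OF onb, of u] uS by simp
    finally show ?thesis
      using assms uS h_pos[OF uS] by (simp add: gauss_def sgn_scaleR sgn_div_norm)
  qed
  then show ?thesis using dual_face_ne[of x] by blast
qed

lemma gauss_in_S: "gauss x \<in> S"
proof (cases "regular_pt x")
  case True
  then have "gauss x \<in> dual_face x" by (simp add: regular_dual_face)
  then show ?thesis by (simp add: dual_face_def)
next
  case False
  moreover have "(SOME b. b \<in> B) \<in> B" using B_ne by (simp add: some_in_eq)
  ultimately show ?thesis using B_sub_S unfolding gauss_def by auto
qed

end

section \<open>Volumes of cones\<close>

lemma nn_integral_power_Icc:
  assumes "0 < a"
  shows "(\<integral>\<^sup>+t. ennreal ((t / a) ^ m) * indicator {0..a} t \<partial>lborel) = ennreal (a / real (Suc m))"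
proof -
  have "(\<integral>\<^sup>+t. ennreal ((t / a) ^ m) * indicator {0..a} t \<partial>lborel) =
      ennreal ((a / real (Suc m)) * (a / a) ^ Suc m - (a / real (Suc m)) * (0 / a) ^ Suc m)"
  proof (rule nn_integral_FTC_Icc)
    fix t
    have "((\<lambda>t. (t / a) ^ Suc m) has_real_derivative real (Suc m) * (t / a) ^ m * (1 / a)) (at t)"
      by (rule DERIV_cong[OF DERIV_power[OF DERIV_cdivide[OF DERIV_ident]]]) (simp add: mult_ac)
    from DERIV_cmult[OF this, of "a / real (Suc m)"]
    show "((\<lambda>t. a / real (Suc m) * (t / a) ^ Suc m) has_real_derivative (t / a) ^ m) (at t)"
      using assms by (simp del: power_Suc of_nat_Suc)
  qed (use assms in auto)
  then show ?thesis using assms by simp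
qed

text \<open>
  This takes the place of integration in polar coordinates. The layer-cake formula expresses
  the integral by the measures of the sets \<open>g \<le> t\<close>, which are proportional to \<open>t ^ card B\<close> by
  homogeneity.
\<close>

lemma (in framed_body) cone_layer_cake:
  assumes W [measurable]: "W \<in> sets borel" and cone: "\<And>x c. c > 0 \<Longrightarrow> c *\<^sub>R x \<in> W \<longleftrightarrow> x \<in> W"
    and g [measurable]: "g \<in> borel_measurable borel" and g0: "\<And>x. 0 \<le> g x"
    and gs: "\<And>x c. c > 0 \<Longrightarrow> g (c *\<^sub>R x) = c * g x"
  shows "ennreal (real (card B) + 1) * (\<integral>\<^sup>+x. indicator W x * ennreal (max 0 (1 - g x)) \<partial>\<mu>) =
     emeasure \<mu> {x\<in>W. g x \<le> 1}"
proof -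
  interpret frame: sigma_finite_measure \<mu> by (rule sigma_finite_frame_lborel[OF onb])
  interpret pair_sigma_finite \<mu> lborel ..
  define Y where "Y t = {x\<in>W. g x \<le> t}" for t
  have Ym: "Y t \<in> sets borel" for t
  proof -
    have "{x\<in>space borel. x \<in> W \<and> g x \<le> t} \<in> sets borel" by measurable
    then show ?thesis by (simp add: Y_def)
  qed
  have pt: "indicator W x * ennreal (max 0 (1 - g x)) =
      (\<integral>\<^sup>+t. indicator W x * indicator {0..1} t * (if g x \<le> t then 1 else 0) \<partial>lborel)" for x
  proof -
    have "(\<integral>\<^sup>+t. indicator W x * indicator {0..1} t * (if g x \<le> t then 1 else 0) \<partial>lborel) =
        (\<integral>\<^sup>+t. indicator W x * indicator {g x..1} t \<partial>lborel)"
      using g0[of x] by (intro nn_integral_cong) (auto simp: indicator_def)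
    also have "\<dots> = indicator W x * emeasure lborel {g x..1}"
      by (subst nn_integral_cmult) auto
    also have "emeasure lborel {g x..1} = ennreal (max 0 (1 - g x))"
      by (cases "g x \<le> 1") (auto simp: max_def)
    finally show ?thesis by simp
  qed
  have scale: "emeasure \<mu> (Y t) = ennreal (t ^ card B) * emeasure \<mu> (Y 1)" if "t > 0" for t
  proof -
    have "{x. t *\<^sub>R x \<in> Y t} = Y 1" using that by (auto simp: Y_def cone gs)
    then show ?thesis using emeasure_frame_scale[OF onb that Ym[of t]] by simp
  qed
  have "(\<integral>\<^sup>+x. indicator W x * ennreal (max 0 (1 - g x)) \<partial>\<mu>) =
      (\<integral>\<^sup>+x. \<integral>\<^sup>+t. indicator W x * indicator {0..1} t * (if g x \<le> t then 1 else 0) \<partial>lborel \<partial>\<mu>)"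
    by (simp add: pt)
  also have "\<dots> = (\<integral>\<^sup>+t. \<integral>\<^sup>+x. indicator W x * indicator {0..1} t * (if g x \<le> t then 1 else 0) \<partial>\<mu> \<partial>lborel)"
    by (rule Fubini'[symmetric]) measurable
  also have "\<dots> = (\<integral>\<^sup>+t. indicator {0..1} t * emeasure \<mu> (Y t) \<partial>lborel)"
  proof (rule nn_integral_cong)
    fix t :: real
    have "(\<integral>\<^sup>+x. indicator W x * indicator {0..1} t * (if g x \<le> t then 1 else 0) \<partial>\<mu>) =
        (\<integral>\<^sup>+x. indicator {0..1} t * indicator (Y t) x \<partial>\<mu>)"
      by (intro nn_integral_cong) (auto simp: indicator_def Y_def)
    then show "(\<integral>\<^sup>+x. indicator W x * indicator {0..1} t * (if g x \<le> t then 1 else 0) \<partial>\<mu>) =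
        indicator {0..1} t * emeasure \<mu> (Y t)"
      using Ym[of t] by (simp add: nn_integral_cmult)
  qed
  also have "\<dots> = (\<integral>\<^sup>+t. ennreal ((t / 1) ^ card B) * indicator {0..1} t * emeasure \<mu> (Y 1) \<partial>lborel)"
  proof (rule nn_integral_cong_AE)
    show "AE t in lborel. indicator {0..1} t * emeasure \<mu> (Y t) =
        ennreal ((t / 1) ^ card B) * indicator {0..1} t * emeasure \<mu> (Y 1)"
      using AE_lborel_singleton[of "0::real"]
    proof eventually_elim
      case (elim t)
      then show ?case using scale[of t] by (cases "t > 0") (auto simp: indicator_def)
    qed
  qed
  also have "\<dots> = ennreal (1 / real (Suc (card B))) * emeasure \<mu> (Y 1)"
    by (subst nn_integral_multc) (auto simp: nn_integral_power_Icc[of 1 "card B", simplified])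
  finally have "ennreal (real (card B) + 1) * (\<integral>\<^sup>+x. indicator W x * ennreal (max 0 (1 - g x)) \<partial>\<mu>) =
      ennreal ((real (card B) + 1) * (1 / real (Suc (card B)))) * emeasure \<mu> (Y 1)"
    by (subst ennreal_mult) (simp_all add: mult.assoc)
  also have "(real (card B) + 1) * (1 / real (Suc (card B))) = 1" by simp
  finally show ?thesis by (simp add: Y_def)
qed

lemma nn_integral_frame_cong_fibre:
  assumes "orthonormal_set (insert u B')" "u \<notin> B'" and [measurable]: "f \<in> borel_measurable borel"
    and "\<And>t y. y \<in> span B' \<Longrightarrow> f (t *\<^sub>R u + y) = g t y"
  shows "(\<integral>\<^sup>+x. f x \<partial>frame_lborel (insert u B')) = (\<integral>\<^sup>+t. \<integral>\<^sup>+y. g t y \<partial>frame_lborel B' \<partial>lborel)"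
  unfolding nn_integral_frame_insert[OF assms(1-3)]
  using AE_frame_lborel_span[of B'] assms(4)
  by (intro nn_integral_cong nn_integral_cong_AE) (auto elim!: eventually_mono)

lemma orthonormal_insert_orth:
  assumes "orthonormal_set (insert u B')" "u \<notin> B'"
  shows "y \<in> span B' \<Longrightarrow> y \<bullet> u = 0"
    and "y \<in> span (insert u B') \<Longrightarrow> y \<bullet> u = 0 \<Longrightarrow> y \<in> span B'"
proof -
  have "\<forall>c\<in>B'. orthogonal u c"
    using assms by (auto simp: orthonormal_set_def pairwise_insert)
  then show "y \<in> span B' \<Longrightarrow> y \<bullet> u = 0"
    using orthogonal_to_span[of y B' u] by (auto simp: orthogonal_def inner_commute)
  assume y: "y \<in> span (insert u B')" "y \<bullet> u = 0"
  have fin: "finite B'" using orthonormal_set_finite[OF assms(1)] by simp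
  have "y = (\<Sum>b\<in>B'. (y \<bullet> b) *\<^sub>R b)"
    using orthonormal_set_expand[OF assms(1) y(1)] fin assms(2) y(2) by simp
  also have "\<dots> \<in> span B'" by (intro span_sum span_scale span_base)
  finally show "y \<in> span B'" .
qed

text \<open>
  The section of a cone at height \<open>t\<close> is the dilate by \<open>t / a\<close> of the section at height \<open>a\<close>.
  Integrating over \<open>t\<close> gives the volume as height times base divided by dimension.
\<close>

lemma emeasure_cone_slab:
  assumes o: "orthonormal_set (insert u B')" and u: "u \<notin> B'"
    and W [measurable]: "W \<in> sets borel" and cone: "\<And>x c. c > 0 \<Longrightarrow> c *\<^sub>R x \<in> W \<longleftrightarrow> x \<in> W"
    and Wpos: "\<And>x. x \<in> W \<Longrightarrow> 0 < x \<bullet> u" and a: "a > 0"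
  shows "emeasure (frame_lborel (insert u B')) {x\<in>W. x \<bullet> u \<le> a} =
     ennreal (a / real (Suc (card B'))) * emeasure (frame_lborel B') {y. a *\<^sub>R u + y \<in> W}"
proof -
  have o': "orthonormal_set B'" using o by (rule orthonormal_set_mono) auto
  have uu: "u \<bullet> u = 1" using o by (simp add: orthonormal_set_def norm_eq_1)
  interpret frame: sigma_finite_measure "frame_lborel B'" by (rule sigma_finite_frame_lborel[OF o'])
  define Y where "Y t = {y. t *\<^sub>R u + y \<in> W}" for t
  have Ym [measurable]: "Y t \<in> sets borel" for t
  proof -
    have "{y\<in>space borel. t *\<^sub>R u + y \<in> W} \<in> sets borel" by measurable
    then show ?thesis by (simp add: Y_def)
  qed
  have Vm: "{x\<in>W. x \<bullet> u \<le> a} \<in> sets borel"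
  proof -
    have "{x\<in>space borel. x \<in> W \<and> x \<bullet> u \<le> a} \<in> sets borel" by measurable
    then show ?thesis by simp
  qed
  have inner: "(t *\<^sub>R u + y) \<bullet> u = t" if "y \<in> span B'" for t y
    using orthonormal_insert_orth(1)[OF o u that] uu by (simp add: inner_add_left)
  have "emeasure (frame_lborel (insert u B')) {x\<in>W. x \<bullet> u \<le> a} =
     (\<integral>\<^sup>+x. indicator {x\<in>W. x \<bullet> u \<le> a} x \<partial>frame_lborel (insert u B'))" using Vm by simp
  also have "\<dots> = (\<integral>\<^sup>+t. \<integral>\<^sup>+y. (if 0 < t \<and> t \<le> a then indicator (Y t) y else 0) \<partial>frame_lborel B' \<partial>lborel)"
  proof (rule nn_integral_frame_cong_fibre[OF o u])
    show "indicator {x\<in>W. x \<bullet> u \<le> a} \<in> borel_measurable borel" using Vm by simp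
    fix t y assume y: "y \<in> span B'"
    show "indicator {x\<in>W. x \<bullet> u \<le> a} (t *\<^sub>R u + y) = (if 0 < t \<and> t \<le> a then indicator (Y t) y else 0)"
      using inner[OF y, of t] Wpos[of "t *\<^sub>R u + y"] by (auto simp: indicator_def Y_def)
  qed
  also have "\<dots> = (\<integral>\<^sup>+t. ennreal ((t / a) ^ card B') * indicator {0..a} t * emeasure (frame_lborel B') (Y a) \<partial>lborel)"
  proof (rule nn_integral_cong_AE)
    show "AE t in lborel. (\<integral>\<^sup>+y. (if 0 < t \<and> t \<le> a then indicator (Y t) y else 0) \<partial>frame_lborel B') =
        ennreal ((t / a) ^ card B') * indicator {0..a} t * emeasure (frame_lborel B') (Y a)"
      using AE_lborel_singleton[of "0::real"]
    proof eventually_elim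
      case (elim t)
      show ?case
      proof (cases "0 < t \<and> t \<le> a")
        case True
        have "{y. (t / a) *\<^sub>R y \<in> Y t} = Y a"
        proof -
          have "t *\<^sub>R u + (t / a) *\<^sub>R y = (t / a) *\<^sub>R (a *\<^sub>R u + y)" for y
            using a by (simp add: scaleR_add_right)
          then show ?thesis using cone[of "t / a"] True a by (simp add: Y_def)
        qed
        then show ?thesis using emeasure_frame_scale[OF o' _ Ym[of t], of "t / a"] True a by simp
      next
        case False
        then have "t \<notin> {0..a}" using elim by auto
        then show ?thesis unfolding if_not_P[OF False] by simp
      qed
    qed
  qed
  also have "\<dots> = ennreal (a / real (Suc (card B'))) * emeasure (frame_lborel B') (Y a)"
    by (subst nn_integral_multc) (auto simp: nn_integral_power_Icc[OF a] simp del: of_nat_Suc)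
  finally show ?thesis by (simp add: Y_def)
qed

text \<open>
  Two points whose heights over the hyperplane \<open>x \<bullet> u = 0\<close> are close to \<open>k\<close>, and whose
  difference is almost parallel to this hyperplane, are projected from the origin to the
  hyperplane \<open>x \<bullet> u = k\<close>. The images differ by a multiple, with factor close to \<open>1\<close>, of
  \<open>x - y + z\<close>, where \<open>z\<close> corrects for the difference of heights; by the last two hypotheses
  \<open>z\<close> is small compared with \<open>x - y\<close>.
\<close>

lemma central_projection_bilipschitz:
  fixes x y :: "'a::euclidean_space"
  assumes ab: "0 < x \<bullet> u" "0 < y \<bullet> u" and l: "1 \<le> l" "l \<le> 2"
    and ha: "x \<bullet> u \<le> l\<^sup>2 * k" "k \<le> l\<^sup>2 * (x \<bullet> u)" and k: "0 < k"
    and d: "\<bar>(x - y) \<bullet> u\<bar> \<le> \<eta> * norm (x - y)" and e: "norm y * \<eta> \<le> (l - 1) / 3 * (y \<bullet> u)"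
  shows "norm ((k / (x \<bullet> u)) *\<^sub>R x - (k / (y \<bullet> u)) *\<^sub>R y) \<le> l ^ 3 * norm (x - y)"
    and "norm (x - y) \<le> l ^ 3 * norm ((k / (x \<bullet> u)) *\<^sub>R x - (k / (y \<bullet> u)) *\<^sub>R y)"
proof -
  define a b D where "a = x \<bullet> u" and "b = y \<bullet> u" and "D = norm (x - y)"
  define z where "z = ((b - a) / b) *\<^sub>R y"
  have pos: "0 < a" "0 < b" "0 \<le> D" using ab by (auto simp: a_def b_def D_def)
  let ?w = "(k / a) *\<^sub>R x - (k / b) *\<^sub>R y"
  have w: "?w = (k / a) *\<^sub>R ((x - y) + z)"
    unfolding z_def using pos by (simp add: algebra_simps diff_divide_distrib)
  have "\<bar>(b - a) / b\<bar> * norm y \<le> \<eta> * D / b * norm y"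
    using d pos by (intro mult_right_mono) (auto simp: a_def b_def D_def inner_diff_left abs_minus_commute divide_right_mono)
  also have "\<dots> = (norm y * \<eta>) * D / b" by simp
  also have "\<dots> \<le> ((l - 1) / 3 * b) * D / b"
    using e pos by (intro divide_right_mono mult_right_mono) (auto simp: b_def)
  also have "\<dots> = (l - 1) / 3 * D" using pos by simp
  finally have second: "norm z \<le> (l - 1) / 3 * D" by (simp add: z_def)
  have nw: "norm ?w = k / a * norm ((x - y) + z)"
    unfolding w using k pos by simp
  have up: "norm ((x - y) + z) \<le> D + (l - 1) / 3 * D"
    using norm_triangle_ineq[of "x - y" z] second unfolding D_def by linarith
  have lo: "D - (l - 1) / 3 * D \<le> norm ((x - y) + z)"
    using norm_diff_ineq[of "x - y" z] second unfolding D_def by linarith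
  have ka: "k / a \<le> l\<^sup>2" "1 \<le> l\<^sup>2 * (k / a)" using ha pos by (auto simp: a_def field_simps)
  have "(l - 1) / 3 * D \<le> (l - 1) * D" using l pos by (intro mult_right_mono) auto
  then have "D + (l - 1) / 3 * D \<le> l * D" by (simp add: algebra_simps)
  then have "norm ?w \<le> l\<^sup>2 * (l * D)"
    unfolding nw using up ka k pos by (intro mult_mono) auto
  then show "norm ((k / (x \<bullet> u)) *\<^sub>R x - (k / (y \<bullet> u)) *\<^sub>R y) \<le> l ^ 3 * norm (x - y)"
    by (simp add: a_def b_def D_def power2_eq_square power3_eq_cube mult.assoc)
  have "l * (D - (l - 1) / 3 * D) - D = (l - 1) * (1 - l / 3) * D" by (simp add: field_simps)
  moreover have "0 \<le> (l - 1) * (1 - l / 3) * D" using l pos by (intro mult_nonneg_nonneg) auto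
  ultimately have "D \<le> l * (D - (l - 1) / 3 * D)" by simp
  also have "\<dots> \<le> l * norm ((x - y) + z)" using lo l by (intro mult_left_mono) auto
  also have "\<dots> \<le> (l\<^sup>2 * (k / a)) * (l * norm ((x - y) + z))"
    using mult_right_mono[OF ka(2), of "l * norm ((x - y) + z)"] l by simp
  also have "\<dots> = l ^ 3 * norm ?w" unfolding nw by (simp add: power2_eq_square power3_eq_cube mult_ac)
  finally show "norm (x - y) \<le> l ^ 3 * norm ((k / (x \<bullet> u)) *\<^sub>R x - (k / (y \<bullet> u)) *\<^sub>R y)"
    by (simp add: a_def b_def D_def)
qed

section \<open>Boundary pieces with nearly constant normal\<close>

text \<open>
  All comparisons of measures below hold up to a power of a factor \<open>l\<close> that may be chosen
  arbitrarily close to \<open>1\<close>.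
\<close>

lemma ennreal_le_limit_factor:
  fixes x y :: ennreal
  assumes "\<And>l. 1 < l \<Longrightarrow> l \<le> 2 \<Longrightarrow> x \<le> ennreal (l ^ p) * y"
  shows "x \<le> y"
proof (cases y)
  case (real c)
  have "((\<lambda>l. ennreal (l ^ p * c)) \<longlongrightarrow> ennreal (1 ^ p * c)) (at_right 1)"
    by (intro tendsto_ennrealI tendsto_intros)
  moreover have "eventually (\<lambda>l. x \<le> ennreal (l ^ p * c)) (at_right (1::real))"
    unfolding eventually_at_right_field
    using assms real by (intro exI[of _ 2]) (auto simp: ennreal_mult)
  ultimately have "x \<le> ennreal (1 ^ p * c)"
    by (rule tendsto_lowerbound) simp
  then show ?thesis using real by simp
qed simp

context framed_body
begin

text \<open>
  With this weight, integration over the cone spanned by a boundary piece gives the area of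
  the piece. For a flat piece with normal \<open>u\<close> the cone has volume \<open>h u / j\<close> times the area,
  where \<open>j = card B\<close>, and the mean of \<open>G\<close> over the cone is \<open>j / (j + 1)\<close>. The factor \<open>G\<close> is
  the one that the first variation of volume produces.
\<close>

definition "cone_dens x = ennreal ((real (card B) + 1) * G x / h (gauss x)) * indicator {x. G x \<le> 1} x"

definition "cone_measure = density \<mu> cone_dens"

text \<open>
  The candidate for the area on the relative boundary. Since the Gauss map is constant along
  rays, \<open>surf_measure\<close> is the image of this measure under the Gauss map. Both are measures by
  construction, whereas for the set function in the definition of the surface area measure
  this has to be proved.
\<close>

definition "bdry_measure = distr cone_measure borel (\<lambda>x. x /\<^sub>R G x)"

definition "surf_measure = distr cone_measure (restrict_space borel S) gauss"

definition "cone_over E = {x \<in> span B. 0 < G x \<and> x /\<^sub>R G x \<in> E}"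

lemma measurable_h [measurable]: "h \<in> borel_measurable borel"
  by (rule borel_measurable_continuous_onI[OF continuous_h])

lemma G_le_1_borel [measurable]: "{x. G x \<le> 1} \<in> sets borel"
  using measurable_G by (simp add: borel_measurable_iff_le)

lemma measurable_cone_dens [measurable]: "cone_dens \<in> borel_measurable borel"
  unfolding cone_dens_def[abs_def] by measurable

lemma sets_cone_measure [simp, measurable_cong]: "sets cone_measure = sets borel"
  by (simp add: cone_measure_def)

lemma space_cone_measure [simp]: "space cone_measure = UNIV"
  by (simp add: cone_measure_def)

lemma sets_bdry_measure [simp, measurable_cong]: "sets bdry_measure = sets borel"
  by (simp add: bdry_measure_def)

lemma measurable_gauss_S: "gauss \<in> borel \<rightarrow>\<^sub>M restrict_space borel S"
  using gauss_in_S by (intro measurable_restrict_space2 measurable_gauss) auto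

lemma sets_surf_measure: "sets surf_measure = sets (restrict_space borel S)"
  and space_surf_measure: "space surf_measure = S"
  by (simp_all add: surf_measure_def space_restrict_space)

lemma emeasure_unit_sublevel_finite: "emeasure \<mu> {x\<in>W. G x \<le> 1} < \<infinity>" if [measurable]: "W \<in> sets borel"
proof -
  have "emeasure \<mu> {x\<in>W. G x \<le> 1} \<le> emeasure \<mu> A"
  proof (rule emeasure_mono_AE)
    show "AE x in \<mu>. x \<in> {x\<in>W. G x \<le> 1} \<longrightarrow> x \<in> A"
      using AE_frame_lborel_span[of B] by eventually_elim (auto simp: mem_A_iff)
    show "A \<in> sets \<mu>" using compact_A by (simp add: borel_compact)
  qed
  also have "\<dots> < \<infinity>" by (rule emeasure_frame_bounded[OF onb compact_imp_bounded[OF compact_A]])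
  finally show ?thesis .
qed

lemma finite_cone_measure: "emeasure cone_measure UNIV < \<infinity>"
proof -
  let ?c = "ennreal ((real (card B) + 1) / r)"
  have "emeasure cone_measure UNIV = (\<integral>\<^sup>+x. cone_dens x \<partial>\<mu>)"
    unfolding cone_measure_def by (subst emeasure_density) auto
  also have "\<dots> \<le> (\<integral>\<^sup>+x. ?c * indicator {x\<in>UNIV. G x \<le> 1} x \<partial>\<mu>)"
  proof (rule nn_integral_mono)
    fix x
    have "(real (card B) + 1) * G x / h (gauss x) \<le> (real (card B) + 1) / r" if "G x \<le> 1"
      using that G_nonneg[of x] h_bounds(1)[OF gauss_in_S[of x]] r_pos
      by (intro frac_le) (auto intro: mult_left_le)
    then show "cone_dens x \<le> ?c * indicator {x\<in>UNIV. G x \<le> 1} x"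
      by (cases "G x \<le> 1") (simp_all add: cone_dens_def ennreal_leI)
  qed
  also have "\<dots> = ?c * emeasure \<mu> {x\<in>UNIV. G x \<le> 1}" by (subst nn_integral_cmult) auto
  also have "\<dots> < \<infinity>"
    using emeasure_unit_sublevel_finite[of UNIV] by (simp add: ennreal_mult_less_top)
  finally show ?thesis .
qed

lemma cone_over_borel:
  assumes [measurable]: "E \<in> sets borel"
  shows "cone_over E \<in> sets borel"
proof -
  have "{x\<in>space borel. x \<in> span B \<and> 0 < G x \<and> x /\<^sub>R G x \<in> E} \<in> sets borel" by measurable
  then show ?thesis by (simp add: cone_over_def)
qed

lemma cone_over_scale: "c > 0 \<Longrightarrow> c *\<^sub>R x \<in> cone_over E \<longleftrightarrow> x \<in> cone_over E"
proof -
  assume c: "c > 0"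
  have 1: "(c *\<^sub>R x \<in> span B) = (x \<in> span B)"
    using span_scale[of x B c] span_scale[of "c *\<^sub>R x" B "inverse c"] c by auto
  have 2: "(c *\<^sub>R x) /\<^sub>R G (c *\<^sub>R x) = x /\<^sub>R G x"
    using c by (cases "G x = 0") (auto simp: G_scale field_simps)
  have 3: "(0 < G (c *\<^sub>R x)) = (0 < G x)" using c by (simp add: G_scale zero_less_mult_iff)
  show ?thesis by (simp only: cone_over_def mem_Collect_eq 1 2 3)
qed

lemma emeasure_bdry:
  assumes E: "E \<in> sets borel"
  shows "emeasure bdry_measure E = (\<integral>\<^sup>+x. cone_dens x * indicator (cone_over E) x \<partial>\<mu>)"
proof -
  have m: "(\<lambda>x. x /\<^sub>R G x) \<in> borel_measurable borel" by measurable
  have m': "(\<lambda>x. x /\<^sub>R G x) \<in> borel_measurable cone_measure" by measurable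
  have pre: "(\<lambda>x. x /\<^sub>R G x) -` E \<in> sets borel"
    using measurable_sets[OF m E] by simp
  have "emeasure bdry_measure E = emeasure cone_measure ((\<lambda>x. x /\<^sub>R G x) -` E)"
    unfolding bdry_measure_def using emeasure_distr[OF m'] E by simp
  also have "\<dots> = (\<integral>\<^sup>+x. cone_dens x * indicator ((\<lambda>x. x /\<^sub>R G x) -` E) x \<partial>\<mu>)"
    unfolding cone_measure_def using pre by (subst emeasure_density) auto
  also have "\<dots> = (\<integral>\<^sup>+x. cone_dens x * indicator (cone_over E) x \<partial>\<mu>)"
  proof (rule nn_integral_cong_AE)
    show "AE x in \<mu>. cone_dens x * indicator ((\<lambda>x. x /\<^sub>R G x) -` E) x = cone_dens x * indicator (cone_over E) x"
      using AE_frame_lborel_span[of B]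
    proof eventually_elim
      case (elim x)
      show ?case
      proof (cases "G x = 0")
        case True
        then show ?thesis by (simp add: cone_dens_def)
      next
        case False
        then have "0 < G x" using G_nonneg[of x] by simp
        then show ?thesis using elim by (simp add: indicator_def cone_over_def)
      qed
    qed
  qed
  finally show ?thesis .
qed

text \<open>
  From the layer-cake formula, since \<open>G = 1 - (1 - G)\<close>.
\<close>

lemma cone_G_integral:
  assumes W [measurable]: "W \<in> sets borel" and cone: "\<And>x c. c > 0 \<Longrightarrow> c *\<^sub>R x \<in> W \<longleftrightarrow> x \<in> W"
  shows "(\<integral>\<^sup>+x. ennreal ((real (card B) + 1) * G x) * indicator {x\<in>W. G x \<le> 1} x \<partial>\<mu>) =
     ennreal (real (card B)) * emeasure \<mu> {x\<in>W. G x \<le> 1}"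
proof -
  let ?j = "real (card B)" and ?m = "emeasure \<mu> {x\<in>W. G x \<le> 1}"
  have Vm [measurable]: "{x\<in>W. G x \<le> 1} \<in> sets borel"
  proof -
    have "{x\<in>space borel. x \<in> W \<and> G x \<le> 1} \<in> sets borel" by measurable
    then show ?thesis by simp
  qed
  have Y: "ennreal (?j + 1) * (\<integral>\<^sup>+x. indicator W x * ennreal (max 0 (1 - G x)) \<partial>\<mu>) = ?m"
    by (rule cone_layer_cake[OF W cone measurable_G G_nonneg]) (simp_all add: G_scale)
  have "ennreal (?j + 1) * ?m = (\<integral>\<^sup>+x. ennreal (?j + 1) * indicator {x\<in>W. G x \<le> 1} x \<partial>\<mu>)"
    by (simp add: nn_integral_cmult)
  also have "\<dots> = (\<integral>\<^sup>+x. ennreal ((?j + 1) * G x) * indicator {x\<in>W. G x \<le> 1} x +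
       ennreal (?j + 1) * (indicator W x * ennreal (max 0 (1 - G x))) \<partial>\<mu>)"
  proof (rule nn_integral_cong)
    fix x
    have "ennreal (?j + 1) = ennreal ((?j + 1) * G x) + ennreal (?j + 1) * ennreal (1 - G x)" if "G x \<le> 1"
    proof -
      have "?j + 1 = (?j + 1) * G x + (?j + 1) * (1 - G x)" by (simp add: algebra_simps)
      then have "ennreal (?j + 1) = ennreal ((?j + 1) * G x + (?j + 1) * (1 - G x))" by simp
      also have "\<dots> = ennreal ((?j + 1) * G x) + ennreal ((?j + 1) * (1 - G x))"
        using that G_nonneg[of x] by (intro ennreal_plus) auto
      finally show ?thesis using that by (simp add: ennreal_mult)
    qed
    then show "ennreal (?j + 1) * indicator {x\<in>W. G x \<le> 1} x =
      ennreal ((?j + 1) * G x) * indicator {x\<in>W. G x \<le> 1} x +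
       ennreal (?j + 1) * (indicator W x * ennreal (max 0 (1 - G x)))"
      by (auto simp: indicator_def max_def)
  qed
  also have "\<dots> = (\<integral>\<^sup>+x. ennreal ((?j + 1) * G x) * indicator {x\<in>W. G x \<le> 1} x \<partial>\<mu>) +
       (\<integral>\<^sup>+x. ennreal (?j + 1) * (indicator W x * ennreal (max 0 (1 - G x))) \<partial>\<mu>)"
    by (rule nn_integral_add) measurable
  also have "(\<integral>\<^sup>+x. ennreal (?j + 1) * (indicator W x * ennreal (max 0 (1 - G x))) \<partial>\<mu>) = ?m"
  proof -
    have mm: "(\<lambda>x. indicator W x * ennreal (max 0 (1 - G x))) \<in> borel_measurable \<mu>" by measurable
    show ?thesis unfolding nn_integral_cmult[OF mm] by (rule Y)
  qed
  finally have "(\<integral>\<^sup>+x. ennreal ((?j + 1) * G x) * indicator {x\<in>W. G x \<le> 1} x \<partial>\<mu>) + ?m = ennreal (?j + 1) * ?m"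
    by simp
  also have "\<dots> = ennreal ?j * ?m + ?m" by (simp add: ennreal_plus distrib_right del: ennreal_plus_if)
  finally show ?thesis
    using emeasure_unit_sublevel_finite[OF W] by (auto simp: ennreal_add_left_cancel add.commute[of _ ?m] less_top)
qed

text \<open>
  By convexity \<open>x - y\<close> makes an obtuse angle with the normal at \<open>y\<close> and an acute one with the
  normal at \<open>x\<close>. If both normals are close to \<open>u\<close>, then \<open>x - y\<close> is almost orthogonal to \<open>u\<close>.
\<close>

lemma normals_nearly_orthogonal:
  assumes x: "x \<in> span B" "G x = 1" "v \<in> dual_face x" "norm (v - u) \<le> \<eta>"
    and y: "y \<in> span B" "G y = 1" "w \<in> dual_face y" "norm (w - u) \<le> \<eta>"
  shows "\<bar>(x - y) \<bullet> u\<bar> \<le> \<eta> * norm (x - y)"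
proof -
  have *: "(y - x) \<bullet> u \<le> \<eta> * norm (x - y)"
    if x: "G x = 1" "v \<in> dual_face x" "norm (v - u) \<le> \<eta>" and y: "G y = 1" for x y v
  proof -
    have "v \<in> S" "x \<bullet> v = h v" using x by (auto simp: dual_face_def)
    then have "(y - x) \<bullet> v \<le> 0" using inner_le_G[of v y] y by (simp add: inner_diff_left)
    moreover have "(y - x) \<bullet> (u - v) \<le> norm (y - x) * norm (u - v)" by (rule norm_cauchy_schwarz)
    moreover have "norm (y - x) * norm (u - v) \<le> norm (x - y) * \<eta>"
      using x(3) by (simp add: norm_minus_commute mult_left_mono)
    ultimately show ?thesis by (simp add: inner_diff_right mult.commute)
  qed
  show ?thesis using *[OF x(2-4) y(2)] *[OF y(2-4) x(2)]
    by (simp add: abs_le_iff inner_diff_left norm_minus_commute)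
qed

text \<open>
  The factor \<open>l\<close> absorbs errors: \<open>x \<bullet> u\<close> and \<open>h u\<close> differ from \<open>h v\<close> by at most \<open>R \<eta>\<close>, and all
  three are at least of order \<open>r\<close>. With the constant \<open>4\<close> in \<open>l\<close>, also the hypothesis of
  \<open>central_projection_bilipschitz\<close> is met.
\<close>

lemma boundary_point_bounds:
  assumes u: "u \<in> S" and \<eta>: "0 \<le> \<eta>" "4 * R * \<eta> \<le> r" and l: "l = 1 + 4 * R * \<eta> / r"
    and x: "x \<in> span B" "G x = 1" "v \<in> dual_face x" "norm (v - u) \<le> \<eta>"
  shows "x \<bullet> u \<le> l * h v" "h v \<le> l * (x \<bullet> u)" "h v \<le> l * h u" "h u \<le> l * h v" "0 < x \<bullet> u"
    "norm x * \<eta> \<le> (l - 1) / 3 * (x \<bullet> u)"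
proof -
  have vS: "v \<in> S" and xv: "x \<bullet> v = h v" using x by (auto simp: dual_face_def)
  have nx: "norm x \<le> R" using G_ge_norm[OF x(1)] x(2) R_pos by (simp add: pos_divide_le_eq)
  define d where "d = R * \<eta>"
  have ld: "(l - 1) * r = 4 * d" using l r_pos by (simp add: d_def)
  have d: "0 \<le> d" "4 * d \<le> r" using \<eta> R_pos by (auto simp: d_def mult.assoc)
  have l1: "0 \<le> l - 1" using l \<eta> R_pos r_pos by simp
  have 1: "\<bar>x \<bullet> u - h v\<bar> \<le> d"
  proof -
    have "\<bar>x \<bullet> (u - v)\<bar> \<le> norm x * norm (u - v)" by (rule Cauchy_Schwarz_ineq2)
    also have "\<dots> \<le> R * \<eta>" using nx x(4) R_pos by (intro mult_mono) (auto simp: norm_minus_commute)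
    finally show ?thesis by (simp add: xv inner_diff_right d_def)
  qed
  have 2: "\<bar>h u - h v\<bar> \<le> d"
  proof -
    have "R * norm (u - v) \<le> R * \<eta>"
      using x(4) R_pos by (intro mult_left_mono) (auto simp: norm_minus_commute)
    then show ?thesis using h_lipschitz[of u v] by (simp add: d_def)
  qed
  have hv: "r \<le> h v" "r \<le> h u" by (rule h_bounds(1)[OF vS], rule h_bounds(1)[OF u])
  have xu: "r - d \<le> x \<bullet> u" using 1 hv by linarith
  have dl: "4 * d \<le> (l - 1) * h v" "4 * d \<le> (l - 1) * h u"
    using mult_left_mono[OF hv(1) l1] mult_left_mono[OF hv(2) l1] ld by auto
  have "(l - 1) * (r - d) \<le> (l - 1) * (x \<bullet> u)" using xu l1 by (rule mult_left_mono)
  moreover have "3 * d \<le> (l - 1) * (r - d)"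
  proof -
    have "(l - 1) * r \<le> 1 * r" using ld d by simp
    then have "l - 1 \<le> 1" using r_pos by (rule mult_right_le_imp_le)
    then have "(l - 1) * d \<le> d" using d(1) l1 by (intro mult_left_le_one_le)
    then show ?thesis using ld by (simp add: right_diff_distrib)
  qed
  ultimately have dx: "3 * d \<le> (l - 1) * (x \<bullet> u)" by simp
  show "0 < x \<bullet> u" using xu d r_pos by linarith
  show "x \<bullet> u \<le> l * h v" using 1 dl(1) d by (simp add: algebra_simps)
  show "h v \<le> l * (x \<bullet> u)" using 1 dx d by (simp add: algebra_simps)
  show "h v \<le> l * h u" using 2 dl(2) d by (simp add: algebra_simps)
  show "h u \<le> l * h v" using 2 dl(1) d by (simp add: algebra_simps)
  have "norm x * \<eta> \<le> d" using nx \<eta> by (simp add: d_def mult_right_mono)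
  then show "norm x * \<eta> \<le> (l - 1) / 3 * (x \<bullet> u)" using dx by simp
qed

text \<open>
  The heart of the comparison of the two notions of area. Let \<open>W\<close> be the cone over the nearly
  flat piece \<open>E\<close> and \<open>q\<close> the central projection to the hyperplane \<open>x \<bullet> u = k\<close>, where
  \<open>k = h u\<close>. Each step costs a power of \<open>l\<close>: the measure of \<open>E\<close> is about \<open>j / k\<close> times the
  volume \<open>m1\<close> of the part of \<open>W\<close> inside the body; this is comparable to the volume \<open>m2\<close> of the
  part below the hyperplane; \<open>m2\<close> is exactly \<open>k / j\<close> times the area \<open>m3\<close> of the base, which is
  also its Hausdorff measure; and \<open>q\<close> maps \<open>E\<close> to the base with bi-Lipschitz constant \<open>l ^ 3\<close>.
  Altogether the exponent is \<open>1 + 2 j + 3 (j - 1) \<le> 5 j\<close>.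
\<close>

lemma hausdorff_outer_flat_piece:
  assumes u: "u \<in> S" and \<eta>: "0 \<le> \<eta>" "4 * R * \<eta> \<le> r" and l: "l = 1 + 4 * R * \<eta> / r"
    and E: "E \<in> sets borel"
    and E_bd: "\<And>x. x \<in> E \<Longrightarrow> x \<in> span B" "\<And>x. x \<in> E \<Longrightarrow> G x = 1"
    and E_normal: "\<And>x. x \<in> E \<Longrightarrow> \<exists>v\<in>dual_face x. norm (v - u) \<le> \<eta>"
  shows "hausdorff_outer (card B - 1) E \<le> ennreal (l ^ (5 * card B)) * emeasure bdry_measure E"
    and "emeasure bdry_measure E \<le> ennreal (l ^ (5 * card B)) * hausdorff_outer (card B - 1) E"
proof -
  obtain B' where B': "orthonormal_set (insert u B')" "u \<notin> B'" "span (insert u B') = span B"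
    using orthonormal_basis_through[OF subspace_span_B, of u] u by auto
  have oB': "orthonormal_set B'" using B'(1) by (rule orthonormal_set_mono) auto
  have mu: "\<mu> = frame_lborel (insert u B')"
    using B' onb by (intro frame_lborel_cong_span) auto
  have card: "card B = Suc (card B')"
    using orthonormal_set_card[OF onb] orthonormal_set_card[OF B'(1)] B'(2,3) orthonormal_set_finite[OF oB'] by simp
  let ?j = "card B" and ?d = "card B'"
  define k where "k = h u"
  have k: "k > 0" using h_pos[OF u] by (simp add: k_def)
  have "0 \<le> 4 * R * \<eta> / r" "4 * R * \<eta> / r \<le> 1" using \<eta> R_pos r_pos by simp_all
  then have l1: "1 \<le> l" "l \<le> 2" using l by linarith+
  have uS: "u \<in> span B" "u \<bullet> u = 1" using u by (auto simp: norm_eq_1)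
  define W where "W = cone_over E"
  have W [measurable]: "W \<in> sets borel" unfolding W_def by (rule cone_over_borel[OF E])
  have Wc: "c *\<^sub>R x \<in> W \<longleftrightarrow> x \<in> W" if "c > 0" for c x unfolding W_def using that by (rule cone_over_scale)
  note bounds = boundary_point_bounds[OF u \<eta> l]
  have EW: "x \<in> W" if "x \<in> E" for x using that E_bd by (simp add: W_def cone_over_def)
  have Epos: "0 < x \<bullet> u" "x \<bullet> u \<le> l\<^sup>2 * k" "k \<le> l\<^sup>2 * (x \<bullet> u)" "norm x * \<eta> \<le> (l - 1) / 3 * (x \<bullet> u)" if "x \<in> E" for x
  proof -
    obtain v where v: "v \<in> dual_face x" "norm (v - u) \<le> \<eta>" using E_normal[OF \<open>x \<in> E\<close>] by blast
    note b = bounds[OF E_bd(1)[OF \<open>x \<in> E\<close>] E_bd(2)[OF \<open>x \<in> E\<close>] v]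
    show "0 < x \<bullet> u" "norm x * \<eta> \<le> (l - 1) / 3 * (x \<bullet> u)" using b by auto
    have "l * h v \<le> l * (l * k)" "l * h v \<le> l * (l * (x \<bullet> u))"
      using b(2,3) l1 by (auto intro!: mult_left_mono simp: k_def)
    then have xk: "x \<bullet> u \<le> l * (l * k)" "k \<le> l * (l * (x \<bullet> u))" using b(1,4) by (simp_all add: k_def)
    show "x \<bullet> u \<le> l\<^sup>2 * k" "k \<le> l\<^sup>2 * (x \<bullet> u)"
      using xk by (simp_all add: power2_eq_square mult.assoc)
  qed
  have Wpos: "0 < x \<bullet> u" "x \<bullet> u \<le> l\<^sup>2 * (k * G x)" "k * G x \<le> l\<^sup>2 * (x \<bullet> u)" if "x \<in> W" for x
  proof -
    define e where "e = x /\<^sub>R G x"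
    have e: "e \<in> E" "0 < G x" using that by (auto simp: W_def cone_over_def e_def)
    then have xe: "x \<bullet> u = G x * (e \<bullet> u)" by (simp add: e_def)
    show "0 < x \<bullet> u" using Epos(1)[OF e(1)] e(2) by (simp add: xe)
    show "x \<bullet> u \<le> l\<^sup>2 * (k * G x)"
      using mult_left_mono[OF Epos(2)[OF e(1)], of "G x"] e(2) by (simp add: xe mult_ac)
    show "k * G x \<le> l\<^sup>2 * (x \<bullet> u)"
      using mult_left_mono[OF Epos(3)[OF e(1)], of "G x"] e(2) by (simp add: xe mult_ac)
  qed
  define m1 where "m1 = emeasure \<mu> {x\<in>W. G x \<le> 1}"
  define m2 where "m2 = emeasure \<mu> {x\<in>W. x \<bullet> u \<le> k}"
  define m3 where "m3 = emeasure (frame_lborel B') {y. k *\<^sub>R u + y \<in> W}"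
  have bor: "{x\<in>W. G x \<le> c} \<in> sets borel" "{x\<in>W. x \<bullet> u \<le> c} \<in> sets borel" for c
  proof -
    have "{x\<in>space borel. x \<in> W \<and> G x \<le> c} \<in> sets borel" "{x\<in>space borel. x \<in> W \<and> x \<bullet> u \<le> c} \<in> sets borel" by measurable
    then show "{x\<in>W. G x \<le> c} \<in> sets borel" "{x\<in>W. x \<bullet> u \<le> c} \<in> sets borel" by simp_all
  qed
  have l2: "l\<^sup>2 > 0" using l1 by simp
  have sc: "ennreal ((l\<^sup>2) ^ ?j) = ennreal (l ^ (2 * ?j))" by (simp add: power_mult)
  \<comment> \<open>on the cone, \<open>x \<bullet> u\<close> and \<open>k * G x\<close> agree up to the factor \<open>l\<^sup>2\<close>, and dilations
    rescale volume\<close>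
  have m12: "m1 \<le> ennreal (l ^ (2 * ?j)) * m2"
  proof -
    have "m1 \<le> emeasure \<mu> {x\<in>W. x \<bullet> u \<le> l\<^sup>2 * k}"
      unfolding m1_def
    proof (rule emeasure_mono)
      show "{x\<in>W. G x \<le> 1} \<subseteq> {x\<in>W. x \<bullet> u \<le> l\<^sup>2 * k}"
      proof safe
        fix x assume x: "x \<in> W" "G x \<le> 1"
        have "l\<^sup>2 * (k * G x) \<le> l\<^sup>2 * (k * 1)" using x k l2 by (intro mult_left_mono) auto
        then show "x \<bullet> u \<le> l\<^sup>2 * k" using Wpos(2)[OF x(1)] by simp
      qed
    qed (use bor in simp)
    also have "\<dots> = ennreal ((l\<^sup>2) ^ ?j) * emeasure \<mu> {x. l\<^sup>2 *\<^sub>R x \<in> {x\<in>W. x \<bullet> u \<le> l\<^sup>2 * k}}"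
      by (rule emeasure_frame_scale[OF onb l2 bor(2)])
    also have "{x. l\<^sup>2 *\<^sub>R x \<in> {x\<in>W. x \<bullet> u \<le> l\<^sup>2 * k}} = {x\<in>W. x \<bullet> u \<le> k}"
      using Wc[OF l2] l2 by auto
    finally show ?thesis by (simp add: sc m2_def)
  qed
  have m21: "m2 \<le> ennreal (l ^ (2 * ?j)) * m1"
  proof -
    have "m2 \<le> emeasure \<mu> {x\<in>W. G x \<le> l\<^sup>2}"
      unfolding m2_def
    proof (rule emeasure_mono)
      show "{x\<in>W. x \<bullet> u \<le> k} \<subseteq> {x\<in>W. G x \<le> l\<^sup>2}"
      proof safe
        fix x assume x: "x \<in> W" "x \<bullet> u \<le> k"
        have "k * G x \<le> l\<^sup>2 * (x \<bullet> u)" by (rule Wpos(3)[OF x(1)])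
        also have "\<dots> \<le> l\<^sup>2 * k" using x(2) l2 by (intro mult_left_mono) auto
        finally show "G x \<le> l\<^sup>2" using k by (simp add: mult.commute)
      qed
    qed (use bor in simp)
    also have "\<dots> = ennreal ((l\<^sup>2) ^ ?j) * emeasure \<mu> {x. l\<^sup>2 *\<^sub>R x \<in> {x\<in>W. G x \<le> l\<^sup>2}}"
      by (rule emeasure_frame_scale[OF onb l2 bor(1)])
    also have "{x. l\<^sup>2 *\<^sub>R x \<in> {x\<in>W. G x \<le> l\<^sup>2}} = {x\<in>W. G x \<le> 1}"
      using Wc[OF l2] l2 by (auto simp: G_scale)
    finally show ?thesis by (simp add: sc m1_def)
  qed
  have m23: "ennreal (real ?j / k) * m2 = m3"
  proof -
    have "m2 = ennreal (k / real ?j) * m3"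
      unfolding m2_def m3_def mu card
      by (rule emeasure_cone_slab[OF B'(1,2) W Wc Wpos(1) k])
    then have "ennreal (real ?j / k) * m2 = ennreal ((real ?j / k) * (k / real ?j)) * m3"
      using k by (subst ennreal_mult) (auto simp: mult.assoc)
    then show ?thesis using k card by simp
  qed
  have jm: "(\<integral>\<^sup>+x. ennreal ((real ?j + 1) * G x) * indicator {x\<in>W. G x \<le> 1} x \<partial>\<mu>) = ennreal (real ?j) * m1"
    unfolding m1_def by (rule cone_G_integral[OF W Wc])
  have hg: "h (gauss x) \<le> l * k \<and> k \<le> l * h (gauss x)" if "x \<in> W" "regular_pt x" for x
  proof -
    have e: "x /\<^sub>R G x \<in> E" "0 < G x" using that by (auto simp: W_def cone_over_def)
    obtain v where v: "v \<in> dual_face (x /\<^sub>R G x)" "norm (v - u) \<le> \<eta>" using E_normal[OF e(1)] by blast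
    have "dual_face (x /\<^sub>R G x) = {gauss x}"
      using dual_face_scale[of "inverse (G x)" x] regular_dual_face[OF that(2)] e(2) by simp
    then have "v = gauss x" using v by simp
    then show ?thesis using bounds(3,4)[OF E_bd(1)[OF e(1)] E_bd(2)[OF e(1)] v] by (simp add: k_def)
  qed
  have \<sigma>: "emeasure bdry_measure E = (\<integral>\<^sup>+x. cone_dens x * indicator W x \<partial>\<mu>)"
    unfolding W_def by (rule emeasure_bdry[OF E])
  have Fm [measurable]: "(\<lambda>x. ennreal ((real ?j + 1) * G x) * indicator {x\<in>W. G x \<le> 1} x) \<in> borel_measurable borel"
    using bor(1) by measurable
  \<comment> \<open>on the cone the density is, up to the factor \<open>l\<close>, the one with \<open>k\<close> in place of
    \<open>h (gauss x)\<close>\<close>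
  have \<sigma>1: "emeasure bdry_measure E \<le> ennreal (l * (real ?j / k)) * m1"
  proof -
    have "emeasure bdry_measure E \<le>
        (\<integral>\<^sup>+x. ennreal (l / k) * (ennreal ((real ?j + 1) * G x) * indicator {x\<in>W. G x \<le> 1} x) \<partial>\<mu>)"
      unfolding \<sigma>
    proof (rule nn_integral_mono_AE)
      show "AE x in \<mu>. cone_dens x * indicator W x \<le>
         ennreal (l / k) * (ennreal ((real ?j + 1) * G x) * indicator {x\<in>W. G x \<le> 1} x)"
        using AE_regular
      proof eventually_elim
        case (elim x)
        show ?case
        proof (cases "x \<in> W \<and> G x \<le> 1")
          case True
          have "1 / h (gauss x) \<le> l / k"
            using hg[of x] True elim k h_pos[OF gauss_in_S[of x]] by (simp add: field_simps)
          then have "(real ?j + 1) * G x * (1 / h (gauss x)) \<le> (real ?j + 1) * G x * (l / k)"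
            using G_nonneg[of x] by (intro mult_left_mono) auto
          then have "ennreal ((real ?j + 1) * G x / h (gauss x)) \<le> ennreal ((l / k) * ((real ?j + 1) * G x))"
            by (intro ennreal_leI) (simp add: mult.commute)
          also have "\<dots> = ennreal (l / k) * ennreal ((real ?j + 1) * G x)"
            using l1 k G_nonneg[of x] by (intro ennreal_mult) auto
          finally show ?thesis using True by (simp add: cone_dens_def)
        qed (auto simp: cone_dens_def indicator_def)
      qed
    qed
    also have "\<dots> = ennreal (l / k) * (ennreal (real ?j) * m1)"
      unfolding jm[symmetric] by (rule nn_integral_cmult) simp
    also have "\<dots> = ennreal (l * (real ?j / k)) * m1"
      using l1 k by (simp add: mult.assoc[symmetric] ennreal_mult[symmetric])
    finally show ?thesis .
  qed
  have \<sigma>2: "ennreal (real ?j / k) * m1 \<le> ennreal l * emeasure bdry_measure E"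
  proof -
    have "ennreal (1 / k) * (ennreal (real ?j) * m1) =
        (\<integral>\<^sup>+x. ennreal (1 / k) * (ennreal ((real ?j + 1) * G x) * indicator {x\<in>W. G x \<le> 1} x) \<partial>\<mu>)"
      unfolding jm[symmetric] by (rule nn_integral_cmult[symmetric]) simp
    also have "\<dots> \<le> (\<integral>\<^sup>+x. ennreal l * (cone_dens x * indicator W x) \<partial>\<mu>)"
    proof (rule nn_integral_mono_AE)
      show "AE x in \<mu>. ennreal (1 / k) * (ennreal ((real ?j + 1) * G x) * indicator {x\<in>W. G x \<le> 1} x) \<le>
          ennreal l * (cone_dens x * indicator W x)"
        using AE_regular
      proof eventually_elim
        case (elim x)
        show ?case
        proof (cases "x \<in> W \<and> G x \<le> 1")
          case True
          have "1 / k \<le> l / h (gauss x)"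
            using hg[of x] True elim k h_pos[OF gauss_in_S[of x]] by (simp add: field_simps)
          then have "(real ?j + 1) * G x * (1 / k) \<le> (real ?j + 1) * G x * (l / h (gauss x))"
            using G_nonneg[of x] by (intro mult_left_mono) auto
          then have "ennreal ((1 / k) * ((real ?j + 1) * G x)) \<le> ennreal (l * ((real ?j + 1) * G x / h (gauss x)))"
            by (intro ennreal_leI) (simp add: mult.commute mult.left_commute)
          then have "ennreal (1 / k) * ennreal ((real ?j + 1) * G x) \<le> ennreal l * ennreal ((real ?j + 1) * G x / h (gauss x))"
            using l1 k G_nonneg[of x] h_pos[OF gauss_in_S[of x]] by (simp add: ennreal_mult[symmetric])
          then show ?thesis using True by (simp add: cone_dens_def)
        qed (auto simp: indicator_def)
      qed
    qed
    also have "\<dots> = ennreal l * emeasure bdry_measure E"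
      unfolding \<sigma> using W by (intro nn_integral_cmult) measurable
    finally show ?thesis using k by (simp add: mult.assoc[symmetric] ennreal_mult[symmetric])
  qed
  define F where "F = {y \<in> span B'. k *\<^sub>R u + y \<in> W}"
  have F_borel: "F \<in> sets borel"
  proof -
    have [measurable]: "span B' \<in> sets borel" by (rule borel_closed) (rule closed_span)
    have "{y\<in>space borel. y \<in> span B' \<and> k *\<^sub>R u + y \<in> W} \<in> sets borel" by measurable
    then show ?thesis by (simp add: F_def)
  qed
  define q where "q x = (k / (x \<bullet> u)) *\<^sub>R x - k *\<^sub>R u" for x
  have qF: "q ` E = F"
  proof (intro equalityI subsetI)
    fix y assume "y \<in> q ` E"
    then obtain x where x: "x \<in> E" "y = q x" by blast
    have "q x \<in> span (insert u B')"
      unfolding B'(3) q_def using E_bd(1)[OF x(1)] uS by (intro span_diff span_scale)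
    moreover have "q x \<bullet> u = 0" using Epos(1)[OF x(1)] uS by (simp add: q_def inner_diff_left)
    ultimately have "q x \<in> span B'" by (rule orthonormal_insert_orth(2)[OF B'(1,2)])
    moreover have "k *\<^sub>R u + q x \<in> W"
      using Wc[of "k / (x \<bullet> u)" x] EW[OF x(1)] Epos(1)[OF x(1)] k by (simp add: q_def)
    ultimately show "y \<in> F" using x by (simp add: F_def)
  next
    fix y assume y: "y \<in> F"
    define z where "z = k *\<^sub>R u + y"
    have z: "z \<in> W" "z \<bullet> u = k"
      using y orthonormal_insert_orth(1)[OF B'(1,2), of y] uS by (auto simp: F_def z_def inner_add_left)
    have zE: "z /\<^sub>R G z \<in> E" "0 < G z" using z(1) by (auto simp: W_def cone_over_def)
    have "q (z /\<^sub>R G z) = z - k *\<^sub>R u" using z(2) zE(2) k by (simp add: q_def)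
    then have "q (z /\<^sub>R G z) = y" by (simp add: z_def)
    then show "y \<in> q ` E" using zE(1) by (metis imageI)
  qed
  have lip: "dist (q x) (q y) \<le> l ^ 3 * dist x y" "dist x y \<le> l ^ 3 * dist (q x) (q y)" if "x \<in> E" "y \<in> E" for x y
  proof -
    obtain v where v: "v \<in> dual_face x" "norm (v - u) \<le> \<eta>" using E_normal[OF \<open>x \<in> E\<close>] by blast
    obtain w where w: "w \<in> dual_face y" "norm (w - u) \<le> \<eta>" using E_normal[OF \<open>y \<in> E\<close>] by blast
    have d: "\<bar>(x - y) \<bullet> u\<bar> \<le> \<eta> * norm (x - y)"
      using E_bd that v w by (intro normals_nearly_orthogonal[of x v u \<eta> y w]) auto
    have qq: "q x - q y = (k / (x \<bullet> u)) *\<^sub>R x - (k / (y \<bullet> u)) *\<^sub>R y" by (simp add: q_def)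
    note c = central_projection_bilipschitz[OF Epos(1)[OF that(1)] Epos(1)[OF that(2)] l1 Epos(2,3)[OF that(1)] k d Epos(4)[OF that(2)]]
    show "dist (q x) (q y) \<le> l ^ 3 * dist x y" "dist x y \<le> l ^ 3 * dist (q x) (q y)"
      unfolding dist_norm qq using c by auto
  qed
  have l3: "l ^ 3 > 0" using l1 by simp
  have F_bdd: "bounded F"
  proof (cases "E = {}")
    case False
    then obtain y where y: "y \<in> E" by blast
    have "dist (q y) z \<le> l ^ 3 * (R + R)" if "z \<in> F" for z
    proof -
      obtain x where x: "x \<in> E" "z = q x" using \<open>z \<in> F\<close> qF by blast
      have nR: "norm e \<le> R" if "e \<in> E" for e
        using G_ge_norm[OF E_bd(1)[OF that]] E_bd(2)[OF that] R_pos by (simp add: pos_divide_le_eq)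
      have "dist y x \<le> R + R" using nR[OF x(1)] nR[OF y] norm_triangle_ineq4[of y x] by (simp add: dist_norm)
      then have "l ^ 3 * dist y x \<le> l ^ 3 * (R + R)" using l3 by (intro mult_left_mono) auto
      then show ?thesis using lip(1)[OF y x(1)] x(2) by simp
    qed
    then show ?thesis unfolding bounded_def by blast
  qed (use qF in auto)
  have HF: "hausdorff_outer ?d F = m3"
  proof -
    have "hausdorff_outer ?d F = emeasure (frame_lborel B') F"
      by (rule hausdorff_outer_eq_frame[OF oB' F_borel _ F_bdd]) (auto simp: F_def)
    also have "\<dots> = m3"
      unfolding m3_def
    proof (rule emeasure_eq_AE)
      show "AE x in frame_lborel B'. x \<in> F \<longleftrightarrow> x \<in> {y. k *\<^sub>R u + y \<in> W}"
        using AE_frame_lborel_span[of B'] by eventually_elim (simp add: F_def)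
      have "{y\<in>space borel. k *\<^sub>R u + y \<in> W} \<in> sets borel" by measurable
      then show "{y. k *\<^sub>R u + y \<in> W} \<in> sets (frame_lborel B')" by simp
    qed (use F_borel in simp)
    finally show ?thesis .
  qed
  have H1: "m3 \<le> ennreal (l ^ (3 * ?d)) * hausdorff_outer ?d E"
    using hausdorff_outer_Lipschitz[OF l3 lip(1), of E ?d] by (simp add: qF HF power_mult)
  have H2: "hausdorff_outer ?d E \<le> ennreal (l ^ (3 * ?d)) * m3"
  proof -
    have inj: "inj_on q E"
    proof (rule inj_onI)
      fix x y assume "x \<in> E" "y \<in> E" "q x = q y"
      then show "x = y" using lip(2)[of x y] by simp
    qed
    have "inv_into E q ` F = E" using inj unfolding qF[symmetric] by (simp add: image_inv_into_cancel inv_into_image_cancel)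
    moreover have "hausdorff_outer ?d (inv_into E q ` F) \<le> ennreal ((l ^ 3) ^ ?d) * hausdorff_outer ?d F"
    proof (rule hausdorff_outer_Lipschitz[OF l3])
      fix a b assume "a \<in> F" "b \<in> F"
      then obtain x y where "x \<in> E" "y \<in> E" "a = q x" "b = q y" using qF by blast
      then show "dist (inv_into E q a) (inv_into E q b) \<le> l ^ 3 * dist a b"
        using lip(2)[of x y] inj by simp
    qed
    ultimately show ?thesis by (simp add: HF power_mult)
  qed
  have pw: "ennreal (l ^ a) * ennreal (l ^ b) = ennreal (l ^ (a + b))" for a b
    using l1 by (simp add: ennreal_mult[symmetric] power_add)
  have mono: "ennreal (l ^ a) * y \<le> ennreal (l ^ b) * y" if "a \<le> b" for a b and y :: ennreal
    using l1 that by (intro mult_right_mono ennreal_leI power_increasing) auto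
  have "hausdorff_outer ?d E \<le> ennreal (l ^ (3 * ?d)) * (ennreal (real ?j / k) * m2)"
    using H2 unfolding m23 .
  also have "\<dots> \<le> ennreal (l ^ (3 * ?d)) * (ennreal (real ?j / k) * (ennreal (l ^ (2 * ?j)) * m1))"
    by (intro mult_left_mono m21) auto
  also have "\<dots> = ennreal (l ^ (3 * ?d)) * (ennreal (l ^ (2 * ?j)) * (ennreal (real ?j / k) * m1))"
    by (simp only: mult_ac)
  also have "\<dots> \<le> ennreal (l ^ (3 * ?d)) * (ennreal (l ^ (2 * ?j)) * (ennreal (l ^ 1) * emeasure bdry_measure E))"
    using \<sigma>2 by (intro mult_left_mono) auto
  also have "\<dots> = ennreal (l ^ (3 * ?d + (2 * ?j + 1))) * emeasure bdry_measure E"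
    by (simp only: mult.assoc[symmetric] pw)
  also have "\<dots> \<le> ennreal (l ^ (5 * ?j)) * emeasure bdry_measure E" by (rule mono) (simp add: card)
  finally show "hausdorff_outer (?j - 1) E \<le> ennreal (l ^ (5 * ?j)) * emeasure bdry_measure E"
    by (simp add: card)
  have "emeasure bdry_measure E \<le> ennreal l * (ennreal (real ?j / k) * m1)"
  proof -
    have "ennreal (l * (real ?j / k)) = ennreal l * ennreal (real ?j / k)"
      using l1 k by (intro ennreal_mult) auto
    then show ?thesis using \<sigma>1 by (simp only: mult.assoc)
  qed
  also have "\<dots> \<le> ennreal l * (ennreal (real ?j / k) * (ennreal (l ^ (2 * ?j)) * m2))"
    by (intro mult_left_mono m12) auto
  also have "\<dots> = ennreal (l ^ 1) * (ennreal (l ^ (2 * ?j)) * (ennreal (real ?j / k) * m2))"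
    by (simp only: mult_ac power_one_right)
  also have "\<dots> \<le> ennreal (l ^ 1) * (ennreal (l ^ (2 * ?j)) * (ennreal (l ^ (3 * ?d)) * hausdorff_outer ?d E))"
    unfolding m23 by (intro mult_left_mono H1) auto
  also have "\<dots> = ennreal (l ^ (1 + (2 * ?j + 3 * ?d))) * hausdorff_outer ?d E"
    by (simp only: mult.assoc[symmetric] pw)
  also have "\<dots> \<le> ennreal (l ^ (5 * ?j)) * hausdorff_outer ?d E" by (rule mono) (simp add: card)
  finally show "emeasure bdry_measure E \<le> ennreal (l ^ (5 * ?j)) * hausdorff_outer (?j - 1) E"
    by (simp add: card)
qed

end

section \<open>The surface area measure as an image of Lebesgue measure\<close>

context framed_body
begin

lemma affine_hull_A: "affine hull A = span B"
proof -
  have "affine hull A = span A"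
    by (rule affine_hull_span_0) (simp add: hull_inc zero_in_A)
  also have "\<dots> = span B"
  proof (rule antisym)
    show "span A \<subseteq> span B" by (rule span_minimal[OF A_sub subspace_span_B])
    have "B \<subseteq> span A"
    proof
      fix b assume b: "b \<in> B"
      then have "norm b = 1" "b \<in> span B" using B_sub_S by auto
      then have "r *\<^sub>R b \<in> cball 0 r \<inter> span B" using r_pos by (simp add: span_scale)
      then have "r *\<^sub>R b \<in> A" using ball_sub by blast
      then have "(1 / r) *\<^sub>R (r *\<^sub>R b) \<in> span A" by (intro span_scale span_base)
      then show "b \<in> span A" using r_pos by simp
    qed
    then show "span B \<subseteq> span A" by (rule span_minimal) (rule subspace_span)
  qed
  finally show ?thesis .
qed

lemma rel_frontier_A: "rel_frontier A = {x \<in> span B. G x = 1}"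
proof -
  have int: "x \<in> rel_interior A \<longleftrightarrow> G x < 1" if x: "x \<in> span B" for x
  proof
    assume "x \<in> rel_interior A"
    then obtain e where e: "x \<in> A" "e > 0" "ball x e \<inter> span B \<subseteq> A"
      unfolding mem_rel_interior_ball affine_hull_A by blast
    define c where "c = (e / 2) / (norm x + 1)"
    have n1: "norm x + 1 > 0" using norm_ge_zero[of x] by linarith
    have c: "c > 0" using e(2) n1 by (simp add: c_def)
    have "c * norm x \<le> c * (norm x + 1)" using c by simp
    also have "\<dots> = e / 2" using n1 by (intro iffD1[OF nonzero_eq_divide_eq c_def]) simp
    finally have "(1 + c) *\<^sub>R x \<in> ball x e"
      using e(2) c by (simp add: dist_norm algebra_simps)
    then have "(1 + c) *\<^sub>R x \<in> A" using e(3) x by (auto simp: span_scale)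
    then have "(1 + c) * G x \<le> 1" using mem_A_iff[of "(1 + c) *\<^sub>R x"] x c by (simp add: span_scale G_scale)
    show "G x < 1"
    proof (rule ccontr)
      assume "\<not> G x < 1"
      then have "(1 + c) * 1 \<le> (1 + c) * G x" using c by (intro mult_left_mono) auto
      then have "(1 + c) * 1 \<le> 1" using \<open>(1 + c) * G x \<le> 1\<close> by (rule order_trans)
      with c show False by simp
    qed
  next
    assume G: "G x < 1"
    have "ball x (r * (1 - G x)) \<inter> span B \<subseteq> A"
    proof
      fix y assume y: "y \<in> ball x (r * (1 - G x)) \<inter> span B"
      have "norm (y - x) / r < 1 - G x" using y r_pos by (simp add: dist_norm norm_minus_commute pos_divide_less_eq mult.commute)
      then have "G y \<le> 1" using G_lipschitz[of y x] by simp
      then show "y \<in> A" using y mem_A_iff by simp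
    qed
    moreover have "x \<in> A" using G x mem_A_iff by simp
    ultimately show "x \<in> rel_interior A"
      unfolding mem_rel_interior_ball affine_hull_A using G r_pos by (auto intro!: exI[of _ "r * (1 - G x)"])
  qed
  have "rel_frontier A = A - rel_interior A"
    by (simp add: rel_frontier_def compact_imp_closed[OF compact_A] closure_closed)
  also have "\<dots> = {x \<in> span B. G x = 1}"
    using int mem_A_iff A_sub by (auto simp: not_less)
  finally show ?thesis .
qed

lemma dual_face_iff_normal:
  assumes "x \<in> span B" "G x = 1" "u \<in> S"
  shows "u \<in> dual_face x \<longleftrightarrow> (\<forall>y\<in>A. u \<bullet> y \<le> u \<bullet> x)"
proof
  assume "u \<in> dual_face x"
  then have "u \<bullet> x = h u" using assms by (simp add: dual_face_def inner_commute)
  then show "\<forall>y\<in>A. u \<bullet> y \<le> u \<bullet> x" using support_fun_attained(2)[OF compact_A A_ne] by simp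
next
  assume n: "\<forall>y\<in>A. u \<bullet> y \<le> u \<bullet> x"
  obtain y where y: "y \<in> A" "u \<bullet> y = h u" using support_fun_attained(1)[OF compact_A A_ne] by blast
  then have "h u \<le> u \<bullet> x" using n by force
  moreover have "x \<bullet> u \<le> h u" using inner_le_G[OF assms(3), of x] assms(2) by simp
  ultimately show "u \<in> dual_face x" using assms by (simp add: dual_face_def inner_commute)
qed

lemma rev_spherical_image_eq:
  assumes "\<omega> \<subseteq> S"
  shows "rev_spherical_image A \<omega> = {x \<in> span B. G x = 1 \<and> dual_face x \<inter> \<omega> \<noteq> {}}"
  unfolding rev_spherical_image_def rel_frontier_A
  using dual_face_iff_normal assms by blast

lemma borel_sphere_sets: "\<omega> \<in> sets (restrict_space borel S) \<longleftrightarrow> \<omega> \<in> sets borel \<and> \<omega> \<subseteq> S"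
proof -
  have "S \<in> sets borel" using compact_S by (rule borel_compact)
  then show ?thesis by (auto simp: sets_restrict_space_iff)
qed

definition "regular_piece \<omega> = {x \<in> span B. G x = 1 \<and> regular_pt x \<and> gauss x \<in> \<omega>}"

lemma regular_piece_borel:
  assumes [measurable]: "\<omega> \<in> sets borel"
  shows "regular_piece \<omega> \<in> sets borel"
proof -
  have "{x\<in>space borel. x \<in> span B \<and> G x = 1 \<and> regular_pt x \<and> gauss x \<in> \<omega>} \<in> sets borel" by measurable
  then show ?thesis by (simp add: regular_piece_def)
qed

text \<open>
  Almost every ray consists of regular points, along which the Gauss map is constant.
\<close>

lemma surf_eq_bdry:
  assumes \<omega>: "\<omega> \<in> sets borel" "\<omega> \<subseteq> S"
  shows "emeasure surf_measure \<omega> = emeasure bdry_measure (regular_piece \<omega>)"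
proof -
  have m: "gauss \<in> cone_measure \<rightarrow>\<^sub>M restrict_space borel S"
    using measurable_gauss_S by (simp cong: measurable_cong_sets)
  have pre: "gauss -` \<omega> \<in> sets borel" using measurable_sets[OF measurable_gauss \<omega>(1)] by simp
  have "emeasure surf_measure \<omega> = emeasure cone_measure (gauss -` \<omega>)"
    unfolding surf_measure_def using emeasure_distr[OF m, of \<omega>] \<omega> borel_sphere_sets[of \<omega>] by simp
  also have "\<dots> = (\<integral>\<^sup>+x. cone_dens x * indicator (gauss -` \<omega>) x \<partial>\<mu>)"
    unfolding cone_measure_def using pre by (subst emeasure_density) auto
  also have "\<dots> = (\<integral>\<^sup>+x. cone_dens x * indicator (cone_over (regular_piece \<omega>)) x \<partial>\<mu>)"
  proof (rule nn_integral_cong_AE)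
    show "AE x in \<mu>. cone_dens x * indicator (gauss -` \<omega>) x = cone_dens x * indicator (cone_over (regular_piece \<omega>)) x"
      using AE_frame_lborel_span[of B] AE_regular
    proof eventually_elim
      case (elim x)
      show ?case
      proof (cases "G x = 0")
        case True
        then show ?thesis by (simp add: cone_dens_def)
      next
        case False
        then have pos: "0 < inverse (G x)" using G_nonneg[of x] by simp
        have "x \<in> cone_over (regular_piece \<omega>) \<longleftrightarrow> gauss x \<in> \<omega>"
          using pos elim False regular_scale[OF pos, of x] gauss_scale[OF pos, of x]
          by (simp add: cone_over_def regular_piece_def span_scale G_scale)
        then show ?thesis by (simp add: indicator_def)
      qed
    qed
  qed
  also have "\<dots> = emeasure bdry_measure (regular_piece \<omega>)"
    by (rule emeasure_bdry[OF regular_piece_borel[OF \<omega>(1)], symmetric])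
  finally show ?thesis .
qed

lemma sphere_partition:
  assumes "\<eta> > 0"
  obtains N :: nat and c T where "\<And>i. i < N \<Longrightarrow> c i \<in> S" "\<And>i. T i \<in> sets borel"
    "\<And>i x. x \<in> T i \<Longrightarrow> norm (x - c i) \<le> \<eta>" "disjoint_family T" "S \<subseteq> (\<Union>i<N. T i)"
proof -
  obtain F where F: "finite F" "F \<subseteq> S" "S \<subseteq> (\<Union>x\<in>F. ball x \<eta>)"
  proof (rule compactE_image[OF compact_S, of S "\<lambda>x. ball x \<eta>"])
    show "S \<subseteq> (\<Union>x\<in>S. ball x \<eta>)" using assms by auto
  qed (use that in auto)
  obtain N :: nat and c where c: "F = c ` {i. i < N}"
    using finite_imp_nat_seg_image_inj_on[OF F(1)] by blast
  define T where "T = disjointed (\<lambda>i. ball (c i) \<eta>)"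
  show ?thesis
  proof (rule that[of N c T])
    show "c i \<in> S" if "i < N" for i using that c F(2) by blast
    show "T i \<in> sets borel" for i unfolding T_def disjointed_def by auto
    show "norm (x - c i) \<le> \<eta>" if "x \<in> T i" for i x
      using that disjointed_subset[of "\<lambda>i. ball (c i) \<eta>" i]
      by (auto simp: T_def dist_norm norm_minus_commute dest!: subsetD)
    show "disjoint_family T" unfolding T_def by (rule disjoint_family_disjointed)
    have "(\<Union>i\<in>{0..<N}. T i) = (\<Union>i\<in>{0..<N}. ball (c i) \<eta>)"
      unfolding T_def by (rule finite_UN_disjointed_eq)
    then show "S \<subseteq> (\<Union>i<N. T i)" using F(3) c by (auto simp: atLeast0LessThan lessThan_def)
  qed
qed

text \<open>
  The normal cone depends upper semicontinuously on the point. This makes the sets in the next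
  proof measurable.
\<close>

lemma closed_dual_face_meets:
  assumes "compact K"
  shows "closed {x. dual_face x \<inter> K \<noteq> {}}"
  unfolding closed_sequential_limits
proof (intro allI impI)
  fix x :: "nat \<Rightarrow> real^'n" and l assume x: "(\<forall>n. x n \<in> {x. dual_face x \<inter> K \<noteq> {}}) \<and> x \<longlonglongrightarrow> l"
  then have "\<forall>n. \<exists>v. v \<in> dual_face (x n) \<and> v \<in> K" by blast
  then obtain v where v: "\<And>n. v n \<in> dual_face (x n)" "\<And>n. v n \<in> K" by metis
  have "compact (S \<inter> K)" using compact_S assms by (rule compact_Int)
  then obtain w \<sigma> where w: "w \<in> S \<inter> K" "strict_mono \<sigma>" "(v \<circ> \<sigma>) \<longlonglongrightarrow> w"
    by (rule seq_compactE[OF compact_imp_seq_compact, of _ v]) (use v in \<open>auto simp: dual_face_def\<close>)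
  have xl: "(\<lambda>n. x (\<sigma> n)) \<longlonglongrightarrow> l" using LIMSEQ_subseq_LIMSEQ[OF conjunct2[OF x] w(2)] by (simp add: comp_def)
  have vw: "(\<lambda>n. v (\<sigma> n)) \<longlonglongrightarrow> w" using w(3) by (simp add: comp_def)
  have "(\<lambda>n. x (\<sigma> n) \<bullet> v (\<sigma> n)) \<longlonglongrightarrow> l \<bullet> w" by (intro tendsto_inner xl vw)
  moreover have "(\<lambda>n. G (x (\<sigma> n)) * h (v (\<sigma> n))) \<longlonglongrightarrow> G l * h w"
    by (intro tendsto_mult continuous_on_tendsto_compose[OF continuous_G[of UNIV] xl]
        continuous_on_tendsto_compose[OF continuous_h[of UNIV] vw]) auto
  moreover have "x (\<sigma> n) \<bullet> v (\<sigma> n) = G (x (\<sigma> n)) * h (v (\<sigma> n))" for n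
    using v(1)[of "\<sigma> n"] by (simp add: dual_face_def)
  ultimately have "l \<bullet> w = G l * h w" using LIMSEQ_unique by simp
  then show "l \<in> {x. dual_face x \<inter> K \<noteq> {}}" using w(1) by (auto simp: dual_face_def)
qed

definition "singular_bdry = {x \<in> span B. G x = 1 \<and> \<not> regular_pt x}"

text \<open>
  The cone over the singular boundary points is a null set. Cut into finitely many nearly flat
  pieces, the singular boundary then has Hausdorff measure zero as well, by the comparison for
  flat pieces; a coarse partition is enough.
\<close>

lemma hausdorff_singular_bdry: "hausdorff_outer (card B - 1) singular_bdry = 0"
proof -
  define \<eta> where "\<eta> = r / (4 * R)"
  have \<eta>: "\<eta> > 0" "4 * R * \<eta> \<le> r" using r_pos R_pos by (auto simp: \<eta>_def)
  obtain N :: nat and c T where cT: "\<And>i. i < N \<Longrightarrow> c i \<in> S" "\<And>i. T i \<in> sets borel"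
    "\<And>i x. x \<in> T i \<Longrightarrow> norm (x - c i) \<le> \<eta>" "disjoint_family T" "S \<subseteq> (\<Union>i<N. T i)"
    using sphere_partition[OF \<eta>(1)] by metis
  define Z where "Z i = {x \<in> singular_bdry. dual_face x \<inter> cball (c i) \<eta> \<noteq> {}}" for i
  have null: "hausdorff_outer (card B - 1) (Z i) = 0" if i: "i < N" for i
  proof -
    have cl [measurable]: "{x. dual_face x \<inter> cball (c i) \<eta> \<noteq> {}} \<in> sets borel"
      by (rule borel_closed[OF closed_dual_face_meets]) simp
    have "{x\<in>space borel. x \<in> span B \<and> G x = 1 \<and> \<not> regular_pt x \<and> x \<in> {x. dual_face x \<inter> cball (c i) \<eta> \<noteq> {}}} \<in> sets borel"
      by measurable
    then have Zb: "Z i \<in> sets borel" by (simp add: Z_def singular_bdry_def conj_assoc)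
    have "AE x in \<mu>. cone_dens x * indicator (cone_over (Z i)) x = 0"
      using AE_regular
    proof eventually_elim
      case (elim x)
      have "x \<notin> cone_over (Z i)"
      proof
        assume "x \<in> cone_over (Z i)"
        then have "0 < inverse (G x)" "\<not> regular_pt (x /\<^sub>R G x)" by (auto simp: cone_over_def Z_def singular_bdry_def)
        then show False using elim regular_scale[of "inverse (G x)" x] by simp
      qed
      then show ?case by simp
    qed
    then have "(\<integral>\<^sup>+x. cone_dens x * indicator (cone_over (Z i)) x \<partial>\<mu>) = (\<integral>\<^sup>+x. 0 \<partial>\<mu>)"
      by (rule nn_integral_cong_AE)
    then have "emeasure bdry_measure (Z i) = 0" by (simp add: emeasure_bdry[OF Zb])
    have n: "\<exists>v\<in>dual_face x. norm (v - c i) \<le> \<eta>" if "x \<in> Z i" for x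
      using that by (auto simp: Z_def dist_norm norm_minus_commute)
    have b: "x \<in> span B" "G x = 1" if "x \<in> Z i" for x
      using that by (simp_all add: Z_def singular_bdry_def)
    show ?thesis
      using hausdorff_outer_flat_piece(1)[OF cT(1)[OF i] less_imp_le[OF \<eta>(1)] \<eta>(2) refl Zb b n]
      unfolding \<open>emeasure bdry_measure (Z i) = 0\<close> by simp
  qed
  have "singular_bdry \<subseteq> (\<Union>i\<in>{..<N}. Z i)"
  proof
    fix x assume x: "x \<in> singular_bdry"
    obtain v where v: "v \<in> dual_face x" using dual_face_ne by blast
    then have "v \<in> S" by (simp add: dual_face_def)
    then obtain i where i: "i < N" "v \<in> T i" using cT(5) by blast
    then have "v \<in> cball (c i) \<eta>" using cT(3) by (simp add: dist_norm norm_minus_commute)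
    then have "x \<in> Z i" using x v by (auto simp: Z_def)
    then show "x \<in> (\<Union>i\<in>{..<N}. Z i)" using i(1) by blast
  qed
  then have "hausdorff_outer (card B - 1) singular_bdry \<le> (\<Sum>i<N. hausdorff_outer (card B - 1) (Z i))"
    by (rule order_trans[OF hausdorff_outer_mono hausdorff_outer_UN]) simp
  also have "\<dots> = 0" using null by simp
  finally show ?thesis by simp
qed

text \<open>
  Fix a factor \<open>l\<close> and cut the regular part of the boundary according to a fine partition of
  the sphere of normals. Subadditivity gives the upper bound. For the lower bound, the pieces
  are approximated from inside by compact sets with respect to \<open>bdry_measure\<close>; Hausdorff
  measure is additive on disjoint compact sets. In the end \<open>l\<close> tends to \<open>1\<close>.
\<close>

theorem hausdorff_rev_spherical_image:
  assumes \<omega>: "\<omega> \<in> sets borel" "\<omega> \<subseteq> S"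
  shows "hausdorff_outer (card B - 1) (rev_spherical_image A \<omega>) = emeasure surf_measure \<omega>"
proof -
  let ?H = "hausdorff_outer (card B - 1)" and ?E = "rev_spherical_image A \<omega>" and ?p = "5 * card B"
  have main: "?H ?E \<le> ennreal (l ^ ?p) * emeasure surf_measure \<omega> \<and> emeasure surf_measure \<omega> \<le> ennreal (l ^ ?p) * ?H ?E"
    if l: "1 < l" "l \<le> 2" for l :: real
  proof -
    define \<eta> where "\<eta> = (l - 1) * r / (4 * R)"
    have eq: "4 * R * \<eta> = (l - 1) * r" using R_pos by (simp add: \<eta>_def)
    have \<eta>: "\<eta> > 0" using l r_pos R_pos by (simp add: \<eta>_def)
    have \<eta>2: "4 * R * \<eta> \<le> r" unfolding eq using l r_pos by (intro mult_left_le_one_le) auto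
    have leq: "l = 1 + 4 * R * \<eta> / r" unfolding eq using r_pos by simp
    obtain N :: nat and c T where cT: "\<And>i. i < N \<Longrightarrow> c i \<in> S" "\<And>i. T i \<in> sets borel"
      "\<And>i x. x \<in> T i \<Longrightarrow> norm (x - c i) \<le> \<eta>" "disjoint_family T" "S \<subseteq> (\<Union>i<N. T i)"
      using sphere_partition[OF \<eta>] by metis
    define P where "P i = regular_piece (\<omega> \<inter> T i)" for i
    have Pb: "P i \<in> sets borel" for i unfolding P_def using \<omega>(1) cT(2) by (intro regular_piece_borel) auto
    have Pp: "x \<in> span B" "G x = 1" "gauss x \<in> dual_face x" "gauss x \<in> T i" "gauss x \<in> \<omega>" if "x \<in> P i" for x i
      using that regular_dual_face[of x] by (auto simp: P_def regular_piece_def)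
    have piece: "?H X \<le> ennreal (l ^ ?p) * emeasure bdry_measure X" "emeasure bdry_measure X \<le> ennreal (l ^ ?p) * ?H X"
      if i: "i < N" and X: "X \<in> sets borel" "X \<subseteq> P i" for X i
    proof -
      have n: "\<exists>v\<in>dual_face x. norm (v - c i) \<le> \<eta>" if "x \<in> X" for x
      proof -
        have "x \<in> P i" using that X(2) by blast
        then show ?thesis using Pp(3,4)[of x i] cT(3) by blast
      qed
      show "?H X \<le> ennreal (l ^ ?p) * emeasure bdry_measure X" "emeasure bdry_measure X \<le> ennreal (l ^ ?p) * ?H X"
        using hausdorff_outer_flat_piece[OF cT(1)[OF i] less_imp_le[OF \<eta>] \<eta>2 leq X(1) _ _ n] Pp(1,2) X(2) by blast+
    qed
    have surf: "(\<Sum>i<N. emeasure bdry_measure (P i)) = emeasure surf_measure \<omega>"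
    proof -
      have "(\<Sum>i<N. emeasure bdry_measure (P i)) = (\<Sum>i<N. emeasure surf_measure (\<omega> \<inter> T i))"
        unfolding P_def using \<omega> cT(2) by (intro sum.cong refl surf_eq_bdry[symmetric]) auto
      also have "\<dots> = emeasure surf_measure (\<Union>i<N. \<omega> \<inter> T i)"
      proof (rule sum_emeasure)
        show "(\<lambda>i. \<omega> \<inter> T i) ` {..<N} \<subseteq> sets surf_measure"
          using \<omega> cT(2) by (auto simp: sets_surf_measure borel_sphere_sets)
        show "disjoint_family_on (\<lambda>i. \<omega> \<inter> T i) {..<N}"
          using cT(4) unfolding disjoint_family_on_def by blast
      qed simp
      also have "(\<Union>i<N. \<omega> \<inter> T i) = \<omega>" using cT(5) \<omega>(2) by blast
      finally show ?thesis .
    qed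
    have "?E \<subseteq> (\<Union>i\<in>{..<N}. P i) \<union> singular_bdry"
    proof
      fix x assume "x \<in> ?E"
      then have x: "x \<in> span B" "G x = 1" "dual_face x \<inter> \<omega> \<noteq> {}"
        unfolding rev_spherical_image_eq[OF \<omega>(2)] by auto
      show "x \<in> (\<Union>i\<in>{..<N}. P i) \<union> singular_bdry"
      proof (cases "regular_pt x")
        case True
        then have "gauss x \<in> \<omega>" using x(3) regular_dual_face by auto
        moreover obtain i where "i < N" "gauss x \<in> T i" using cT(5) gauss_in_S[of x] by blast
        ultimately have "x \<in> P i" using x True by (simp add: P_def regular_piece_def)
        then show ?thesis using \<open>i < N\<close> by blast
      qed (use x in \<open>simp add: singular_bdry_def\<close>)
    qed
    then have "?H ?E \<le> ?H ((\<Union>i\<in>{..<N}. P i) \<union> singular_bdry)" by (rule hausdorff_outer_mono)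
    also have "\<dots> \<le> ?H (\<Union>i\<in>{..<N}. P i) + ?H singular_bdry" by (rule hausdorff_outer_Un)
    also have "\<dots> = ?H (\<Union>i\<in>{..<N}. P i)" unfolding hausdorff_singular_bdry by simp
    also have "\<dots> \<le> (\<Sum>i<N. ?H (P i))" by (rule hausdorff_outer_UN) simp
    also have "\<dots> \<le> (\<Sum>i<N. ennreal (l ^ ?p) * emeasure bdry_measure (P i))"
      using Pb by (intro sum_mono piece(1)) auto
    also have "\<dots> = ennreal (l ^ ?p) * emeasure surf_measure \<omega>"
      by (simp add: sum_distrib_left[symmetric] surf)
    finally have upper: "?H ?E \<le> ennreal (l ^ ?p) * emeasure surf_measure \<omega>" .
    have low: "emeasure surf_measure \<omega> \<le> ennreal (l ^ ?p) * ?H ?E + ennreal e" if e: "e > 0" for e :: real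
    proof -
      define e' where "e' = e / (real N + 1)"
      have e': "e' > 0" using e by (simp add: e'_def add_nonneg_pos)
      have fin: "emeasure bdry_measure (space bdry_measure) \<noteq> \<infinity>"
      proof -
        have "emeasure bdry_measure (space bdry_measure) = emeasure cone_measure UNIV"
          unfolding bdry_measure_def by (subst emeasure_distr) (auto, measurable)
        then show ?thesis using finite_cone_measure by simp
      qed
      have "\<exists>K. K \<subseteq> P i \<and> compact K \<and> emeasure bdry_measure (P i) \<le> emeasure bdry_measure K + ennreal e'" for i
      proof -
        have reg: "emeasure bdry_measure (P i) = (SUP K \<in> {K. K \<subseteq> P i \<and> compact K}. emeasure bdry_measure K)"
          by (rule inner_regular[OF sets_bdry_measure fin Pb])
        have lt: "emeasure bdry_measure (P i) \<noteq> \<infinity>"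
          using emeasure_space[of bdry_measure "P i"] fin by (auto simp: top_unique)
        have ne: "{K. K \<subseteq> P i \<and> compact K} \<noteq> {}" using compact_empty by blast
        from SUP_approx_ennreal[OF e' ne reg lt] show ?thesis by (auto intro: less_imp_le)
      qed
      then obtain K where K: "\<And>i. K i \<subseteq> P i" "\<And>i. compact (K i)"
        "\<And>i. emeasure bdry_measure (P i) \<le> emeasure bdry_measure (K i) + ennreal e'" by metis
      have "emeasure surf_measure \<omega> \<le> (\<Sum>i<N. emeasure bdry_measure (K i) + ennreal e')"
        unfolding surf[symmetric] by (intro sum_mono K(3))
      also have "\<dots> = (\<Sum>i<N. emeasure bdry_measure (K i)) + ennreal (real N * e')"
        using e' by (simp add: sum.distrib ennreal_mult ennreal_of_nat_eq_real_of_nat)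
      also have "\<dots> \<le> (\<Sum>i<N. ennreal (l ^ ?p) * ?H (K i)) + ennreal e"
      proof (intro add_mono sum_mono piece(2) ennreal_leI)
        show "real N * e' \<le> e" using e by (simp add: e'_def field_simps)
        show "K i \<in> sets borel" "K i \<subseteq> P i" for i using K by (auto simp: borel_compact)
      qed auto
      also have "(\<Sum>i<N. ennreal (l ^ ?p) * ?H (K i)) = ennreal (l ^ ?p) * (\<Sum>i<N. ?H (K i))"
        by (simp add: sum_distrib_left)
      also have "\<dots> \<le> ennreal (l ^ ?p) * ?H (\<Union>i\<in>{..<N}. K i)"
      proof (intro mult_left_mono hausdorff_outer_UN_compact)
        show "disjoint_family_on K {..<N}"
          unfolding disjoint_family_on_def
        proof (intro ballI impI)
          fix m n :: nat assume "m \<noteq> n"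
          then have "T m \<inter> T n = {}" using cT(4) by (auto simp: disjoint_family_on_def)
          then show "K m \<inter> K n = {}" using K(1)[of m] K(1)[of n] Pp(4) by blast
        qed
      qed (use K in auto)
      also have "\<dots> \<le> ennreal (l ^ ?p) * ?H ?E"
      proof (intro mult_left_mono hausdorff_outer_mono UN_least)
        fix i show "K i \<subseteq> ?E"
        proof
          fix x assume "x \<in> K i"
          then have "x \<in> P i" using K(1) by blast
          then show "x \<in> ?E" unfolding rev_spherical_image_eq[OF \<omega>(2)] using Pp[of x i] by blast
        qed
      qed simp
      finally show ?thesis by (simp add: add_right_mono)
    qed
    have "emeasure surf_measure \<omega> \<le> ennreal (l ^ ?p) * ?H ?E"
      by (rule ennreal_le_epsilon) (rule low)
    then show ?thesis using upper by simp
  qed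
  show ?thesis
  proof (rule antisym)
    show "?H ?E \<le> emeasure surf_measure \<omega>"
      by (rule ennreal_le_limit_factor[of _ ?p]) (rule conjunct1[OF main])
    show "emeasure surf_measure \<omega> \<le> ?H ?E"
      by (rule ennreal_le_limit_factor[of _ ?p]) (rule conjunct2[OF main])
  qed
qed

text \<open>
  In particular, the set function in the definition is countably additive, so that
  \<open>measure_of\<close> does not fall back to its default.
\<close>

theorem surface_area_measure_eq: "surface_area_measure (span B) A = surf_measure"
proof (rule measure_eqI)
  have dim: "dim (span B) = card B" by (rule orthonormal_set_card[OF onb])
  let ?\<Sigma> = "sets (restrict_space borel S)"
  let ?f = "\<lambda>\<omega>. hausdorff_outer (dim (span B) - 1) (rev_spherical_image A \<omega>)"
  have sp: "space (restrict_space borel S) = S" by (simp add: space_restrict_space)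
  have sub: "?\<Sigma> \<subseteq> Pow S" using sets.space_closed[of "restrict_space borel S"] sp by simp
  have alg: "sigma_algebra S ?\<Sigma>" using sets.sigma_algebra_axioms[of "restrict_space borel S"] sp by simp
  have sets: "sets (surface_area_measure (span B) A) = ?\<Sigma>"
    unfolding surface_area_measure_def using sub alg
    by (simp add: sets_measure_of sigma_algebra.sigma_sets_eq)
  then show "sets (surface_area_measure (span B) A) = sets surf_measure" by (simp add: sets_surf_measure)
  have f: "?f \<omega> = emeasure surf_measure \<omega>" if "\<omega> \<in> ?\<Sigma>" for \<omega>
    unfolding dim using that by (intro hausdorff_rev_spherical_image) (auto simp: borel_sphere_sets)
  have pos: "positive ?\<Sigma> ?f"
    unfolding positive_def using f[of "{}"] by simp
  have ca: "countably_additive ?\<Sigma> ?f"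
    unfolding countably_additive_def
  proof (intro allI impI)
    fix X :: "nat \<Rightarrow> (real^'n) set"
    assume X: "range X \<subseteq> ?\<Sigma>" "disjoint_family X" "\<Union> (range X) \<in> ?\<Sigma>"
    have "(\<Sum>i. ?f (X i)) = (\<Sum>i. emeasure surf_measure (X i))"
      using X(1) by (intro suminf_cong f) auto
    also have "\<dots> = emeasure surf_measure (\<Union> (range X))"
      using X by (intro suminf_emeasure) (auto simp: sets_surf_measure)
    finally show "(\<Sum>i. ?f (X i)) = ?f (\<Union> (range X))" using f[OF X(3)] by simp
  qed
  fix \<omega> assume "\<omega> \<in> sets (surface_area_measure (span B) A)"
  then have \<omega>: "\<omega> \<in> ?\<Sigma>" using sets by simp
  have "emeasure (surface_area_measure (span B) A) \<omega> = ?f \<omega>"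
    unfolding surface_area_measure_def by (rule emeasure_measure_of_sigma[OF alg pos ca \<omega>])
  then show "emeasure (surface_area_measure (span B) A) \<omega> = emeasure surf_measure \<omega>" using f[OF \<omega>] by simp
qed

end

section \<open>First variation of volume\<close>

context framed_body
begin

lemma emeasure_G_le: "c > 0 \<Longrightarrow> emeasure \<mu> {x. G x \<le> c} = ennreal (c ^ card B) * emeasure \<mu> {x. G x \<le> 1}"
proof -
  assume c: "c > 0"
  have "{x. G x \<le> c} \<in> sets borel" using measurable_G by (simp add: borel_measurable_iff_le)
  moreover have "{x. c *\<^sub>R x \<in> {x. G x \<le> c}} = {x. G x \<le> 1}" using c by (auto simp: G_scale)
  ultimately show ?thesis using emeasure_frame_scale[OF onb c, of "{x. G x \<le> c}"] by simp
qed

lemma emeasure_A: "emeasure \<mu> A = emeasure \<mu> {x. G x \<le> 1}"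
proof (rule emeasure_eq_AE)
  show "AE x in \<mu>. x \<in> A \<longleftrightarrow> x \<in> {x. G x \<le> 1}"
    using AE_frame_lborel_span[of B] by eventually_elim (simp add: mem_A_iff)
qed (use compact_A G_le_1_borel in \<open>auto simp: borel_compact\<close>)

lemma emeasure_A_finite: "emeasure \<mu> A < \<infinity>"
  by (rule emeasure_frame_bounded[OF onb compact_imp_bounded[OF compact_A]])

text \<open>
  The set \<open>G = 1\<close> is contained in the difference of \<open>{x. G x \<le> 1}\<close> and its dilate by \<open>c < 1\<close>,
  and the measures of the two are close for \<open>c\<close> close to \<open>1\<close>.
\<close>

lemma AE_G_neq_1: "AE x in \<mu>. G x \<noteq> 1"
proof -
  let ?M = "measure \<mu> {x. G x \<le> 1}"
  have bor: "{x. G x \<le> c} \<in> sets borel" for c using measurable_G by (simp add: borel_measurable_iff_le)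
  have bor1: "{x. G x = 1} \<in> sets borel"
    using measurable_sets[OF measurable_G, of "{1}"] by (simp add: vimage_def)
  have fin: "emeasure \<mu> {x. G x \<le> c} \<noteq> \<infinity>" if "c > 0" for c
    using emeasure_A_finite emeasure_A emeasure_G_le[OF that] by (simp add: ennreal_mult_eq_top_iff)
  have meas: "measure \<mu> {x. G x \<le> c} = c ^ card B * ?M" if "c > 0" for c
    unfolding measure_def emeasure_G_le[OF that] using that by (simp add: enn2real_mult)
  have "measure \<mu> {x. G x = 1} \<le> ?M - c ^ card B * ?M" if c: "0 < c" "c < 1" for c
  proof -
    have "{x. G x \<le> 1} \<in> fmeasurable \<mu>"
      by (intro fmeasurableI) (use bor fin[of 1] in \<open>auto simp: less_top\<close>)
    then have "{x. G x \<le> 1} - {x. G x \<le> c} \<in> fmeasurable \<mu>"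
      by (rule fmeasurableI2) (use bor in auto)
    then have "measure \<mu> {x. G x = 1} \<le> measure \<mu> ({x. G x \<le> 1} - {x. G x \<le> c})"
      by (rule measure_mono_fmeasurable[rotated 2]) (use bor1 c in auto)
    also have "\<dots> = measure \<mu> {x. G x \<le> 1} - measure \<mu> {x. G x \<le> c}"
      using c bor fin by (intro measure_Diff) auto
    finally show ?thesis using meas[OF c(1)] by simp
  qed
  then have "eventually (\<lambda>c. measure \<mu> {x. G x = 1} \<le> ?M - c ^ card B * ?M) (at_left (1::real))"
    unfolding eventually_at_left_field by (intro exI[of _ 0]) auto
  moreover have "((\<lambda>c. ?M - c ^ card B * ?M) \<longlongrightarrow> ?M - 1 ^ card B * ?M) (at_left 1)"
    by (intro tendsto_intros)
  ultimately have "measure \<mu> {x. G x = 1} \<le> ?M - 1 ^ card B * ?M"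
    by (intro tendsto_lowerbound[where F = "at_left (1::real)"]) auto
  then have "measure \<mu> {x. G x = 1} = 0" by (simp add: measure_le_0_iff)
  moreover have "emeasure \<mu> {x. G x = 1} \<noteq> \<infinity>"
  proof -
    have "emeasure \<mu> {x. G x = 1} \<le> emeasure \<mu> {x. G x \<le> 1}" using bor by (intro emeasure_mono) auto
    then show ?thesis using fin[of 1] by (auto simp: top_unique)
  qed
  ultimately have "emeasure \<mu> {x. G x = 1} = 0" by (simp add: emeasure_eq_ennreal_measure)
  then show ?thesis using bor1 by (intro AE_I[of _ _ "{x. G x = 1}"]) auto
qed

text \<open>
  The integral formula turns volume, where the body appears as the domain of integration, into
  an integral of a Lipschitz function of the gauge over a fixed domain.
\<close>

lemma integrable_hat: "integrable \<mu> (\<lambda>x. max 0 (1 - G x))"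
  and measure_A_eq: "measure \<mu> A = (real (card B) + 1) * (\<integral>x. max 0 (1 - G x) \<partial>\<mu>)"
proof -
  let ?N = "\<integral>\<^sup>+x. ennreal (max 0 (1 - G x)) \<partial>\<mu>"
  have eq: "ennreal (real (card B) + 1) * ?N = emeasure \<mu> A"
    using cone_layer_cake[of UNIV G] by (simp add: G_nonneg G_scale emeasure_A del: ennreal_plus)
  then have "?N < \<infinity>"
    using emeasure_A_finite by (auto simp: ennreal_mult_less_top less_top[symmetric] top_unique)
  then show "integrable \<mu> (\<lambda>x. max 0 (1 - G x))" by (intro integrableI_nonneg) auto
  have "(\<integral>x. max 0 (1 - G x) \<partial>\<mu>) = enn2real ?N" by (intro integral_eq_nn_integral) auto
  then show "measure \<mu> A = (real (card B) + 1) * (\<integral>x. max 0 (1 - G x) \<partial>\<mu>)"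
    unfolding measure_def eq[symmetric] by (simp add: enn2real_mult del: ennreal_plus)
qed

lemma surf_integral:
  fixes f :: "real^'n \<Rightarrow> real"
  assumes "continuous_on S f"
  shows "(\<integral>u. f u \<partial>surf_measure) = (real (card B) + 1) * (\<integral>x. indicator {x. G x \<le> 1} x * (G x / h (gauss x)) * f (gauss x) \<partial>\<mu>)"
proof -
  have fm: "f \<in> borel_measurable (restrict_space borel S)"
    using assms by (rule borel_measurable_continuous_on_restrict)
  have gm: "gauss \<in> cone_measure \<rightarrow>\<^sub>M restrict_space borel S"
    using measurable_gauss_S by (simp cong: measurable_cong_sets)
  have fgm: "(\<lambda>x. f (gauss x)) \<in> borel_measurable borel"
    using measurable_compose[OF measurable_gauss_S fm] .
  define d where "d x = (real (card B) + 1) * (indicator {x. G x \<le> 1} x * (G x / h (gauss x)))" for x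
  have dm: "d \<in> borel_measurable borel" unfolding d_def[abs_def] by measurable
  have d: "cone_dens x = ennreal (d x)" for x by (simp add: cone_dens_def d_def indicator_def)
  have d0: "0 \<le> d x" for x using G_nonneg[of x] h_pos[OF gauss_in_S[of x]] by (simp add: d_def)
  have "(\<integral>u. f u \<partial>surf_measure) = (\<integral>x. f (gauss x) \<partial>cone_measure)"
    unfolding surf_measure_def by (rule integral_distr[OF gm fm])
  also have "\<dots> = (\<integral>x. d x *\<^sub>R f (gauss x) \<partial>\<mu>)"
    unfolding cone_measure_def d[abs_def] using dm fgm d0 by (intro integral_density) auto
  also have "\<dots> = (\<integral>x. (real (card B) + 1) * (indicator {x. G x \<le> 1} x * (G x / h (gauss x)) * f (gauss x)) \<partial>\<mu>)"
    by (intro Bochner_Integration.integral_cong refl) (simp add: d_def)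
  also have "\<dots> = (real (card B) + 1) * (\<integral>x. indicator {x. G x \<le> 1} x * (G x / h (gauss x)) * f (gauss x) \<partial>\<mu>)"
    by (rule integral_mult_right_zero)
  finally show ?thesis .
qed

end

text \<open>
  Bodies \<open>A' k\<close> that contain \<open>A\<close> and converge to it, whose support functions have derivative
  \<open>g\<close> with respect to the parameter \<open>\<epsilon> k\<close>. The relative growth bound yields domination; the
  convergence of quotients along convergent arguments is the form required by \<open>danskin\<close>.
\<close>

locale body_variation = framed_body B A r R for B A :: "(real^'n) set" and r R :: real +
  fixes A' :: "nat \<Rightarrow> (real^'n) set" and R' c :: real and \<epsilon> :: "nat \<Rightarrow> real" and g :: "real^'n \<Rightarrow> real"
  assumes body': "\<And>k. framed_body B (A' k) r R'"
    and eps: "\<And>k. 0 < \<epsilon> k" "\<And>k. \<epsilon> k \<le> 1" "\<epsilon> \<longlonglongrightarrow> 0" and c_nonneg: "0 \<le> c"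
    and g_cont: "continuous_on (sphere 0 1 \<inter> span B) g"
    and mono: "\<And>k u. u \<in> sphere 0 1 \<inter> span B \<Longrightarrow> support_fun A u \<le> support_fun (A' k) u"
    and growth: "\<And>k u. u \<in> sphere 0 1 \<inter> span B \<Longrightarrow> support_fun (A' k) u \<le> (1 + c * \<epsilon> k) * support_fun A u"
    and quot: "\<And>\<sigma> v u. strict_mono (\<sigma> :: nat \<Rightarrow> nat) \<Longrightarrow> (\<And>k. v k \<in> sphere 0 1 \<inter> span B) \<Longrightarrow>
        u \<in> sphere 0 1 \<inter> span B \<Longrightarrow> v \<longlonglongrightarrow> u \<Longrightarrow>
        (\<lambda>k. (support_fun (A' (\<sigma> k)) (v k) - support_fun A (v k)) / \<epsilon> (\<sigma> k)) \<longlonglongrightarrow> g u"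
begin

abbreviation "h' k \<equiv> support_fun (A' k)"
abbreviation "G' k \<equiv> gauge_on (span B) (A' k)"

lemma G'_le_G: "G' k x \<le> G x"
proof -
  interpret b: framed_body B "A' k" r R' by (rule body')
  show ?thesis unfolding b.G_le_iff
  proof
    fix u assume u: "u \<in> S"
    have "x \<bullet> u \<le> G x * h u" by (rule inner_le_G[OF u])
    also have "\<dots> \<le> G x * h' k u" using mono[OF u] G_nonneg by (intro mult_left_mono) auto
    finally show "x \<bullet> u \<le> G x * h' k u" .
  qed
qed

lemma G_le_G': "G x \<le> (1 + c * \<epsilon> k) * G' k x"
proof -
  interpret b: framed_body B "A' k" r R' by (rule body')
  show ?thesis unfolding G_le_iff
  proof
    fix u assume u: "u \<in> S"
    have "x \<bullet> u \<le> G' k x * h' k u" by (rule b.inner_le_G[OF u])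
    also have "\<dots> \<le> G' k x * ((1 + c * \<epsilon> k) * h u)" using growth[OF u] b.G_nonneg by (intro mult_left_mono) auto
    finally show "x \<bullet> u \<le> (1 + c * \<epsilon> k) * G' k x * h u" by (simp add: mult_ac)
  qed
qed

text \<open>
  At a regular point \<open>gauss x\<close> is the only maximiser of \<open>(x \<bullet> u) / h u\<close>, so the envelope
  theorem gives the derivative of this quotient with respect to \<open>h\<close> at this maximiser.
\<close>

lemma G'_quotient_limit:
  assumes "regular_pt x"
  shows "(\<lambda>k. (G' k x - G x) / \<epsilon> k) \<longlonglongrightarrow> - (G x * g (gauss x) / h (gauss x))"
proof -
  have gd: "gauss x \<in> dual_face x" using regular_dual_face[OF assms] by simp
  then have gx: "gauss x \<in> S" "x \<bullet> gauss x = G x * h (gauss x)" "x \<bullet> gauss x / h (gauss x) = G x"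
  proof -
    show "gauss x \<in> S" "x \<bullet> gauss x = G x * h (gauss x)" using gd unfolding dual_face_def by auto
    show "x \<bullet> gauss x / h (gauss x) = G x" using gd by (simp add: dual_face_iff)
  qed
  have hp: "h (gauss x) > 0" by (rule h_pos[OF gx(1)])
  have cval: "- (x \<bullet> gauss x) * g (gauss x) / (h (gauss x) * h (gauss x)) = - (G x * g (gauss x) / h (gauss x))"
    unfolding gx(2) using hp by (simp add: field_simps)
  show ?thesis
    unfolding gauge_on_def
  proof (rule danskin[where c = "\<lambda>u. - (x \<bullet> u) * g u / (h u * h u)" and ?u0.0 = "gauss x"])
    show "compact S" "S \<noteq> {}" by (rule compact_S S_ne)+
    show "continuous_on S (\<lambda>u. x \<bullet> u / h u)" by (rule continuous_ratio)
    show "continuous_on S (\<lambda>u. x \<bullet> u / h' k u)" for k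
      by (rule framed_body.continuous_ratio[OF body'])
    show "gauss x \<in> S" by (rule gx(1))
    show "x \<bullet> gauss x / h (gauss x) = (SUP v\<in>S. x \<bullet> v / h v)" using gx(3) by (simp add: gauge_on_def)
    show "- (x \<bullet> gauss x) * g (gauss x) / (h (gauss x) * h (gauss x)) = - ((SUP u\<in>S. x \<bullet> u / h u) * g (gauss x) / h (gauss x))"
      using cval by (simp add: gauge_on_def)
    show "- (x \<bullet> u) * g u / (h u * h u) \<le> - ((SUP u\<in>S. x \<bullet> u / h u) * g (gauss x) / h (gauss x))"
      if "u \<in> S" "x \<bullet> u / h u = (SUP v\<in>S. x \<bullet> v / h v)" for u
    proof -
      have "u \<in> dual_face x" using that by (simp add: dual_face_iff gauge_on_def)
      then have "u = gauss x" using regular_dual_face[OF assms] by simp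
      then show ?thesis using cval by (simp add: gauge_on_def)
    qed
    fix \<sigma> :: "nat \<Rightarrow> nat" and v u
    assume \<sigma>: "strict_mono \<sigma>" and v: "\<And>k. v k \<in> S" and u: "u \<in> S" and vu: "v \<longlonglongrightarrow> u"
    let ?q = "\<lambda>k. (h' (\<sigma> k) (v k) - h (v k)) / \<epsilon> (\<sigma> k)"
    have q: "?q \<longlonglongrightarrow> g u" by (rule quot[OF \<sigma> v u vu])
    have hv: "(\<lambda>k. h (v k)) \<longlonglongrightarrow> h u"
      using continuous_on_tendsto_compose[OF continuous_h[of UNIV] vu] by simp
    have e\<sigma>: "(\<lambda>k. \<epsilon> (\<sigma> k)) \<longlonglongrightarrow> 0" using LIMSEQ_subseq_LIMSEQ[OF eps(3) \<sigma>] by (simp add: comp_def)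
    have "(\<lambda>k. h (v k) + \<epsilon> (\<sigma> k) * ?q k) \<longlonglongrightarrow> h u + 0 * g u"
      by (intro tendsto_add tendsto_mult hv e\<sigma> q)
    then have h'v: "(\<lambda>k. h' (\<sigma> k) (v k)) \<longlonglongrightarrow> h u"
      using eps(1) by (simp add: less_imp_neq[symmetric])
    have hu: "h u \<noteq> 0" using h_pos[OF u] by simp
    have "(\<lambda>k. - (x \<bullet> v k) * ?q k / (h' (\<sigma> k) (v k) * h (v k))) \<longlonglongrightarrow> - (x \<bullet> u) * g u / (h u * h u)"
      by (intro tendsto_intros q hv h'v vu) (use hu in auto)
    moreover have "- (x \<bullet> v k) * ?q k / (h' (\<sigma> k) (v k) * h (v k)) =
        (x \<bullet> v k / h' (\<sigma> k) (v k) - x \<bullet> v k / h (v k)) / \<epsilon> (\<sigma> k)" for k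
    proof -
      have "h (v k) > 0" "h' (\<sigma> k) (v k) > 0" "\<epsilon> (\<sigma> k) > 0"
        using h_pos[OF v] framed_body.h_pos[OF body' v] eps(1) by auto
      then show ?thesis by (simp add: field_simps)
    qed
    ultimately show "(\<lambda>k. (x \<bullet> v k / h' (\<sigma> k) (v k) - x \<bullet> v k / h (v k)) / \<epsilon> (\<sigma> k)) \<longlonglongrightarrow> - (x \<bullet> u) * g u / (h u * h u)"
      by simp
  qed (use eps in auto)
qed

lemma G'_limit: "(\<lambda>k. G' k x) \<longlonglongrightarrow> G x"
proof (rule tendsto_sandwich)
  have "(\<lambda>k. G x / (1 + c * \<epsilon> k)) \<longlonglongrightarrow> G x / (1 + c * 0)"
    by (intro tendsto_intros eps) simp
  then show "(\<lambda>k. G x / (1 + c * \<epsilon> k)) \<longlonglongrightarrow> G x" by simp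
  have "G x / (1 + c * \<epsilon> k) \<le> G' k x" for k
  proof -
    have "0 < 1 + c * \<epsilon> k" using c_nonneg eps(1)[of k] by (simp add: add_pos_nonneg)
    then show ?thesis using G_le_G'[of x k] by (simp add: pos_divide_le_eq mult.commute)
  qed
  then show "\<forall>\<^sub>F k in sequentially. G x / (1 + c * \<epsilon> k) \<le> G' k x" by simp
  show "\<forall>\<^sub>F k in sequentially. G' k x \<le> G x" using G'_le_G by simp
qed simp

text \<open>
  The truncated function \<open>max 0 (1 - G)\<close> changes only at points with \<open>G x \<le> 1 + c\<close>, and there
  by at most \<open>c * \<epsilon> k\<close>.
\<close>

lemma hat_quotient_bound:
  "\<bar>(max 0 (1 - G' k x) - max 0 (1 - G x)) / \<epsilon> k\<bar> \<le> c * indicator {x. G x \<le> 1 + c} x"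
proof (cases "G' k x \<le> 1")
  case True
  interpret b: framed_body B "A' k" r R' by (rule body')
  have ce: "0 \<le> c * \<epsilon> k" "c * \<epsilon> k \<le> c" using c_nonneg eps(1,2)[of k] by (auto intro: mult_left_le)
  have "(1 + c * \<epsilon> k) * G' k x \<le> G' k x + c * \<epsilon> k"
    using mult_left_mono[OF True ce(1)] by (simp add: algebra_simps)
  then have 1: "G x \<le> G' k x + c * \<epsilon> k" using G_le_G'[of x k] by simp
  then have 2: "G x \<le> 1 + c" using True ce by simp
  have "\<bar>max 0 (1 - G' k x) - max 0 (1 - G x)\<bar> \<le> c * \<epsilon> k"
    using 1 G'_le_G[of k x] by (simp add: max_def abs_if)
  then show ?thesis using 2 eps(1)[of k] by (simp add: abs_divide pos_divide_le_eq)
next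
  case False
  then have "1 < G x" using G'_le_G[of k x] by simp
  then show ?thesis using False c_nonneg by simp
qed

text \<open>
  Differentiation under the integral sign in the formula \<open>(j + 1) \<integral> max 0 (1 - G)\<close>. The limit
  is an integral with the weight of \<open>cone_dens\<close>, hence an integral over the surface area
  measure.
\<close>

theorem volume_variation:
  "(\<lambda>k. (measure \<mu> (A' k) - measure \<mu> A) / \<epsilon> k) \<longlonglongrightarrow> (\<integral>u. g u \<partial>surface_area_measure (span B) A)"
proof -
  let ?j = "real (card B)"
  let ?q = "\<lambda>k x. (max 0 (1 - G' k x) - max 0 (1 - G x)) / \<epsilon> k"
  let ?lim = "\<lambda>x. indicator {x. G x \<le> 1} x * (G x / h (gauss x)) * g (gauss x)"
  have gm: "(\<lambda>x. g (gauss x)) \<in> borel_measurable borel"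
    using measurable_compose[OF measurable_gauss_S borel_measurable_continuous_on_restrict[OF g_cont]] .
  have [measurable]: "G' k \<in> borel_measurable borel" for k by (rule framed_body.measurable_G[OF body'])
  have "(\<lambda>k. \<integral>x. ?q k x \<partial>\<mu>) \<longlonglongrightarrow> (\<integral>x. ?lim x \<partial>\<mu>)"
  proof (rule integral_dominated_convergence[where w = "\<lambda>x. c * indicator {x. G x \<le> 1 + c} x"])
    show "?lim \<in> borel_measurable \<mu>" using gm by measurable
    show "?q k \<in> borel_measurable \<mu>" for k by measurable
    have "emeasure \<mu> {x. G x \<le> 1 + c} < \<infinity>"
      using emeasure_G_le[of "1 + c"] c_nonneg emeasure_A emeasure_A_finite
      by (simp add: ennreal_mult_less_top add_pos_nonneg)
    moreover have "{x. G x \<le> 1 + c} \<in> sets borel" using measurable_G by (simp add: borel_measurable_iff_le)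
    ultimately show "integrable \<mu> (\<lambda>x. c * indicator {x. G x \<le> 1 + c} x)"
      by (intro integrable_mult_right integrable_real_indicator) auto
    show "AE x in \<mu>. norm (?q k x) \<le> c * indicator {x. G x \<le> 1 + c} x" for k
      using hat_quotient_bound by (intro AE_I2) simp
    show "AE x in \<mu>. (\<lambda>k. ?q k x) \<longlonglongrightarrow> ?lim x"
      using AE_G_neq_1 AE_regular
    proof eventually_elim
      case (elim x)
      show ?case
      proof (cases "G x < 1")
        case True
        have "?q k x = - ((G' k x - G x) / \<epsilon> k)" for k
          using True G'_le_G[of k x] by (simp add: minus_divide_left)
        moreover have "(\<lambda>k. - ((G' k x - G x) / \<epsilon> k)) \<longlonglongrightarrow> - (- (G x * g (gauss x) / h (gauss x)))"
          by (intro tendsto_minus G'_quotient_limit elim)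
        ultimately show ?thesis using True by simp
      next
        case False
        then have G: "1 < G x" using elim by simp
        then have "\<forall>\<^sub>F k in sequentially. 1 < G' k x" using order_tendstoD(1)[OF G'_limit] by blast
        then have "\<forall>\<^sub>F k in sequentially. ?q k x = 0" by eventually_elim (use G in simp)
        then show ?thesis using G by (simp add: tendsto_eventually)
      qed
    qed
  qed
  then have lim: "(\<lambda>k. (?j + 1) * (\<integral>x. ?q k x \<partial>\<mu>)) \<longlonglongrightarrow> (?j + 1) * (\<integral>x. ?lim x \<partial>\<mu>)"
    by (intro tendsto_intros)
  have eq: "(?j + 1) * (\<integral>x. ?q k x \<partial>\<mu>) = (measure \<mu> (A' k) - measure \<mu> A) / \<epsilon> k" for k
  proof -
    interpret b: framed_body B "A' k" r R' by (rule body')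
    have 1: "(\<integral>x. ?q k x \<partial>\<mu>) = (\<integral>x. max 0 (1 - G' k x) - max 0 (1 - G x) \<partial>\<mu>) / \<epsilon> k"
      by (rule integral_divide_zero)
    have 2: "(\<integral>x. max 0 (1 - G' k x) - max 0 (1 - G x) \<partial>\<mu>) =
        (\<integral>x. max 0 (1 - G' k x) \<partial>\<mu>) - (\<integral>x. max 0 (1 - G x) \<partial>\<mu>)"
      by (rule Bochner_Integration.integral_diff[OF b.integrable_hat integrable_hat])
    show ?thesis
      by (simp only: 1 2 measure_A_eq b.measure_A_eq right_diff_distrib[symmetric] times_divide_eq_right)
  qed
  from lim[unfolded eq] show ?thesis
    unfolding surface_area_measure_eq surf_integral[OF g_cont] .
qed

lemma measure_variation_bounds:
  "measure \<mu> A \<le> measure \<mu> (A' k)" "measure \<mu> (A' k) \<le> (1 + c * \<epsilon> k) ^ card B * measure \<mu> A"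
proof -
  interpret b: framed_body B "A' k" r R' by (rule body')
  have p: "0 < 1 + c * \<epsilon> k" using c_nonneg eps(1)[of k] by (simp add: add_pos_nonneg)
  have meas: "measure \<mu> A = measure \<mu> {x. G x \<le> 1}" "measure \<mu> (A' k) = measure \<mu> {x. G' k x \<le> 1}"
    unfolding measure_def emeasure_A b.emeasure_A by simp_all
  have f: "{x. G' k x \<le> 1} \<in> fmeasurable \<mu>"
    using b.emeasure_A_finite b.emeasure_A b.G_le_1_borel by (intro fmeasurableI) auto
  have f2: "{x. G x \<le> 1 + c * \<epsilon> k} \<in> fmeasurable \<mu>"
  proof (intro fmeasurableI)
    show "{x. G x \<le> 1 + c * \<epsilon> k} \<in> sets \<mu>" using measurable_G by (simp add: borel_measurable_iff_le)
    show "emeasure \<mu> {x. G x \<le> 1 + c * \<epsilon> k} < \<infinity>"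
      using emeasure_G_le[OF p] emeasure_A emeasure_A_finite by (simp add: ennreal_mult_less_top)
  qed
  show "measure \<mu> A \<le> measure \<mu> (A' k)"
    unfolding meas using G'_le_G by (intro measure_mono_fmeasurable f) (auto intro: order_trans)
  have "measure \<mu> (A' k) \<le> measure \<mu> {x. G x \<le> 1 + c * \<epsilon> k}"
    unfolding meas
  proof (intro measure_mono_fmeasurable f2 subsetI)
    fix x assume "x \<in> {x. G' k x \<le> 1}"
    then have "(1 + c * \<epsilon> k) * G' k x \<le> (1 + c * \<epsilon> k) * 1" using p by (intro mult_left_mono) auto
    then show "x \<in> {x. G x \<le> 1 + c * \<epsilon> k}" using G_le_G'[of x k] by simp
  qed (use f in auto)
  also have "\<dots> = (1 + c * \<epsilon> k) ^ card B * measure \<mu> A"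
    unfolding meas measure_def emeasure_G_le[OF p] using p by (simp add: enn2real_mult emeasure_A)
  finally show "measure \<mu> (A' k) \<le> (1 + c * \<epsilon> k) ^ card B * measure \<mu> A" .
qed

end

section \<open>The Orlicz combination and its projections\<close>

lemma convex_body_balls:
  fixes K :: "(real^'n) set"
  assumes "K \<in> convex_bodies_o"
  obtains r R where "0 < r" "cball 0 r \<subseteq> K" "K \<subseteq> cball 0 R"
proof -
  have K: "compact K" "0 \<in> interior K" using assms by (auto simp: convex_bodies_o_def)
  obtain e where e: "e > 0" "cball 0 e \<subseteq> K" using K(2) unfolding mem_interior_cball by blast
  obtain R where "K \<subseteq> cball 0 R"
    using compact_imp_bounded[OF K(1)] bounded_pos[of K] by (auto simp: subset_iff)
  then show ?thesis using that e by blast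
qed

lemma support_fun_bounds:
  fixes K :: "(real^'n) set"
  assumes K: "compact K" "0 < r" "cball 0 r \<subseteq> K" "K \<subseteq> cball 0 R"
  shows "r * norm x \<le> support_fun K x" "support_fun K x \<le> R * norm x"
proof -
  have ne: "K \<noteq> {}" using K(2,3) by (metis cball_eq_empty less_asym subset_empty)
  show "r * norm x \<le> support_fun K x"
  proof (cases "x = 0")
    case True
    have "0 \<in> K" using K(2,3) by auto
    then show ?thesis using support_fun_attained(2)[OF K(1) ne, of 0 x] True by simp
  next
    case False
    have "(r / norm x) *\<^sub>R x \<in> K" using K(2,3) False by (auto simp: subset_iff)
    from support_fun_attained(2)[OF K(1) ne this, of x]
    show ?thesis using False by (simp add: dot_square_norm power2_eq_square)
  qed
  obtain y where y: "y \<in> K" "x \<bullet> y = support_fun K x" using support_fun_attained(1)[OF K(1) ne] by blast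
  have "x \<bullet> y \<le> norm x * norm y" by (rule norm_cauchy_schwarz)
  also have "\<dots> \<le> norm x * R" using y(1) K(4) by (intro mult_left_mono) auto
  finally show "support_fun K x \<le> R * norm x" using y by (simp add: mult.commute)
qed

lemma support_fun_add:
  fixes K :: "(real^'n) set"
  assumes K: "compact K" "K \<noteq> {}"
  shows "support_fun K (x + y) \<le> support_fun K x + support_fun K y"
proof -
  obtain z where z: "z \<in> K" "(x + y) \<bullet> z = support_fun K (x + y)" using support_fun_attained(1)[OF K] by blast
  then show ?thesis using support_fun_attained(2)[OF K z(1), of x] support_fun_attained(2)[OF K z(1), of y]
    by (simp add: inner_add_left)
qed

lemma support_fun_scale:
  fixes K :: "(real^'n) set"
  assumes K: "compact K" "K \<noteq> {}" and c: "c > 0"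
  shows "support_fun K (c *\<^sub>R x) = c * support_fun K x"
proof (rule antisym)
  obtain z where z: "z \<in> K" "(c *\<^sub>R x) \<bullet> z = support_fun K (c *\<^sub>R x)" using support_fun_attained(1)[OF K] by blast
  show "support_fun K (c *\<^sub>R x) \<le> c * support_fun K x"
    using support_fun_attained(2)[OF K z(1), of x] c z(2)[symmetric] by simp
  obtain w where w: "w \<in> K" "x \<bullet> w = support_fun K x" using support_fun_attained(1)[OF K] by blast
  show "c * support_fun K x \<le> support_fun K (c *\<^sub>R x)"
    using support_fun_attained(2)[OF K w(1), of "c *\<^sub>R x"] w(2) by simp
qed

lemma convex_body_mem_iff:
  fixes M :: "(real^'n) set"
  assumes "M \<in> convex_bodies_o"
  shows "y \<in> M \<longleftrightarrow> (\<forall>x. x \<bullet> y \<le> support_fun M x)"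
proof
  have M: "compact M" "convex M" "M \<noteq> {}" using assms interior_subset by (auto simp: convex_bodies_o_def)
  show "y \<in> M \<Longrightarrow> \<forall>x. x \<bullet> y \<le> support_fun M x" using support_fun_attained(2)[OF M(1,3)] by blast
  assume *: "\<forall>x. x \<bullet> y \<le> support_fun M x"
  show "y \<in> M"
  proof (rule ccontr)
    assume "y \<notin> M"
    then obtain a b where ab: "a \<bullet> y < b" "\<forall>z\<in>M. a \<bullet> z > b"
      using separating_hyperplane_closed_point[OF M(2) compact_imp_closed[OF M(1)]] by blast
    obtain z where z: "z \<in> M" "(-a) \<bullet> z = support_fun M (-a)" using support_fun_attained(1)[OF M(1,3)] by blast
    have "(-a) \<bullet> y \<le> support_fun M (-a)" using * by blast
    then have "a \<bullet> z \<le> a \<bullet> y" using z(2) by simp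
    then show False using ab z(1) by force
  qed
qed

lemma support_fun_injective:
  fixes M N :: "(real^'n) set"
  assumes "M \<in> convex_bodies_o" "N \<in> convex_bodies_o" "\<And>x. support_fun M x = support_fun N x"
  shows "M = N"
  using convex_body_mem_iff[OF assms(1)] convex_body_mem_iff[OF assms(2)] assms(3) by auto

text \<open>
  A vector \<open>y\<close> with \<open>x \<bullet> y = f x\<close> and \<open>z \<bullet> y \<le> f z\<close> for all \<open>z\<close> is obtained by separating the
  point \<open>x / f x\<close> from the convex set \<open>{z. f z < 1}\<close> and normalising the separating
  functional.
\<close>

lemma sublinear_is_support_fun:
  fixes f :: "real^'n \<Rightarrow> real"
  assumes hom: "\<And>c x. c > 0 \<Longrightarrow> f (c *\<^sub>R x) = c * f x" and sub: "\<And>x y. f (x + y) \<le> f x + f y"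
    and r: "0 < r" "\<And>x. r * norm x \<le> f x" and R: "\<And>x. f x \<le> R * norm x"
  shows "\<exists>M\<in>convex_bodies_o. \<forall>x. support_fun M x = f x"
proof -
  define M where "M = {y. \<forall>x. x \<bullet> y \<le> f x}"
  have f0: "f 0 = 0" using r(2)[of 0] R[of 0] by simp
  have fpos: "x \<noteq> 0 \<Longrightarrow> f x > 0" for x
    using r(2)[of x] mult_pos_pos[OF r(1), of "norm x"] by simp
  have hom0: "c \<ge> 0 \<Longrightarrow> f (c *\<^sub>R x) = c * f x" for c x
    using hom[of c x] f0 by (cases "c = 0") auto
  have "closed M"
  proof -
    have "M = (\<Inter>x. {y. x \<bullet> y \<le> f x})" by (auto simp: M_def)
    then show ?thesis by (simp add: closed_INT closed_halfspace_le)
  qed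
  moreover have "M \<subseteq> cball 0 R"
  proof
    fix y assume "y \<in> M"
    then have "y \<bullet> y \<le> R * norm y" using R[of y] by (auto simp: M_def intro: order_trans)
    then show "y \<in> cball 0 R"
      by (cases "y = 0") (use r(2)[of "axis undefined 1"] R[of "axis undefined 1"] r(1) in
        \<open>auto simp: dot_square_norm power2_eq_square\<close>)
  qed
  ultimately have cM: "compact M" using bounded_subset[OF bounded_cball] by (auto simp: compact_eq_bounded_closed)
  have "convex M" unfolding M_def
  proof (rule convexI)
    fix x y :: "real^'n" and u v :: real
    assume *: "x \<in> {y. \<forall>x. x \<bullet> y \<le> f x}" "y \<in> {y. \<forall>x. x \<bullet> y \<le> f x}" "0 \<le> u" "0 \<le> v" "u + v = 1"
    show "u *\<^sub>R x + v *\<^sub>R y \<in> {y. \<forall>x. x \<bullet> y \<le> f x}"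
    proof (intro CollectI allI)
      fix z
      have "z \<bullet> (u *\<^sub>R x + v *\<^sub>R y) \<le> u * f z + v * f z"
        using * by (simp add: inner_add_right add_mono mult_left_mono)
      also have "\<dots> = f z" using *(5) by (simp flip: distrib_right)
      finally show "z \<bullet> (u *\<^sub>R x + v *\<^sub>R y) \<le> f z" .
    qed
  qed
  moreover have cb: "cball 0 r \<subseteq> M"
  proof
    fix y :: "real^'n" assume y: "y \<in> cball 0 r"
    have "x \<bullet> y \<le> f x" for x
    proof -
      have "x \<bullet> y \<le> norm x * norm y" by (rule norm_cauchy_schwarz)
      also have "\<dots> \<le> norm x * r" using y by (intro mult_left_mono) auto
      finally show ?thesis using r(2)[of x] by (simp add: mult.commute)
    qed
    then show "y \<in> M" by (simp add: M_def)
  qed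
  ultimately have "M \<in> convex_bodies_o"
    using cM r(1) unfolding convex_bodies_o_def mem_Collect_eq mem_interior_cball by blast
  moreover have "support_fun M x = f x" for x
  proof (rule antisym)
    have ne: "M \<noteq> {}" using cb r(1) by (metis cball_eq_empty less_asym subset_empty)
    obtain y where y: "y \<in> M" "x \<bullet> y = support_fun M x" using support_fun_attained(1)[OF cM ne] by blast
    then have "x \<bullet> y \<le> f x" unfolding M_def by blast
    then show "support_fun M x \<le> f x" using y(2) by simp
    show "f x \<le> support_fun M x"
    proof (cases "x = 0")
      case True
      have "0 \<in> M" using cb r(1) by auto
      then show ?thesis using support_fun_attained(2)[OF cM ne, of 0 x] True f0 by simp
    next
      case False
      define x0 where "x0 = x /\<^sub>R f x"
      have fx: "f x > 0" by (rule fpos[OF False])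
      have fx0: "f x0 = 1" using fx by (simp add: x0_def hom)
      let ?U = "{z. f z < 1}"
      have "convex ?U"
      proof (rule convexI)
        fix z w :: "real^'n" and u v :: real
        assume *: "z \<in> ?U" "w \<in> ?U" "0 \<le> u" "0 \<le> v" "u + v = 1"
        have "f (u *\<^sub>R z + v *\<^sub>R w) \<le> u * f z + v * f w"
          using sub[of "u *\<^sub>R z" "v *\<^sub>R w"] * by (simp add: hom0)
        also have "\<dots> < 1" using * convex_bound_lt[of "f z" 1 "f w" u v] by simp
        finally show "u *\<^sub>R z + v *\<^sub>R w \<in> ?U" by simp
      qed
      moreover have "?U \<noteq> {}" using f0 by (auto intro: exI[of _ 0])
      moreover have "?U \<inter> {x0} = {}" using fx0 by auto
      ultimately obtain a b where ab: "a \<noteq> 0" "\<forall>z\<in>?U. a \<bullet> z \<le> b" "\<forall>z\<in>{x0}. b \<le> a \<bullet> z"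
        using separating_hyperplane_sets[of ?U "{x0}"] by auto
      have sep: "a \<bullet> z \<le> a \<bullet> x0" if "f z < 1" for z using ab that by force
      define \<alpha> where "\<alpha> = a \<bullet> x0"
      have fa: "f a > 0" by (rule fpos[OF ab(1)])
      have "a \<bullet> ((1 / (2 * f a)) *\<^sub>R a) \<le> \<alpha>"
        unfolding \<alpha>_def using fa by (intro sep) (simp add: hom)
      moreover have "0 < a \<bullet> ((1 / (2 * f a)) *\<^sub>R a)" using fa ab(1) by simp
      ultimately have \<alpha>: "\<alpha> > 0" by linarith
      have bound: "z \<bullet> a \<le> \<alpha> * f z" for z
      proof (cases "z = 0")
        case False
        then have fz: "f z > 0" by (rule fpos)
        have "c * (z \<bullet> a / f z) \<le> \<alpha>" if "0 < c" "c < 1" for c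
          using sep[of "(c / f z) *\<^sub>R z"] that fz by (simp add: hom \<alpha>_def inner_commute)
        then have "z \<bullet> a / f z \<le> \<alpha>" by (rule field_le_mult_one_interval)
        then show ?thesis using fz by (simp add: pos_divide_le_eq)
      qed (simp add: f0)
      define y where "y = a /\<^sub>R \<alpha>"
      have "y \<in> M" unfolding M_def y_def using bound \<alpha> by (simp add: field_simps)
      then have "x \<bullet> y \<le> support_fun M x" by (rule support_fun_attained(2)[OF cM ne])
      moreover have "x \<bullet> y = f x"
      proof -
        have "x = f x *\<^sub>R x0" using fx by (simp add: x0_def)
        then have "x \<bullet> y = f x * (x0 \<bullet> y)" by (metis inner_scaleR_left)
        also have "x0 \<bullet> y = 1" using \<alpha> by (simp add: y_def \<alpha>_def inner_commute)
        finally show ?thesis by simp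
      qed
      ultimately show ?thesis by simp
    qed
  qed
  ultimately show ?thesis by blast
qed

locale orlicz_fun =
  fixes \<phi> :: "real \<Rightarrow> real"
  assumes phi: "\<phi> \<in> orlicz_functions"
begin

lemma phi_nonneg: "0 \<le> t \<Longrightarrow> 0 \<le> \<phi> t" and phi_mono: "0 \<le> s \<Longrightarrow> s \<le> t \<Longrightarrow> \<phi> s \<le> \<phi> t"
  and phi_convex: "convex_on {0..} \<phi>" and phi_0 [simp]: "\<phi> 0 = 0" and phi_1 [simp]: "\<phi> 1 = 1"
  using phi by (auto simp: orlicz_functions_def mono_on_def)

lemma phi_convex_comb:
  assumes "0 \<le> s" "0 \<le> t" "0 \<le> u" "0 \<le> v" "u + v = 1"
  shows "\<phi> (u * s + v * t) \<le> u * \<phi> s + v * \<phi> t"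
proof -
  have "\<phi> ((1 - v) *\<^sub>R s + v *\<^sub>R t) \<le> (1 - v) * \<phi> s + v * \<phi> t"
    using assms by (intro convex_onD[OF phi_convex]) auto
  moreover have "1 - v = u" using assms by simp
  ultimately show ?thesis by simp
qed

lemma phi_le_id: "0 \<le> t \<Longrightarrow> t \<le> 1 \<Longrightarrow> \<phi> t \<le> t"
  using phi_convex_comb[of 0 1 "1 - t" t] by simp

lemma phi_ge_id: "1 \<le> t \<Longrightarrow> t \<le> \<phi> t"
proof -
  assume t: "1 \<le> t"
  have "\<phi> ((1 - 1 / t) * 0 + (1 / t) * t) \<le> (1 - 1 / t) * \<phi> 0 + (1 / t) * \<phi> t"
    using t by (intro phi_convex_comb) auto
  then show ?thesis using t by (simp add: field_simps)
qed

lemma phi_continuous: "continuous_on {0<..} \<phi>"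
  by (rule convex_on_continuous) (auto intro: convex_on_subset[OF phi_convex])

lemma phi_tendsto: "(f \<longlongrightarrow> a) F \<Longrightarrow> 0 < a \<Longrightarrow> ((\<lambda>x. \<phi> (f x)) \<longlongrightarrow> \<phi> a) F"
proof -
  assume f: "(f \<longlongrightarrow> a) F" and a: "0 < a"
  have "isCont \<phi> a" using phi_continuous a by (simp add: continuous_on_eq_continuous_at)
  then show ?thesis using f by (rule isCont_tendsto_compose)
qed

text \<open>
  The difference quotient at \<open>1\<close>. By convexity it increases on \<open>{0..<1}\<close>, so the left
  derivative is its supremum there.
\<close>

definition "slope t = (\<phi> t - 1) / (t - 1)"

lemma slope_bounds: "0 \<le> t \<Longrightarrow> t < 1 \<Longrightarrow> 1 \<le> slope t" "0 \<le> t \<Longrightarrow> t < 1 \<Longrightarrow> slope t \<le> \<phi> 2 - 1"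
proof -
  assume t: "0 \<le> t" "t < 1"
  have "slope t = (1 - \<phi> t) / (1 - t)" 
    using minus_divide_divide[of "1 - \<phi> t" "1 - t"] by (simp add: slope_def)
  then show "1 \<le> slope t" using phi_le_id[of t] t by simp
  have "(\<phi> t - \<phi> 1) / (t - 1) \<le> (\<phi> t - \<phi> 2) / (t - 2)" "(\<phi> t - \<phi> 2) / (t - 2) \<le> (\<phi> 1 - \<phi> 2) / (1 - 2)"
    using convex_on_slope_le[OF phi_convex, of t 2 1] t by auto
  then show "slope t \<le> \<phi> 2 - 1" by (simp add: slope_def)
qed

lemma slope_mono: "0 \<le> s \<Longrightarrow> s \<le> t \<Longrightarrow> t < 1 \<Longrightarrow> slope s \<le> slope t"
  using convex_on_slope_le(2)[OF phi_convex, of s 1 t] by (cases "s = t") (auto simp: slope_def)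

definition "left_slope = (SUP t\<in>{0..<1}. slope t)"

lemma slope_le_left_slope: "0 \<le> t \<Longrightarrow> t < 1 \<Longrightarrow> slope t \<le> left_slope"
  unfolding left_slope_def by (rule cSUP_upper) (auto intro!: bdd_aboveI[of _ "\<phi> 2 - 1"] slope_bounds)

lemma left_slope_ge_1: "1 \<le> left_slope" using slope_bounds(1)[of 0] slope_le_left_slope[of 0] by simp

lemma slope_eventually: "y < left_slope \<Longrightarrow> \<exists>t0\<in>{0..<1}. \<forall>t. t0 \<le> t \<longrightarrow> t < 1 \<longrightarrow> y < slope t"
proof -
  assume "y < left_slope"
  then obtain t0 where "t0 \<in> {0..<1}" "y < slope t0"
    unfolding left_slope_def by (subst (asm) less_cSUP_iff) (auto intro!: bdd_aboveI[of _ "\<phi> 2 - 1"] slope_bounds)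
  then show ?thesis using slope_mono by (intro bexI[of _ t0]) (auto intro: less_le_trans)
qed

lemma left_deriv_phi: "left_deriv \<phi> 1 = left_slope"
proof -
  have "(slope \<longlongrightarrow> left_slope) (at_left 1)"
  proof (rule order_tendstoI)
    fix y assume "y < left_slope"
    then obtain t0 where "t0 \<in> {0..<1}" "\<forall>t. t0 \<le> t \<longrightarrow> t < 1 \<longrightarrow> y < slope t" using slope_eventually by blast
    then show "eventually (\<lambda>t. y < slope t) (at_left 1)"
      unfolding eventually_at_left_field by (intro exI[of _ t0]) auto
  next
    fix y assume "left_slope < y"
    then show "eventually (\<lambda>t. slope t < y) (at_left 1)"
      unfolding eventually_at_left_field 
      by (intro exI[of _ 0]) (auto intro!: le_less_trans[OF slope_le_left_slope])
  qed
  then have d: "(\<phi> has_real_derivative left_slope) (at_left 1)"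
    by (simp add: has_field_derivative_iff slope_def[abs_def])
  show ?thesis
    unfolding left_deriv_def
  proof (rule the_equality[where P = "\<lambda>d. (\<phi> has_real_derivative d) (at_left 1)"])
    show "(\<phi> has_real_derivative left_slope) (at_left 1)" by (rule d)
    fix d' assume "(\<phi> has_real_derivative d') (at_left 1)"
    then have "(slope \<longlongrightarrow> d') (at_left 1)" by (simp add: has_field_derivative_iff slope_def[abs_def])
    then show "d' = left_slope" using tendsto_unique[OF trivial_limit_at_left_real _ \<open>(slope \<longlongrightarrow> left_slope) (at_left 1)\<close>] by blast
  qed
qed

text \<open>
  The condition on \<open>\<rho>\<close> in the definition of the Orlicz combination, for values \<open>a\<close>, \<open>b\<close> of the
  two support functions. The set of feasible triples is a convex cone, and this makes the
  infimum sublinear.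
\<close>

definition "feasible \<epsilon> a b \<rho> \<longleftrightarrow> \<rho> > 0 \<and> \<phi> (a / \<rho>) + \<epsilon> * \<phi> (b / \<rho>) \<le> 1"

definition "orlicz_value \<epsilon> a b = Inf {\<rho>. feasible \<epsilon> a b \<rho>}"

lemma orlicz_value_le: "feasible \<epsilon> a b \<rho> \<Longrightarrow> orlicz_value \<epsilon> a b \<le> \<rho>"
  unfolding orlicz_value_def by (rule cInf_lower) (auto simp: feasible_def intro!: bdd_belowI[of _ 0])

lemma feasible_mono:
  assumes "feasible \<epsilon> a b \<rho>" "0 \<le> a'" "a' \<le> a" "0 \<le> b'" "b' \<le> b" "\<rho> \<le> \<rho>'" "0 < \<epsilon>"
  shows "feasible \<epsilon> a' b' \<rho>'"
proof -
  have \<rho>: "0 < \<rho>" "0 < \<rho>'" using assms by (auto simp: feasible_def)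
  have "\<phi> (a' / \<rho>') \<le> \<phi> (a / \<rho>)" "\<phi> (b' / \<rho>') \<le> \<phi> (b / \<rho>)"
    using assms \<rho> by (auto intro!: phi_mono frac_le)
  then have "\<phi> (a' / \<rho>') + \<epsilon> * \<phi> (b' / \<rho>') \<le> \<phi> (a / \<rho>) + \<epsilon> * \<phi> (b / \<rho>)"
    using assms by (intro add_mono mult_left_mono) auto
  then show ?thesis using assms \<rho> by (simp add: feasible_def)
qed

lemma feasible_large:
  assumes "0 \<le> a" "0 < b" "0 < \<epsilon>"
  shows "feasible \<epsilon> a b (a + \<epsilon> * b + b)"
proof -
  let ?\<rho> = "a + \<epsilon> * b + b"
  have \<rho>: "?\<rho> > 0" using assms by (simp add: add_nonneg_pos)
  have "a / ?\<rho> \<le> 1" "b / ?\<rho> \<le> 1" using assms \<rho> by (simp_all add: pos_divide_le_eq)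
  then have "\<phi> (a / ?\<rho>) \<le> a / ?\<rho>" "\<phi> (b / ?\<rho>) \<le> b / ?\<rho>" using assms \<rho> by (auto intro!: phi_le_id)
  then have "\<phi> (a / ?\<rho>) + \<epsilon> * \<phi> (b / ?\<rho>) \<le> a / ?\<rho> + \<epsilon> * (b / ?\<rho>)"
    using assms by (intro add_mono mult_left_mono) auto
  also have "\<dots> = (a + \<epsilon> * b) / ?\<rho>" by (simp add: add_divide_distrib)
  also have "\<dots> \<le> 1" using assms \<rho> by (simp add: pos_divide_le_eq)
  finally show ?thesis using \<rho> by (simp add: feasible_def)
qed

lemma feasible_ge:
  assumes "feasible \<epsilon> a b \<rho>" "0 \<le> a" "0 \<le> b" "0 < \<epsilon>"
  shows "a \<le> \<rho>"
proof (rule ccontr)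
  assume "\<not> a \<le> \<rho>"
  then have "1 < a / \<rho>" using assms by (simp add: feasible_def)
  then have "1 < \<phi> (a / \<rho>)" using phi_ge_id[of "a / \<rho>"] by simp
  moreover have "0 \<le> \<epsilon> * \<phi> (b / \<rho>)" using assms by (auto simp: feasible_def intro!: mult_nonneg_nonneg phi_nonneg)
  ultimately show False using assms(1) by (simp add: feasible_def)
qed

lemma orlicz_value_ge: "0 \<le> a \<Longrightarrow> 0 < b \<Longrightarrow> 0 < \<epsilon> \<Longrightarrow> a \<le> orlicz_value \<epsilon> a b"
  unfolding orlicz_value_def using feasible_large[of a b \<epsilon>] feasible_ge[of \<epsilon> a b]
  by (intro cInf_greatest) auto

lemma orlicz_value_limit:
  assumes "0 < a" "0 < b"
    and f: "(f \<longlongrightarrow> \<rho>) F" and "0 < \<rho>"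
  shows "((\<lambda>x. \<phi> (a / f x) + \<epsilon> * \<phi> (b / f x)) \<longlongrightarrow> \<phi> (a / \<rho>) + \<epsilon> * \<phi> (b / \<rho>)) F"
  using assms by (intro tendsto_intros phi_tendsto) auto

text \<open>
  As \<open>\<phi>\<close> need not be strictly increasing, the equation has to be obtained from both sides of
  the infimum, by continuity.
\<close>

lemma orlicz_value_eq:
  assumes ab: "0 < a" "0 < b" and e: "0 < \<epsilon>"
  shows "\<phi> (a / orlicz_value \<epsilon> a b) + \<epsilon> * \<phi> (b / orlicz_value \<epsilon> a b) = 1"
proof -
  let ?\<rho> = "orlicz_value \<epsilon> a b"
  have \<rho>: "0 < ?\<rho>" using orlicz_value_ge[of a b \<epsilon>] assms by simp
  have lim: "((\<lambda>x. \<phi> (a / x) + \<epsilon> * \<phi> (b / x)) \<longlongrightarrow> \<phi> (a / ?\<rho>) + \<epsilon> * \<phi> (b / ?\<rho>)) (at ?\<rho> within X)" for X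
    by (rule orlicz_value_limit[OF ab _ \<rho>]) (rule tendsto_ident_at)
  have "\<phi> (a / ?\<rho>) + \<epsilon> * \<phi> (b / ?\<rho>) \<le> 1"
  proof (rule tendsto_upperbound[OF lim[of "{?\<rho><..}"]])
    have "feasible \<epsilon> a b x" if x: "?\<rho> < x" for x
    proof -
      obtain y where "feasible \<epsilon> a b y" "y < x"
        using x unfolding orlicz_value_def using feasible_large[of a b \<epsilon>] ab e
        by (subst (asm) cInf_less_iff) (auto simp: feasible_def intro!: bdd_belowI[of _ 0])
      then show ?thesis using ab e by (intro feasible_mono[of \<epsilon> a b y a b x]) auto
    qed
    then show "\<forall>\<^sub>F x in at_right ?\<rho>. \<phi> (a / x) + \<epsilon> * \<phi> (b / x) \<le> 1"
      unfolding eventually_at_right_field by (intro exI[of _ "?\<rho> + 1"]) (auto simp: feasible_def)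
  qed simp
  moreover have "1 \<le> \<phi> (a / ?\<rho>) + \<epsilon> * \<phi> (b / ?\<rho>)"
  proof (rule tendsto_lowerbound[OF lim[of "{..<?\<rho>}"]])
    have "1 \<le> \<phi> (a / x) + \<epsilon> * \<phi> (b / x)" if x: "0 < x" "x < ?\<rho>" for x
    proof (rule ccontr)
      assume "\<not> ?thesis"
      then have "feasible \<epsilon> a b x" using x by (simp add: feasible_def)
      then show False using orlicz_value_le x by force
    qed
    then show "\<forall>\<^sub>F x in at_left ?\<rho>. 1 \<le> \<phi> (a / x) + \<epsilon> * \<phi> (b / x)"
      unfolding eventually_at_left_field using \<rho> by (intro exI[of _ 0]) auto
  qed simp
  ultimately show ?thesis by simp
qed

lemma orlicz_value_feasible: "0 < a \<Longrightarrow> 0 < b \<Longrightarrow> 0 < \<epsilon> \<Longrightarrow> feasible \<epsilon> a b (orlicz_value \<epsilon> a b)"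
  using orlicz_value_eq[of a b \<epsilon>] orlicz_value_ge[of a b \<epsilon>] by (simp add: feasible_def)

lemma orlicz_value_zero: "orlicz_value \<epsilon> 0 0 = 0"
proof -
  have "{\<rho>. feasible \<epsilon> 0 0 \<rho>} = {0<..}" by (auto simp: feasible_def)
  then show ?thesis by (simp add: orlicz_value_def)
qed

lemma feasible_scale: "0 < c \<Longrightarrow> feasible \<epsilon> a b \<rho> \<Longrightarrow> feasible \<epsilon> (c * a) (c * b) (c * \<rho>)"
  by (simp add: feasible_def)

lemma orlicz_value_scale:
  assumes "0 < c" "0 < a" "0 < b" "0 < \<epsilon>"
  shows "orlicz_value \<epsilon> (c * a) (c * b) = c * orlicz_value \<epsilon> a b"
proof (rule antisym)
  show "orlicz_value \<epsilon> (c * a) (c * b) \<le> c * orlicz_value \<epsilon> a b"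
    using assms by (intro orlicz_value_le feasible_scale orlicz_value_feasible)
  have "orlicz_value \<epsilon> (1 / c * (c * a)) (1 / c * (c * b)) \<le> 1 / c * orlicz_value \<epsilon> (c * a) (c * b)"
    using assms by (intro orlicz_value_le feasible_scale orlicz_value_feasible) auto
  then show "c * orlicz_value \<epsilon> a b \<le> orlicz_value \<epsilon> (c * a) (c * b)" using assms by (simp add: field_simps)
qed

lemma feasible_add:
  assumes f: "feasible \<epsilon> a b \<rho>" "feasible \<epsilon> a' b' \<rho>'" and nn: "0 \<le> a" "0 \<le> b" "0 \<le> a'" "0 \<le> b'" "0 < \<epsilon>"
  shows "feasible \<epsilon> (a + a') (b + b') (\<rho> + \<rho>')"
proof -
  have \<rho>: "0 < \<rho>" "0 < \<rho>'" using f by (auto simp: feasible_def)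
  define u v where "u = \<rho> / (\<rho> + \<rho>')" and "v = \<rho>' / (\<rho> + \<rho>')"
  have uv: "0 \<le> u" "0 \<le> v" "u + v = 1" using \<rho> by (auto simp: u_def v_def add_divide_distrib[symmetric])
  have comb: "(x + x') / (\<rho> + \<rho>') = u * (x / \<rho>) + v * (x' / \<rho>')" for x x'
    using \<rho> by (simp add: u_def v_def add_divide_distrib)
  have "\<phi> ((a + a') / (\<rho> + \<rho>')) \<le> u * \<phi> (a / \<rho>) + v * \<phi> (a' / \<rho>')"
    "\<phi> ((b + b') / (\<rho> + \<rho>')) \<le> u * \<phi> (b / \<rho>) + v * \<phi> (b' / \<rho>')"
    unfolding comb by (intro phi_convex_comb divide_nonneg_pos nn \<rho> uv)+
  then have "\<phi> ((a + a') / (\<rho> + \<rho>')) + \<epsilon> * \<phi> ((b + b') / (\<rho> + \<rho>')) \<le>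
      (u * \<phi> (a / \<rho>) + v * \<phi> (a' / \<rho>')) + \<epsilon> * (u * \<phi> (b / \<rho>) + v * \<phi> (b' / \<rho>'))"
    using nn by (intro add_mono mult_left_mono) auto
  also have "\<dots> = u * (\<phi> (a / \<rho>) + \<epsilon> * \<phi> (b / \<rho>)) + v * (\<phi> (a' / \<rho>') + \<epsilon> * \<phi> (b' / \<rho>'))"
    by (simp add: algebra_simps)
  also have "\<dots> \<le> u * 1 + v * 1"
    using f uv by (intro add_mono mult_left_mono) (auto simp: feasible_def)
  finally show ?thesis using uv \<rho> by (simp add: feasible_def)
qed

text \<open>
  The candidate \<open>\<rho> = (1 + x) a\<close> is feasible if \<open>x \<le> 1\<close>:
  \<open>\<phi> (1 / (1 + x)) \<le> 1 / (1 + x) \<le> 1 - x / 2\<close>, and \<open>x = 2 (\<phi> q + 1) \<epsilon>\<close> is chosen to make the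
  second term at most \<open>x / 2\<close>. The summand \<open>1\<close> keeps \<open>x\<close> positive when \<open>\<phi> q = 0\<close>.
\<close>

lemma orlicz_value_growth:
  assumes ab: "0 < a" "0 < b" "b / a \<le> q" and e: "0 < \<epsilon>" "2 * (\<phi> q + 1) * \<epsilon> \<le> 1"
  shows "orlicz_value \<epsilon> a b \<le> (1 + 2 * (\<phi> q + 1) * \<epsilon>) * a"
proof (rule orlicz_value_le)
  define x where "x = 2 * (\<phi> q + 1) * \<epsilon>"
  have q: "0 \<le> q" using ab by (meson divide_nonneg_pos less_imp_le order_trans)
  have x: "0 < x" "x \<le> 1" using e phi_nonneg[OF q] by (auto simp: x_def)
  let ?\<rho> = "(1 + x) * a"
  have \<rho>: "0 < ?\<rho>" using x ab by simp
  have "\<phi> (a / ?\<rho>) \<le> 1 / (1 + x)" using phi_le_id[of "1 / (1 + x)"] x ab by simp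
  moreover have "\<epsilon> * \<phi> (b / ?\<rho>) \<le> x / 2"
  proof -
    have "b / ?\<rho> \<le> b / a" using ab x by (intro divide_left_mono) auto
    then have "b / ?\<rho> \<le> q" using ab by simp
    then have "\<phi> (b / ?\<rho>) \<le> \<phi> q + 1" using phi_mono[of "b / ?\<rho>" q] ab \<rho> by simp
    then have "\<epsilon> * \<phi> (b / ?\<rho>) \<le> \<epsilon> * (\<phi> q + 1)" using e by (intro mult_left_mono) auto
    moreover have "x / 2 = \<epsilon> * (\<phi> q + 1)" by (simp add: x_def)
    ultimately show ?thesis by linarith
  qed
  moreover have "1 / (1 + x) + x / 2 \<le> 1"
  proof -
    have "x * x \<le> x" using x by (simp add: mult_left_le)
    then show ?thesis using x by (simp add: field_simps)
  qed
  ultimately show "feasible \<epsilon> a b ((1 + 2 * (\<phi> q + 1) * \<epsilon>) * a)"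
    using \<rho> unfolding feasible_def x_def[symmetric] by linarith
qed

text \<open>
  With \<open>t = a / \<rho>\<close> the defining equation reads \<open>\<epsilon> \<phi> (b / \<rho>) = 1 - \<phi> t = slope t * (1 - t)\<close>,
  and \<open>\<rho> - a = \<rho> (1 - t)\<close>. Hence the quotient is \<open>\<rho> \<phi> (b / \<rho>) / slope t\<close>, where \<open>\<rho>\<close> tends to
  \<open>a0\<close> and \<open>t\<close> tends to \<open>1\<close> from below. All arguments may vary along the sequence.
\<close>

lemma orlicz_value_quotient_limit:
  fixes a b e :: "nat \<Rightarrow> real"
  assumes ab: "\<And>k. 0 < a k" "\<And>k. 0 < b k" "a \<longlonglongrightarrow> a0" "b \<longlonglongrightarrow> b0" "0 < a0" "0 < b0"
    and e: "\<And>k. 0 < e k" "e \<longlonglongrightarrow> 0" and growth: "\<And>k. orlicz_value (e k) (a k) (b k) \<le> (1 + c * e k) * a k"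
  shows "(\<lambda>k. (orlicz_value (e k) (a k) (b k) - a k) / e k) \<longlonglongrightarrow> a0 * \<phi> (b0 / a0) / left_slope"
proof -
  define \<rho> where "\<rho> k = orlicz_value (e k) (a k) (b k)" for k
  have ge: "a k \<le> \<rho> k" for k unfolding \<rho>_def using ab(1,2)[of k] e(1)[of k] by (intro orlicz_value_ge) auto
  have \<rho>pos: "0 < \<rho> k" for k using ge[of k] ab(1)[of k] by simp
  have \<rho>lim: "\<rho> \<longlonglongrightarrow> a0"
  proof (rule tendsto_sandwich[of a \<rho> _ "\<lambda>k. (1 + c * e k) * a k"])
    have "(\<lambda>k. (1 + c * e k) * a k) \<longlonglongrightarrow> (1 + c * 0) * a0" by (intro tendsto_intros e ab)
    then show "(\<lambda>k. (1 + c * e k) * a k) \<longlonglongrightarrow> a0" by simp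
  qed (use ge growth ab in \<open>auto simp: \<rho>_def\<close>)
  define t where "t k = a k / \<rho> k" for k
  have t: "0 < t k" "t k \<le> 1" for k using ge[of k] \<rho>pos[of k] ab(1)[of k] by (auto simp: t_def)
  have tlim: "t \<longlonglongrightarrow> 1"
  proof -
    have "t \<longlonglongrightarrow> a0 / a0" unfolding t_def using ab \<rho>lim by (intro tendsto_intros) auto
    then show ?thesis using ab by simp
  qed
  \<comment> \<open>\<open>t k = 1\<close> is possible when \<open>\<phi>\<close> vanishes at \<open>b / \<rho>\<close>; there \<open>slope\<close> is not meaningful\<close>
  define s where "s x = (if x < 1 then slope x else left_slope)" for x
  have s: "1 \<le> s (t k)" "s (t k) \<le> left_slope" for k
    using slope_bounds(1)[of "t k"] slope_le_left_slope[of "t k"] left_slope_ge_1 t[of k] by (auto simp: s_def)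
  have slim: "(\<lambda>k. s (t k)) \<longlonglongrightarrow> left_slope"
  proof (rule order_tendstoI)
    fix y assume y: "y < left_slope"
    then obtain t0 where t0: "t0 \<in> {0..<1}" "\<forall>t. t0 \<le> t \<longrightarrow> t < 1 \<longrightarrow> y < slope t" using slope_eventually by blast
    then have "\<forall>\<^sub>F k in sequentially. t0 < t k" using order_tendstoD(1)[OF tlim] by auto
    then show "\<forall>\<^sub>F k in sequentially. y < s (t k)"
      by eventually_elim (use t0 y in \<open>auto simp: s_def\<close>)
  next
    fix y assume "left_slope < y"
    then show "\<forall>\<^sub>F k in sequentially. s (t k) < y" by (intro always_eventually allI le_less_trans[OF s(2)])
  qed
  have eq: "(\<rho> k - a k) / e k = \<rho> k * (\<phi> (b k / \<rho> k) / s (t k))" for k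
  proof -
    have "\<phi> (t k) + e k * \<phi> (b k / \<rho> k) = 1"
      unfolding t_def \<rho>_def using ab(1,2)[of k] e(1)[of k] by (intro orlicz_value_eq)
    moreover have "s (t k) * (1 - t k) = 1 - \<phi> (t k)"
    proof (cases "t k < 1")
      case True
      then show ?thesis by (simp add: s_def slope_def divide_simps) (simp add: algebra_simps)
    next
      case False
      then have "t k = 1" using t(2)[of k] by simp
      then show ?thesis by simp
    qed
    ultimately have "e k * \<phi> (b k / \<rho> k) = s (t k) * (1 - t k)" by linarith
    then have "\<phi> (b k / \<rho> k) / s (t k) = (1 - t k) / e k"
      using s(1)[of k] e(1)[of k] by (simp add: divide_simps) (simp add: mult_ac)
    moreover have "\<rho> k * (1 - t k) = \<rho> k - a k" using \<rho>pos[of k] by (simp add: t_def right_diff_distrib)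
    ultimately show ?thesis by simp
  qed
  have "(\<lambda>k. \<rho> k * (\<phi> (b k / \<rho> k) / s (t k))) \<longlonglongrightarrow> a0 * (\<phi> (b0 / a0) / left_slope)"
    using ab left_slope_ge_1 by (intro tendsto_intros \<rho>lim slim phi_tendsto) auto
  then show ?thesis unfolding \<rho>_def[symmetric] eq by simp
qed

end

locale orlicz_pair = orlicz_fun \<phi> for \<phi> :: "real \<Rightarrow> real" +
  fixes K L :: "(real^'n) set" and r R rL RL :: real
  assumes K: "K \<in> convex_bodies_o" and L: "L \<in> convex_bodies_o"
    and K_balls: "0 < r" "cball 0 r \<subseteq> K" "K \<subseteq> cball 0 R"
    and L_balls: "0 < rL" "cball 0 rL \<subseteq> L" "L \<subseteq> cball 0 RL"
begin

abbreviation "hK \<equiv> support_fun K"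
abbreviation "hL \<equiv> support_fun L"

lemma compact_K: "compact K" and convex_K: "convex K" and K_ne: "K \<noteq> {}"
  and compact_L: "compact L" and L_ne: "L \<noteq> {}"
  using K L interior_subset by (auto simp: convex_bodies_o_def)

lemmas hK_bounds = support_fun_bounds[OF compact_K K_balls]
lemmas hL_bounds = support_fun_bounds[OF compact_L L_balls]

lemma hKL_pos: "x \<noteq> 0 \<Longrightarrow> 0 < hK x" "x \<noteq> 0 \<Longrightarrow> 0 < hL x"
  using hK_bounds(1)[of x] hL_bounds(1)[of x] mult_pos_pos[OF K_balls(1), of "norm x"] mult_pos_pos[OF L_balls(1), of "norm x"]
  by auto

lemma h_zero: "hK 0 = 0" "hL 0 = 0"
  using hK_bounds[of 0] hL_bounds[of 0] by auto

lemma RL_nonneg: "0 \<le> RL"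
  using L_balls(2,3) L_balls(1) by (metis cball_eq_empty linorder_not_less subset_empty subset_trans less_asym)

definition "comb \<epsilon> = orlicz_comb \<phi> \<epsilon> K L"

text \<open>
  The definite description in \<open>orlicz_comb\<close> is resolved here: the prescribed function is
  sublinear, hence the support function of a body, and a body is determined by its support
  function.
\<close>

lemma comb: 
  assumes e: "0 < \<epsilon>"
  shows "comb \<epsilon> \<in> convex_bodies_o" and "support_fun (comb \<epsilon>) x = orlicz_value \<epsilon> (hK x) (hL x)"
proof -
  let ?f = "\<lambda>x. orlicz_value \<epsilon> (hK x) (hL x)"
  have ge: "hK x \<le> ?f x" for x
    using orlicz_value_ge[of "hK x" "hL x" \<epsilon>] hKL_pos[of x] e by (cases "x = 0") (auto simp: h_zero orlicz_value_zero)
  have "\<exists>M\<in>convex_bodies_o. \<forall>x. support_fun M x = ?f x"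
  proof (rule sublinear_is_support_fun[where r = r and R = "R + \<epsilon> * RL + RL"])
    show "?f (c *\<^sub>R x) = c * ?f x" if "c > 0" for c x
      using that e hKL_pos[of x]
      by (cases "x = 0")
         (auto simp: h_zero orlicz_value_zero support_fun_scale[OF compact_K K_ne] support_fun_scale[OF compact_L L_ne] orlicz_value_scale)
    show "?f (x + y) \<le> ?f x + ?f y" for x y
    proof (cases "x = 0 \<or> y = 0")
      case True
      then show ?thesis by (auto simp: h_zero orlicz_value_zero)
    next
      case False
      note hp = hKL_pos[of x] hKL_pos[of y]
      show ?thesis
      proof (cases "x + y = 0")
        case True
        then show ?thesis using ge[of x] ge[of y] hp False by (simp add: h_zero orlicz_value_zero)
      next
        case xy: False
        have "feasible \<epsilon> (hK x + hK y) (hL x + hL y) (?f x + ?f y)"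
          using hp False e by (intro feasible_add orlicz_value_feasible) auto
        then have "feasible \<epsilon> (hK (x + y)) (hL (x + y)) (?f x + ?f y)"
          using hKL_pos[OF xy] e support_fun_add[OF compact_K K_ne, of x y] support_fun_add[OF compact_L L_ne, of x y]
          by (elim feasible_mono) auto
        then show ?thesis by (rule orlicz_value_le)
      qed
    qed
    show "0 < r" by (rule K_balls)
    show "r * norm x \<le> ?f x" for x using hK_bounds(1)[of x] ge[of x] by simp
    show "?f x \<le> (R + \<epsilon> * RL + RL) * norm x" for x
    proof (cases "x = 0")
      case False
      have "?f x \<le> hK x + \<epsilon> * hL x + hL x"
        using hKL_pos[OF False] e by (intro orlicz_value_le feasible_large) auto
      also have "\<dots> \<le> R * norm x + \<epsilon> * (RL * norm x) + RL * norm x"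
        using hK_bounds(2)[of x] hL_bounds(2)[of x] e by (intro add_mono mult_left_mono) auto
      finally show ?thesis by (simp add: algebra_simps)
    qed (simp add: h_zero orlicz_value_zero)
  qed
  then obtain M where M: "M \<in> convex_bodies_o" "\<And>x. support_fun M x = ?f x" by blast
  have "comb \<epsilon> = M"
    unfolding comb_def orlicz_comb_def
  proof (rule the_equality)
    show "M \<in> convex_bodies_o \<and> (\<forall>x. support_fun M x = Inf {\<rho>. 0 < \<rho> \<and> \<phi> (hK x / \<rho>) + \<epsilon> * \<phi> (hL x / \<rho>) \<le> 1})"
      using M by (simp add: orlicz_value_def feasible_def)
    fix N assume N: "N \<in> convex_bodies_o \<and> (\<forall>x. support_fun N x = Inf {\<rho>. 0 < \<rho> \<and> \<phi> (hK x / \<rho>) + \<epsilon> * \<phi> (hL x / \<rho>) \<le> 1})"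
    show "N = M" using N M by (intro support_fun_injective) (auto simp: orlicz_value_def feasible_def)
  qed
  then show "comb \<epsilon> \<in> convex_bodies_o" "support_fun (comb \<epsilon>) x = ?f x" using M by auto
qed

text \<open>
  The constant of \<open>orlicz_value_growth\<close> for an upper bound of the ratio of \<open>hL\<close> to \<open>hK\<close>. It
  depends neither on the direction nor on a subspace.
\<close>

definition "growth_const = 2 * (\<phi> (RL / r) + 1)"

lemma growth_const_pos: "0 < growth_const"
  using phi_nonneg[of "RL / r"] RL_nonneg K_balls(1) by (simp add: growth_const_def)

lemma support_comb_ge: "0 < \<epsilon> \<Longrightarrow> hK x \<le> support_fun (comb \<epsilon>) x"
  using orlicz_value_ge[of "hK x" "hL x" \<epsilon>] hKL_pos[of x] by (cases "x = 0") (auto simp: comb h_zero orlicz_value_zero)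

lemma support_comb_le:
  assumes e: "0 < \<epsilon>" "growth_const * \<epsilon> \<le> 1"
  shows "support_fun (comb \<epsilon>) x \<le> (1 + growth_const * \<epsilon>) * hK x"
proof (cases "x = 0")
  case False
  have "hL x / hK x \<le> (RL * norm x) / (r * norm x)"
    using hK_bounds(1)[of x] hL_bounds(2)[of x] hKL_pos[OF False] K_balls(1) False RL_nonneg by (intro frac_le) auto
  then have "hL x / hK x \<le> RL / r" using False by simp
  then show ?thesis
    using orlicz_value_growth[of "hK x" "hL x" "RL / r" \<epsilon>] hKL_pos[OF False] e by (simp add: comb growth_const_def)
qed (use e in \<open>simp add: comb h_zero orlicz_value_zero\<close>)

lemma comb_balls:
  assumes e: "0 < \<epsilon>" "growth_const * \<epsilon> \<le> 1"
  shows "cball 0 r \<subseteq> comb \<epsilon>" "comb \<epsilon> \<subseteq> cball 0 (2 * R)"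
proof -
  have "K \<subseteq> comb \<epsilon>"
    using convex_body_mem_iff[OF comb(1)[OF e(1)]] convex_body_mem_iff[OF K] support_comb_ge[OF e(1)]
    by (meson order_trans subsetI)
  then show "cball 0 r \<subseteq> comb \<epsilon>" using K_balls(2) by blast
  show "comb \<epsilon> \<subseteq> cball 0 (2 * R)"
  proof
    fix y assume y: "y \<in> comb \<epsilon>"
    have hy: "0 \<le> hK y" using hKL_pos(1)[of y] h_zero by (cases "y = 0") auto
    have "y \<bullet> y \<le> support_fun (comb \<epsilon>) y" using y convex_body_mem_iff[OF comb(1)[OF e(1)]] by blast
    also have "\<dots> \<le> (1 + growth_const * \<epsilon>) * hK y" by (rule support_comb_le[OF e])
    also have "\<dots> \<le> 2 * hK y" using e hy by (intro mult_right_mono) auto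
    also have "\<dots> \<le> 2 * (R * norm y)" using hK_bounds(2)[of y] by simp
    finally have "norm y * norm y \<le> (2 * R) * norm y" by (simp add: power2_norm_eq_inner[symmetric] power2_eq_square)
    then have "y \<noteq> 0 \<Longrightarrow> norm y \<le> 2 * R" by (simp add: mult_le_cancel_right)
    moreover have "0 \<le> R" using K_balls by (metis cball_eq_empty linorder_not_less subset_empty subset_trans less_asym)
    ultimately show "y \<in> cball 0 (2 * R)" by (cases "y = 0") auto
  qed
qed

end

lemma subspace_orthonormal_basis:
  fixes \<xi> :: "(real^'n) set"
  assumes "\<xi> \<in> grassmannian j"
  obtains B where "orthonormal_set B" "span B = \<xi>" "card B = j"
proof -
  have s: "subspace \<xi>" "dim \<xi> = j" using assms by (auto simp: grassmannian_def)
  obtain B where B: "B \<subseteq> \<xi>" "pairwise orthogonal B" "\<And>x. x \<in> B \<Longrightarrow> norm x = 1" "independent B" "card B = dim \<xi>" "span B = \<xi>"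
    by (rule orthonormal_basis_subspace[OF s(1)]) blast
  then show ?thesis using that[of B] s by (auto simp: orthonormal_set_def)
qed

lemma orth_proj_span:
  assumes "orthonormal_set B"
  shows "orth_proj (span B) x = (\<Sum>b\<in>B. (x \<bullet> b) *\<^sub>R b)"
  unfolding orth_proj_def
proof (rule the_equality)
  let ?p = "\<Sum>b\<in>B. (x \<bullet> b) *\<^sub>R b"
  have ps: "?p \<in> span B" by (intro span_sum span_scale span_base)
  have "?p \<bullet> b = x \<bullet> b" if "b \<in> B" for b
    using orthonormal_set_inner_sum[OF assms that order_refl, of "\<lambda>b. x \<bullet> b"] that by simp
  then have "orthogonal (x - ?p) b" if "b \<in> B" for b
    using that by (simp add: orthogonal_def inner_diff_left)
  then have orth: "orthogonal (x - ?p) z" if "z \<in> span B" for z using orthogonal_to_span[OF that] by blast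
  then show "?p \<in> span B \<and> (\<forall>z\<in>span B. orthogonal (x - ?p) z)" using ps by blast
  fix y assume y: "y \<in> span B \<and> (\<forall>z\<in>span B. orthogonal (x - y) z)"
  then have d: "y - ?p \<in> span B" using ps by (intro span_diff) auto
  have "(x - ?p) \<bullet> (y - ?p) = 0" "(x - y) \<bullet> (y - ?p) = 0" using orth[OF d] y d by (auto simp: orthogonal_def)
  then have "(y - ?p) \<bullet> (y - ?p) = 0" by (simp add: inner_diff_left)
  then show "y = ?p" by simp
qed

lemma orth_proj_props:
  assumes o: "orthonormal_set B"
  shows "linear (orth_proj (span B))" "orth_proj (span B) x \<in> span B"
    "u \<in> span B \<Longrightarrow> u \<bullet> orth_proj (span B) x = u \<bullet> x"
    "x \<in> span B \<Longrightarrow> orth_proj (span B) x = x" "norm (orth_proj (span B) x) \<le> norm x"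
proof -
  show "linear (orth_proj (span B))"
    unfolding orth_proj_span[OF o] by (rule linearI)
       (simp_all add: inner_add_left scaleR_add_left sum.distrib scaleR_sum_right)
  show in_span: "orth_proj (span B) x \<in> span B" for x unfolding orth_proj_span[OF o] by (intro span_sum span_scale span_base)
  show *: "u \<bullet> orth_proj (span B) x = u \<bullet> x" if "u \<in> span B" for u x
  proof -
    have "u \<bullet> orth_proj (span B) x = x \<bullet> (\<Sum>b\<in>B. (u \<bullet> b) *\<^sub>R b)"
      unfolding orth_proj_span[OF o] by (simp add: inner_sum_right mult.commute)
    then show ?thesis using orthonormal_set_expand[OF o that] by (simp add: inner_commute)
  qed
  show "x \<in> span B \<Longrightarrow> orth_proj (span B) x = x" using orthonormal_set_expand[OF o] by (simp add: orth_proj_span[OF o])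
  let ?p = "orth_proj (span B) x"
  have "norm ?p * norm ?p = ?p \<bullet> x"
    using *[OF in_span, of x x] by (simp add: power2_norm_eq_inner[symmetric] power2_eq_square)
  also have "\<dots> \<le> norm ?p * norm x" by (rule norm_cauchy_schwarz)
  finally show "norm ?p \<le> norm x" by (cases "?p = 0") (auto simp: mult_le_cancel_left)
qed

text \<open>
  This is why the projections of Orlicz combinations are accessible through the support
  functions of the bodies themselves.
\<close>

lemma support_fun_orth_proj:
  "orthonormal_set B \<Longrightarrow> u \<in> span B \<Longrightarrow> support_fun (orth_proj (span B) ` K) u = support_fun K u"
  by (simp add: support_fun_def image_image orth_proj_props(3))

lemma framed_body_orth_proj:
  assumes B: "orthonormal_set B" "B \<noteq> {}" and K: "compact K" "convex K" "0 < r" "cball 0 r \<subseteq> K" "K \<subseteq> cball 0 R"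
  shows "framed_body B (orth_proj (span B) ` K) r R"
proof
  note p = orth_proj_props[OF B(1)]
  show "compact (orth_proj (span B) ` K)"
    by (rule compact_continuous_image[OF linear_continuous_on_compose[OF continuous_on_id p(1)] K(1)])
  show "convex (orth_proj (span B) ` K)" by (rule convex_linear_image[OF p(1) K(2)])
  show "orth_proj (span B) ` K \<subseteq> span B" using p(2) by blast
  show "cball 0 r \<inter> span B \<subseteq> orth_proj (span B) ` K"
  proof
    fix x assume "x \<in> cball 0 r \<inter> span B"
    then show "x \<in> orth_proj (span B) ` K" using p(4)[of x] K(4) by (intro image_eqI[of _ _ x]) auto
  qed
  show "orth_proj (span B) ` K \<subseteq> cball 0 R"
    using K(5) p(5) by (auto simp: subset_iff intro: order_trans)
qed (use assms in auto)

context orlicz_pair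
begin

lemma body_variation_proj:
  assumes B: "orthonormal_set B" "B \<noteq> {}"
    and e: "\<And>k. 0 < \<epsilon> k" "\<And>k. \<epsilon> k \<le> 1" "\<And>k. growth_const * \<epsilon> k \<le> 1" "\<epsilon> \<longlonglongrightarrow> 0"
  shows "body_variation B (orth_proj (span B) ` K) r R (\<lambda>k. orth_proj (span B) ` comb (\<epsilon> k)) (2 * R) growth_const \<epsilon>
     (\<lambda>u. hK u * \<phi> (hL u / hK u) / left_slope)"
proof -
  let ?P = "orth_proj (span B)"
  have fb: "framed_body B (?P ` K) r R"
    by (rule framed_body_orth_proj[OF B compact_K convex_K K_balls])
  interpret framed_body B "?P ` K" r R by (rule fb)
  have cc: "compact (comb (\<epsilon> k))" "convex (comb (\<epsilon> k))" for k
    using comb(1)[OF e(1)] by (auto simp: convex_bodies_o_def)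
  have nz: "u \<noteq> 0" if "u \<in> S" for u using that by auto
  have sK: "support_fun (?P ` K) u = hK u" if "u \<in> S" for u using that by (simp add: support_fun_orth_proj[OF B(1)])
  have sC: "support_fun (?P ` comb (\<epsilon> k)) u = support_fun (comb (\<epsilon> k)) u" if "u \<in> S" for u k
    using that by (simp add: support_fun_orth_proj[OF B(1)])
  have contK: "continuous_on UNIV hK" and contL: "continuous_on UNIV hL"
  proof -
    have *: "continuous_on UNIV (support_fun M)" if "compact M" "M \<noteq> {}" "M \<subseteq> cball 0 D" "0 \<le> D" for M :: "(real^'n) set" and D
      using support_fun_lipschitz[OF that(1-3)] that(4)
      by (intro lipschitz_on_continuous_on[where L = D] lipschitz_onI) (auto simp: dist_norm)
    show "continuous_on UNIV hK" by (rule *[OF compact_K K_ne K_balls(3) less_imp_le[OF R_pos]])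
    show "continuous_on UNIV hL" by (rule *[OF compact_L L_ne L_balls(3) RL_nonneg])
  qed
  show ?thesis
  proof (intro body_variation.intro body_variation_axioms.intro)
    show "framed_body B (?P ` K) r R" by (rule fb)
    show "framed_body B (?P ` comb (\<epsilon> k)) r (2 * R)" for k
      by (rule framed_body_orth_proj[OF B cc K_balls(1) comb_balls[OF e(1,3)]])
    show "0 \<le> growth_const" using growth_const_pos by simp
    show "continuous_on S (\<lambda>u. hK u * \<phi> (hL u / hK u) / left_slope)"
    proof -
      have k: "continuous_on S hK" "continuous_on S hL"
        using contK contL by (auto intro: continuous_on_subset)
      have "continuous_on S (\<lambda>u. hL u / hK u)"
        using hKL_pos(1)[OF nz] by (intro continuous_on_divide k) (auto simp: less_imp_neq[symmetric])
      then have "continuous_on S (\<lambda>u. \<phi> (hL u / hK u))"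
        by (rule continuous_on_compose2[OF phi_continuous]) (use hKL_pos[OF nz] in auto)
      then show ?thesis using left_slope_ge_1 by (intro continuous_intros k) auto
    qed
    show "support_fun (?P ` K) u \<le> support_fun (?P ` comb (\<epsilon> k)) u" if "u \<in> S" for u k
      unfolding sK[OF that] sC[OF that] by (rule support_comb_ge[OF e(1)])
    show "support_fun (?P ` comb (\<epsilon> k)) u \<le> (1 + growth_const * \<epsilon> k) * support_fun (?P ` K) u" if "u \<in> S" for u k
      unfolding sK[OF that] sC[OF that] by (rule support_comb_le[OF e(1,3)])
    fix \<sigma> :: "nat \<Rightarrow> nat" and v u
    assume \<sigma>: "strict_mono \<sigma>" and v: "\<And>k. v k \<in> S" and u: "u \<in> S" and vu: "v \<longlonglongrightarrow> u"
    have "(\<lambda>k. (orlicz_value (\<epsilon> (\<sigma> k)) (hK (v k)) (hL (v k)) - hK (v k)) / \<epsilon> (\<sigma> k)) \<longlonglongrightarrow> hK u * \<phi> (hL u / hK u) / left_slope"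
    proof (rule orlicz_value_quotient_limit[where c = growth_const])
      show "0 < hK (v k)" "0 < hL (v k)" for k using hKL_pos[OF nz[OF v]] by auto
      show "0 < hK u" "0 < hL u" using hKL_pos[OF nz[OF u]] by auto
      show "(\<lambda>k. hK (v k)) \<longlonglongrightarrow> hK u" "(\<lambda>k. hL (v k)) \<longlonglongrightarrow> hL u"
        using continuous_on_tendsto_compose[OF contK vu] continuous_on_tendsto_compose[OF contL vu] by auto
      show "(\<lambda>k. \<epsilon> (\<sigma> k)) \<longlonglongrightarrow> 0" using LIMSEQ_subseq_LIMSEQ[OF e(4) \<sigma>] by (simp add: comp_def)
      show "orlicz_value (\<epsilon> (\<sigma> k)) (hK (v k)) (hL (v k)) \<le> (1 + growth_const * \<epsilon> (\<sigma> k)) * hK (v k)" for k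
        using support_comb_le[OF e(1,3)[of "\<sigma> k"], of "v k"] by (simp add: comb(2)[OF e(1)])
    qed (rule e)
    then show "(\<lambda>k. (support_fun (?P ` comb (\<epsilon> (\<sigma> k))) (v k) - support_fun (?P ` K) (v k)) / \<epsilon> (\<sigma> k))
        \<longlonglongrightarrow> hK u * \<phi> (hL u / hK u) / left_slope"
      unfolding sK[OF v] sC[OF v] comb(2)[OF e(1)] .
  qed (use e in auto)
qed

text \<open>
  The statement for a single subspace, with the bounds that make it uniform in \<open>\<xi>\<close>.
\<close>

theorem projection_volume_derivative:
  assumes \<xi>: "\<xi> \<in> grassmannian j" "1 \<le> j"
    and e: "\<And>k. 0 < \<epsilon> k" "\<And>k. \<epsilon> k \<le> 1" "\<And>k. growth_const * \<epsilon> k \<le> 1" "\<epsilon> \<longlonglongrightarrow> 0"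
  shows "(\<lambda>k. (vol_in \<xi> (orth_proj \<xi> ` comb (\<epsilon> k)) - vol_in \<xi> (orth_proj \<xi> ` K)) / \<epsilon> k) \<longlonglongrightarrow>
      real j / left_slope * orlicz_mixed_vol \<phi> \<xi> (orth_proj \<xi> ` K) (orth_proj \<xi> ` L)"
    and "vol_in \<xi> (orth_proj \<xi> ` K) \<le> vol_in \<xi> (orth_proj \<xi> ` comb (\<epsilon> k))"
    and "vol_in \<xi> (orth_proj \<xi> ` comb (\<epsilon> k)) \<le> (1 + growth_const * \<epsilon> k) ^ j * vol_in \<xi> (orth_proj \<xi> ` K)"
    and "unit_ball_vol (real j) * r ^ j \<le> vol_in \<xi> (orth_proj \<xi> ` K)"
    and "vol_in \<xi> (orth_proj \<xi> ` K) \<le> unit_ball_vol (real j) * R ^ j"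
proof -
  obtain B where B: "orthonormal_set B" "span B = \<xi>" "card B = j" using subspace_orthonormal_basis[OF \<xi>(1)] by blast
  have ne: "B \<noteq> {}" using B(3) \<xi>(2) by auto
  interpret body_variation B "orth_proj (span B) ` K" r R "\<lambda>k. orth_proj (span B) ` comb (\<epsilon> k)" "2 * R" growth_const \<epsilon>
     "\<lambda>u. hK u * \<phi> (hL u / hK u) / left_slope"
    by (rule body_variation_proj[OF B(1) ne e])
  have vol: "vol_in \<xi> X = measure \<mu> X" for X
    unfolding vol_in_def subspace_lborel_eq_frame[OF B(1,2)] by simp
  have sp: "space (surface_area_measure (span B) (orth_proj (span B) ` K)) = S"
    unfolding surface_area_measure_eq by (rule space_surf_measure)
  have int: "(\<integral>u. hK u * \<phi> (hL u / hK u) / left_slope \<partial>surface_area_measure (span B) (orth_proj (span B) ` K)) =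
     real j / left_slope * orlicz_mixed_vol \<phi> \<xi> (orth_proj \<xi> ` K) (orth_proj \<xi> ` L)"
  proof -
    have "(\<integral>u. hK u * \<phi> (hL u / hK u) / left_slope \<partial>surface_area_measure (span B) (orth_proj (span B) ` K)) =
       (\<integral>u. (\<phi> (support_fun (orth_proj (span B) ` L) u / support_fun (orth_proj (span B) ` K) u) *
          support_fun (orth_proj (span B) ` K) u) / left_slope \<partial>surface_area_measure (span B) (orth_proj (span B) ` K))"
      by (intro Bochner_Integration.integral_cong refl) (simp add: sp support_fun_orth_proj[OF B(1)])
    also have "\<dots> = (\<integral>u. \<phi> (support_fun (orth_proj (span B) ` L) u / support_fun (orth_proj (span B) ` K) u) *
          support_fun (orth_proj (span B) ` K) u \<partial>surface_area_measure (span B) (orth_proj (span B) ` K)) / left_slope"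
      by (rule integral_divide_zero)
    also have "\<dots> = real j / left_slope * orlicz_mixed_vol \<phi> \<xi> (orth_proj \<xi> ` K) (orth_proj \<xi> ` L)"
    proof -
      have "dim \<xi> = j" using \<xi> by (simp add: grassmannian_def)
      then show ?thesis using \<xi>(2) by (simp add: orlicz_mixed_vol_def B(2))
    qed
    finally show ?thesis .
  qed
  from volume_variation[unfolded int]
  show "(\<lambda>k. (vol_in \<xi> (orth_proj \<xi> ` comb (\<epsilon> k)) - vol_in \<xi> (orth_proj \<xi> ` K)) / \<epsilon> k) \<longlonglongrightarrow>
      real j / left_slope * orlicz_mixed_vol \<phi> \<xi> (orth_proj \<xi> ` K) (orth_proj \<xi> ` L)"
    unfolding vol B(2) .
  show "vol_in \<xi> (orth_proj \<xi> ` K) \<le> vol_in \<xi> (orth_proj \<xi> ` comb (\<epsilon> k))"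
    and "vol_in \<xi> (orth_proj \<xi> ` comb (\<epsilon> k)) \<le> (1 + growth_const * \<epsilon> k) ^ j * vol_in \<xi> (orth_proj \<xi> ` K)"
    unfolding vol using measure_variation_bounds[of k] B by simp_all
  have mc: "measure \<mu> (cball 0 d) = unit_ball_vol (real j) * d ^ j" if "d > 0" for d
    unfolding measure_def emeasure_frame_cball_0[OF B(1) that] B(3) using that by simp
  have fc: "cball 0 d \<in> fmeasurable \<mu>" for d :: real
    using emeasure_frame_bounded[OF B(1), of "cball 0 d"] by (intro fmeasurableI) auto
  have Am: "orth_proj (span B) ` K \<in> sets \<mu>" using compact_A by (simp add: borel_compact)
  have "measure \<mu> (cball 0 r) = measure \<mu> (cball 0 r \<inter> span B)"
    using AE_frame_lborel_span[of B] span_B_borel by (intro measure_eq_AE) auto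
  also have "\<dots> \<le> measure \<mu> (orth_proj (span B) ` K)"
    using ball_sub emeasure_A_finite Am by (intro measure_mono_fmeasurable fmeasurableI) auto
  finally show "unit_ball_vol (real j) * r ^ j \<le> vol_in \<xi> (orth_proj \<xi> ` K)"
    unfolding vol mc[OF K_balls(1)] B(2) .
  have "measure \<mu> (orth_proj (span B) ` K) \<le> measure \<mu> (cball 0 R)"
    by (rule measure_mono_fmeasurable[OF A_ball Am fc])
  then show "vol_in \<xi> (orth_proj \<xi> ` K) \<le> unit_ball_vol (real j) * R ^ j"
    unfolding vol mc[OF R_pos] B(2) .
qed

end

section \<open>Integration over the Grassmannian\<close>

lemma orthonormal_extension:
  fixes B :: "'a::euclidean_space set"
  assumes o: "orthonormal_set B"
  obtains C where "orthonormal_set (B \<union> C)" "B \<inter> C = {}" "span (B \<union> C) = UNIV"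
proof -
  let ?V = "{y. \<forall>b\<in>B. b \<bullet> y = 0}"
  have sub: "subspace ?V" by (auto simp: subspace_def inner_right_distrib)
  obtain C where C: "C \<subseteq> ?V" "pairwise orthogonal C" "\<And>x. x \<in> C \<Longrightarrow> norm x = 1" "independent C" "card C = dim ?V" "span C = ?V"
    by (rule orthonormal_basis_subspace[OF sub]) blast
  show ?thesis
  proof (rule that[of C])
    show "B \<inter> C = {}"
    proof (rule ccontr)
      assume "B \<inter> C \<noteq> {}"
      then obtain b where b: "b \<in> B" "b \<in> C" by blast
      then have "b \<bullet> b = 0" using C(1) by blast
      then show False using C(3)[OF b(2)] by simp
    qed
    have cross: "b \<bullet> c = 0" "c \<bullet> b = 0" if "b \<in> B" "c \<in> C" for b c
      using C(1) that by (auto simp: inner_commute)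
    then show "orthonormal_set (B \<union> C)"
      using o C(2,3) unfolding orthonormal_set_def pairwise_def orthogonal_def by auto
    have "x \<in> span (B \<union> C)" for x
    proof -
      let ?p = "\<Sum>b\<in>B. (x \<bullet> b) *\<^sub>R b"
      have "?p \<bullet> b = x \<bullet> b" if "b \<in> B" for b
        using orthonormal_set_inner_sum[OF o that order_refl, of "\<lambda>b. x \<bullet> b"] that by simp
      then have "x - ?p \<in> span C" unfolding C(6) by (simp add: inner_diff_right inner_commute)
      moreover have "?p \<in> span B" by (intro span_sum span_scale span_base)
      ultimately have "?p + (x - ?p) \<in> span (B \<union> C)"
        by (intro span_add) (auto intro: subsetD[OF span_mono, rotated])
      then show ?thesis by simp
    qed
    then show "span (B \<union> C) = UNIV" by blast
  qed
qed

lemma tendsto_matrix_vector_mult: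
  fixes M :: "'b \<Rightarrow> real^'n^'m"
  assumes "(M \<longlongrightarrow> M0) F" "(v \<longlongrightarrow> v0) F"
  shows "((\<lambda>x. M x *v v x) \<longlongrightarrow> M0 *v v0) F"
proof (rule vec_tendstoI)
  fix i
  show "((\<lambda>x. (M x *v v x) $ i) \<longlongrightarrow> (M0 *v v0) $ i) F"
    unfolding matrix_vector_mult_def using assms by (auto intro!: tendsto_intros tendsto_vec_nth)
qed

text \<open>
  For the matrix \<open>M\<close> of the projection to \<open>\<xi>\<close> the fibre over \<open>M\<close> is the product of the
  projected body with the unit ball of the orthogonal complement. Writing membership in the
  projection as \<open>\<exists>y\<in>K. M x = M y\<close> makes the set closed, without conditions on \<open>M\<close>.
\<close>

definition proj_cylinder :: "(real^'n) set \<Rightarrow> ((real^'n^'n) \<times> (real^'n)) set" where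
  "proj_cylinder K = {(M, x). (\<exists>y\<in>K. M *v x = M *v y) \<and> norm (x - M *v x) \<le> 1}"

lemma closed_proj_cylinder:
  fixes K :: "(real^'n) set"
  assumes "compact K"
  shows "closed (proj_cylinder K)"
  unfolding closed_sequential_limits
proof (intro allI impI)
  fix z :: "nat \<Rightarrow> (real^'n^'n) \<times> (real^'n)" and l
  assume z: "(\<forall>n. z n \<in> proj_cylinder K) \<and> z \<longlonglongrightarrow> l"
  define M x where "M n = fst (z n)" and "x n = snd (z n)" for n
  have zn: "(M n, x n) \<in> proj_cylinder K" for n using z by (simp add: M_def x_def)
  then have "\<forall>n. \<exists>y. y \<in> K \<and> M n *v x n = M n *v y" unfolding proj_cylinder_def by blast
  then obtain y where y: "\<And>n. y n \<in> K" "\<And>n. M n *v x n = M n *v y n" by metis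
  have nb: "norm (x n - M n *v x n) \<le> 1" for n using zn[of n] by (simp add: proj_cylinder_def)
  have Ml: "M \<longlonglongrightarrow> fst l" and xl: "x \<longlonglongrightarrow> snd l"
    unfolding M_def x_def using z by (auto intro: tendsto_fst tendsto_snd)
  obtain w \<sigma> where w: "w \<in> K" "strict_mono \<sigma>" "(y \<circ> \<sigma>) \<longlonglongrightarrow> w"
    by (rule seq_compactE[OF compact_imp_seq_compact[OF assms], of y]) (use y in auto)
  have M\<sigma>: "(\<lambda>n. M (\<sigma> n)) \<longlonglongrightarrow> fst l" "(\<lambda>n. x (\<sigma> n)) \<longlonglongrightarrow> snd l" "(\<lambda>n. y (\<sigma> n)) \<longlonglongrightarrow> w"
    using LIMSEQ_subseq_LIMSEQ[OF Ml w(2)] LIMSEQ_subseq_LIMSEQ[OF xl w(2)] w(3) by (auto simp: comp_def)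
  have 1: "(\<lambda>n. M (\<sigma> n) *v x (\<sigma> n)) \<longlonglongrightarrow> fst l *v snd l" by (intro tendsto_matrix_vector_mult M\<sigma>)
  have 2: "(\<lambda>n. M (\<sigma> n) *v x (\<sigma> n)) \<longlonglongrightarrow> fst l *v w"
    unfolding y(2) by (intro tendsto_matrix_vector_mult M\<sigma>)
  have "fst l *v snd l = fst l *v w" by (rule LIMSEQ_unique[OF 1 2])
  moreover have "norm (snd l - fst l *v snd l) \<le> 1"
  proof (rule LIMSEQ_le_const2)
    show "(\<lambda>n. norm (x n - M n *v x n)) \<longlonglongrightarrow> norm (snd l - fst l *v snd l)"
      by (intro tendsto_norm tendsto_diff tendsto_matrix_vector_mult Ml xl)
  qed (use nb in blast)
  ultimately show "l \<in> proj_cylinder K" using w(1) by (auto simp: proj_cylinder_def split: prod.splits)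
qed

text \<open>
  The factor \<open>unit_ball_vol\<close> comes from the unit ball of the orthogonal complement, spanned by
  an orthonormal set \<open>C\<close> that completes \<open>B\<close>.
\<close>

lemma emeasure_proj_cylinder:
  fixes K :: "(real^'n) set"
  assumes B: "orthonormal_set B" and K: "compact K"
  shows "emeasure lborel (Pair (matrix (orth_proj (span B))) -` proj_cylinder K) =
     emeasure (frame_lborel B) (orth_proj (span B) ` K) * ennreal (unit_ball_vol (real (CARD('n) - card B)))"
proof -
  let ?P = "orth_proj (span B)"
  note p = orth_proj_props[OF B]
  have mP: "matrix ?P *v x = ?P x" for x using p(1) by (simp add: matrix_works)
  obtain C where C: "orthonormal_set (B \<union> C)" "B \<inter> C = {}" "span (B \<union> C) = UNIV"
    using orthonormal_extension[OF B] by blast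
  have oC: "orthonormal_set C" using C(1) by (rule orthonormal_set_mono) auto
  have fin: "finite B" "finite C" using orthonormal_set_finite[OF C(1)] by auto
  have "card (B \<union> C) = CARD('n)" using orthonormal_set_card[OF C(1)] C(3) by (simp add: dim_UNIV)
  then have cC: "card C = CARD('n) - card B" using card_Un_disjoint[OF fin C(2)] by simp
  define X where "X = {x. ?P x \<in> ?P ` K \<and> norm (x - ?P x) \<le> 1}"
  have X: "Pair (matrix ?P) -` proj_cylinder K = X"
    by (auto simp: proj_cylinder_def X_def mP)
  have Xm: "X \<in> sets borel"
  proof -
    have "Pair (matrix ?P) -` proj_cylinder K \<inter> UNIV \<in> sets borel"
      by (intro borel_closed continuous_closed_vimage[OF closed_proj_cylinder[OF K], unfolded Int_UNIV_right]
          continuous_intros) (auto intro!: continuous_closed_vimage closed_proj_cylinder K continuous_intros)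
    then show ?thesis by (simp add: X)
  qed
  have PKm: "?P ` K \<in> sets borel"
    by (intro borel_compact compact_continuous_image[OF linear_continuous_on_compose[OF continuous_on_id p(1)] K])
  have pxy: "?P (x + y) = x" if "x \<in> span B" "y \<in> span C" for x y
  proof -
    have "b \<bullet> y = 0" if "b \<in> B" for b
    proof -
      have "\<forall>c\<in>C. orthogonal b c"
      proof
        fix c assume c: "c \<in> C"
        then have "b \<noteq> c" using C(2) \<open>b \<in> B\<close> by blast
        then show "orthogonal b c"
          using orthonormal_set_inner[OF C(1), of b c] c \<open>b \<in> B\<close> by (simp add: orthogonal_def)
      qed
      then show ?thesis using orthogonal_to_span[OF \<open>y \<in> span C\<close>, of b] by (auto simp: orthogonal_def inner_commute)
    qed
    then have "?P y = 0" unfolding orth_proj_span[OF B] by (simp add: inner_commute)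
    then show ?thesis using p(4)[OF that(1)] linear_add[OF p(1), of x y] by simp
  qed
  have ball: "emeasure (frame_lborel C) (cball 0 1) = ennreal (unit_ball_vol (real (card C)))"
    using emeasure_frame_cball_0[OF oC, of 1] by simp
  have "emeasure lborel X = (\<integral>\<^sup>+x. indicator X x \<partial>frame_lborel (B \<union> C))"
    unfolding frame_lborel_UNIV[OF C(1,3)] using Xm by simp
  also have "\<dots> = (\<integral>\<^sup>+x. \<integral>\<^sup>+y. indicator X (x + y) \<partial>frame_lborel C \<partial>frame_lborel B)"
    using Xm by (intro nn_integral_frame_Un C) simp
  also have "\<dots> = (\<integral>\<^sup>+x. \<integral>\<^sup>+y. indicator (?P ` K) x * indicator (cball 0 1) y \<partial>frame_lborel C \<partial>frame_lborel B)"
  proof (rule nn_integral_cong_AE)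
    show "AE x in frame_lborel B. (\<integral>\<^sup>+y. indicator X (x + y) \<partial>frame_lborel C) =
        (\<integral>\<^sup>+y. indicator (?P ` K) x * indicator (cball 0 1) y \<partial>frame_lborel C)"
      using AE_frame_lborel_span[of B]
    proof eventually_elim
      case (elim x)
      show ?case
      proof (rule nn_integral_cong_AE)
        show "AE y in frame_lborel C. indicator X (x + y) = indicator (?P ` K) x * (indicator (cball 0 1) y :: ennreal)"
          using AE_frame_lborel_span[of C]
        proof eventually_elim
          case (elim y)
          have "x + y \<in> X \<longleftrightarrow> x \<in> ?P ` K \<and> y \<in> cball 0 1"
            unfolding X_def using pxy[OF \<open>x \<in> span B\<close> elim] by simp
          then show ?case by (auto simp: indicator_def)
        qed
      qed
    qed
  qed
  also have "\<dots> = (\<integral>\<^sup>+x. indicator (?P ` K) x * ennreal (unit_ball_vol (real (card C))) \<partial>frame_lborel B)"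
  proof (rule nn_integral_cong)
    fix x
    have "(\<integral>\<^sup>+y. indicator (?P ` K) x * indicator (cball 0 1) y \<partial>frame_lborel C) =
        indicator (?P ` K) x * emeasure (frame_lborel C) (cball 0 1)"
      by (subst nn_integral_cmult) (simp_all add: borel_measurable_indicator)
    then show "(\<integral>\<^sup>+y. indicator (?P ` K) x * indicator (cball 0 1) y \<partial>frame_lborel C) =
        indicator (?P ` K) x * ennreal (unit_ball_vol (real (card C)))" unfolding ball .
  qed
  also have "\<dots> = emeasure (frame_lborel B) (?P ` K) * ennreal (unit_ball_vol (real (card C)))"
    using PKm by (simp add: nn_integral_multc)
  finally show ?thesis unfolding X cC .
qed

text \<open>
  The volume of a fibre of a measurable subset of a product is measurable by Fubini's theorem,
  and the Borel sets of the Grassmannian are those pulled back from matrices.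
\<close>

lemma measurable_projection_volume:
  fixes K :: "(real^'n) set" and \<nu> :: "(real^'n) set measure"
  assumes \<nu>: "space \<nu> = grassmannian j" "sets \<nu> = sets (grassmannian_borel j)" and K: "compact K"
  shows "(\<lambda>\<xi>. vol_in \<xi> (orth_proj \<xi> ` K)) \<in> borel_measurable \<nu>"
proof -
  let ?w = "unit_ball_vol (real (CARD('n) - j))"
  let ?F = "\<lambda>M. emeasure lborel (Pair M -` proj_cylinder K)"
  have "proj_cylinder K \<in> sets (borel \<Otimes>\<^sub>M lborel)"
    unfolding sets_pair_measure_cong[OF refl sets_lborel] borel_prod
    by (rule borel_closed[OF closed_proj_cylinder[OF K]])
  then have F: "?F \<in> borel_measurable borel" by (rule lborel.measurable_emeasure_Pair)
  have "(\<lambda>\<xi>. matrix (orth_proj \<xi>)) \<in> grassmannian_borel j \<rightarrow>\<^sub>M borel"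
    unfolding grassmannian_borel_def by (rule measurable_vimage_algebra1) simp
  then have P: "(\<lambda>\<xi>. matrix (orth_proj \<xi>)) \<in> \<nu> \<rightarrow>\<^sub>M borel"
    using \<nu>(2) by (simp cong: measurable_cong_sets)
  have "(\<lambda>\<xi>. enn2real (?F (matrix (orth_proj \<xi>))) / ?w) \<in> borel_measurable \<nu>"
    using measurable_compose[OF P F] by measurable
  moreover have "vol_in \<xi> (orth_proj \<xi> ` K) = enn2real (?F (matrix (orth_proj \<xi>))) / ?w" if "\<xi> \<in> space \<nu>" for \<xi>
  proof -
    have "\<xi> \<in> grassmannian j" using that \<nu>(1) by simp
    then obtain B where B: "orthonormal_set B" "span B = \<xi>" "card B = j"
      by (rule subspace_orthonormal_basis)
    have "?w \<noteq> 0" using unit_ball_vol_pos[of "real (CARD('n) - j)"] by linarith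
    then show ?thesis
      using emeasure_proj_cylinder[OF B(1) K] unfolding B(2,3)
      by (simp add: vol_in_def subspace_lborel_eq_frame[OF B(1,2)] measure_def enn2real_mult)
  qed
  ultimately show ?thesis by (simp cong: measurable_cong)
qed

lemma derivative_along_sequence:
  assumes f: "(f has_real_derivative f') (at x)" and y: "y \<longlonglongrightarrow> x"
    and q: "(\<lambda>k. (y k - x) / e k) \<longlonglongrightarrow> d"
  shows "(\<lambda>k. (f (y k) - f x) / e k) \<longlonglongrightarrow> f' * d"
proof -
  obtain g where g: "\<And>z. f z - f x = g z * (z - x)" "isCont g x" "g x = f'"
    using f unfolding CARAT_DERIV by blast
  have "(\<lambda>k. g (y k)) \<longlonglongrightarrow> f'" using isCont_tendsto_compose[OF g(2) y] g(3) by simp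
  then have "(\<lambda>k. g (y k) * ((y k - x) / e k)) \<longlonglongrightarrow> f' * d" using q by (rule tendsto_mult)
  then show ?thesis by (simp add: g(1))
qed

text \<open>
  Bernoulli's inequality in the form \<open>inverse ((1 + x) ^ N) \<ge> (1 - x) ^ N \<ge> 1 - N * x\<close>
  dominates the difference quotients of negative powers of volume.
\<close>

lemma inverse_power_decrease:
  assumes "0 < a" "a \<le> b" "b \<le> (1 + x) ^ p * a" "0 \<le> x" "x \<le> 1"
  shows "\<bar>inverse (b ^ q) - inverse (a ^ q)\<bar> \<le> inverse (a ^ q) * (real (p * q) * x)"
proof -
  have b: "0 < b" using assms by simp
  have "b ^ q \<le> ((1 + x) ^ p * a) ^ q" using assms b by (intro power_mono) auto
  also have "\<dots> = (1 + x) ^ (p * q) * a ^ q" by (simp add: power_mult_distrib power_mult)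
  finally have "inverse ((1 + x) ^ (p * q) * a ^ q) \<le> inverse (b ^ q)"
    using b by (intro le_imp_inverse_le) auto
  then have lo: "inverse ((1 + x) ^ (p * q)) * inverse (a ^ q) \<le> inverse (b ^ q)" by simp
  have "1 - real (p * q) * x \<le> (1 - x) ^ (p * q)"
    using Bernoulli_inequality[of "- x" "p * q"] assms by simp
  also have "\<dots> \<le> inverse ((1 + x) ^ (p * q))"
  proof -
    have "((1 - x) * (1 + x)) ^ (p * q) \<le> 1 ^ (p * q)"
      using assms by (intro power_mono) (auto simp: algebra_simps intro: mult_le_one)
    then have "(1 - x) ^ (p * q) * (1 + x) ^ (p * q) \<le> 1" by (simp add: power_mult_distrib)
    moreover have "0 < (1 + x) ^ (p * q)" using assms by simp
    ultimately show ?thesis by (simp add: inverse_eq_divide pos_le_divide_eq)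
  qed
  finally have "(1 - real (p * q) * x) * inverse (a ^ q) \<le> inverse ((1 + x) ^ (p * q)) * inverse (a ^ q)"
    using assms by (intro mult_right_mono) auto
  then have "inverse (a ^ q) - inverse (a ^ q) * (real (p * q) * x) \<le> inverse (b ^ q)"
    using lo by (simp add: algebra_simps)
  moreover have "inverse (b ^ q) \<le> inverse (a ^ q)"
    using assms by (intro le_imp_inverse_le power_mono) auto
  ultimately show ?thesis by (simp add: abs_le_iff)
qed

context orlicz_pair
begin

text \<open>
  Dominated convergence over the Grassmannian, with a constant as dominating function since
  the projection volumes are bounded below, followed by the chain rule for
  \<open>z \<mapsto> z powr (- 1 / n)\<close>. Positivity of \<open>J\<close> is needed for this chain rule. The right limit is
  reduced to sequences, as the bounds hold for small \<open>\<epsilon>\<close> only.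
\<close>

lemma affine_quermass_right_derivative:
  fixes \<nu> :: "(real^'n) set measure"
  assumes j: "1 \<le> j" and \<nu>: "haar_prob_grassmannian j \<nu>"
  defines "J \<equiv> (LINT \<xi> | \<nu>. inverse (vol_in \<xi> (orth_proj \<xi> ` K) ^ CARD('n)))"
    and "I \<equiv> (LINT \<xi> | \<nu>. orlicz_mixed_vol \<phi> \<xi> (orth_proj \<xi> ` K) (orth_proj \<xi> ` L) *
                            inverse (vol_in \<xi> (orth_proj \<xi> ` K) ^ (CARD('n) + 1)))"
    and "C \<equiv> unit_ball_vol (real CARD('n)) / unit_ball_vol (real j)"
  shows "((\<lambda>\<epsilon>. (affine_quermass \<nu> j (comb \<epsilon>) - affine_quermass \<nu> j K) / \<epsilon>) \<longlongrightarrow>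
       C * J powr (- 1 / real CARD('n) - 1) * (real j / left_slope) * I) (at_right 0)"
    and "0 < J" and "0 \<le> I"
proof -
  let ?n = "CARD('n)"
  define V where "V \<xi> = vol_in \<xi> (orth_proj \<xi> ` K)" for \<xi> :: "(real^'n) set"
  define W where "W \<xi> = orlicz_mixed_vol \<phi> \<xi> (orth_proj \<xi> ` K) (orth_proj \<xi> ` L)" for \<xi> :: "(real^'n) set"
  define V' where "V' \<epsilon> \<xi> = vol_in \<xi> (orth_proj \<xi> ` comb \<epsilon>)" for \<epsilon> and \<xi> :: "(real^'n) set"
  have sp: "space \<nu> = grassmannian j" "sets \<nu> = sets (grassmannian_borel j)" "emeasure \<nu> (space \<nu>) = 1"
    using \<nu> by (auto simp: haar_prob_grassmannian_def)
  interpret \<nu>: finite_measure \<nu> by standard (simp add: sp(3))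
  have meas1: "measure \<nu> (space \<nu>) = 1" by (simp add: measure_def sp(3))
  have Vm [measurable]: "V \<in> borel_measurable \<nu>"
    unfolding V_def by (rule measurable_projection_volume[OF sp(1,2) compact_K])
  have V'm: "V' \<epsilon> \<in> borel_measurable \<nu>" if "0 < \<epsilon>" for \<epsilon>
    unfolding V'_def using comb(1)[OF that]
    by (intro measurable_projection_volume[OF sp(1,2)]) (simp add: convex_bodies_o_def)
  define lo hi where "lo = unit_ball_vol (real j) * r ^ j" and "hi = unit_ball_vol (real j) * R ^ j"
  \<comment> \<open>one fixed sequence of admissible parameters: measurability and nonnegativity of the
    mixed volume follow from its being a limit of difference quotients\<close>
  define e0 where "e0 k = 1 / ((1 + growth_const) * real (Suc k))" for k
  have gc: "0 < growth_const" by (rule growth_const_pos)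
  have e0: "0 < e0 k" "e0 k \<le> 1" "growth_const * e0 k \<le> 1" "e0 \<longlonglongrightarrow> 0" for k
  proof -
    have ge: "1 + growth_const \<le> (1 + growth_const) * real (Suc k)" using gc by simp
    then have p: "0 < (1 + growth_const) * real (Suc k)" using gc by linarith
    then show "0 < e0 k" by (simp add: e0_def)
    have "1 \<le> (1 + growth_const) * real (Suc k)" using ge gc by linarith
    then show "e0 k \<le> 1" using p unfolding e0_def by (subst divide_le_eq_1_pos)
    have "growth_const \<le> (1 + growth_const) * real (Suc k)" using ge by linarith
    then show "growth_const * e0 k \<le> 1" using p unfolding e0_def by simp
    have "(\<lambda>k. (1 / (1 + growth_const)) * (1 / real (Suc k))) \<longlonglongrightarrow> (1 / (1 + growth_const)) * 0"
      by (intro tendsto_intros LIMSEQ_Suc[OF lim_1_over_n])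
    then show "e0 \<longlonglongrightarrow> 0" by (simp add: e0_def[abs_def])
  qed
  note pvd = projection_volume_derivative[OF _ j, folded V_def V'_def W_def lo_def hi_def]
  have Vb: "lo \<le> V \<xi>" "V \<xi> \<le> hi" if "\<xi> \<in> space \<nu>" for \<xi>
    using pvd(4,5)[of \<xi> e0] that e0 sp(1) by auto
  have lo: "0 < lo" using K_balls(1) by (simp add: lo_def)
  have Vpos: "0 < V \<xi>" if "\<xi> \<in> space \<nu>" for \<xi> using Vb(1)[OF that] lo by simp
  have D0: "(\<lambda>k. (V' (e0 k) \<xi> - V \<xi>) / e0 k) \<longlonglongrightarrow> real j / left_slope * W \<xi>" if "\<xi> \<in> space \<nu>" for \<xi>
    using pvd(1)[of \<xi> e0] that e0 sp(1) by auto
  have "(\<lambda>\<xi>. real j / left_slope * W \<xi>) \<in> borel_measurable \<nu>"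
  proof (rule borel_measurable_LIMSEQ_real[OF D0])
    show "(\<lambda>\<xi>. (V' (e0 k) \<xi> - V \<xi>) / e0 k) \<in> borel_measurable \<nu>" for k
      using V'm[OF e0(1)[of k]] by measurable
  qed
  then have "(\<lambda>\<xi>. (left_slope / real j) * (real j / left_slope * W \<xi>)) \<in> borel_measurable \<nu>" by measurable
  then have Wm [measurable]: "W \<in> borel_measurable \<nu>" using j left_slope_ge_1 by simp
  have W0: "0 \<le> W \<xi>" if "\<xi> \<in> space \<nu>" for \<xi>
  proof -
    have "V \<xi> \<le> V' (e0 k) \<xi>" for k using pvd(2)[of \<xi> e0 k] that e0 sp(1) by auto
    then have "0 \<le> real j / left_slope * W \<xi>"
      by (intro LIMSEQ_le_const[OF D0[OF that]]) (auto intro!: divide_nonneg_nonneg less_imp_le[OF e0(1)])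
    moreover have c: "0 < real j / left_slope" using j left_slope_ge_1 by simp
    ultimately show ?thesis
      using mult_pos_neg[OF c, of "W \<xi>"] by (meson linorder_not_less)
  qed
  have J: "J = (\<integral>\<xi>. inverse (V \<xi> ^ ?n) \<partial>\<nu>)" by (simp add: J_def V_def)
  have I: "I = (\<integral>\<xi>. W \<xi> * inverse (V \<xi> ^ (?n + 1)) \<partial>\<nu>)" by (simp add: I_def V_def W_def)
  have intJ: "integrable \<nu> (\<lambda>\<xi>. inverse (V \<xi> ^ ?n))"
  proof (rule \<nu>.integrable_const_bound[where B = "inverse (lo ^ ?n)"])
    show "AE \<xi> in \<nu>. norm (inverse (V \<xi> ^ ?n)) \<le> inverse (lo ^ ?n)"
    proof (rule AE_I2)
      fix \<xi> assume \<xi>: "\<xi> \<in> space \<nu>"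
      show "norm (inverse (V \<xi> ^ ?n)) \<le> inverse (lo ^ ?n)"
        using Vb(1)[OF \<xi>] Vpos[OF \<xi>] lo by (simp add: le_imp_inverse_le power_mono)
    qed
  qed measurable
  show "0 < J"
  proof -
    have ne: "space \<nu> \<noteq> {}" using sp(3) by auto
    then obtain \<xi> where "\<xi> \<in> space \<nu>" by blast
    then have hi: "0 < hi" using Vb Vpos by (meson less_le_trans)
    have "(\<integral>\<xi>. inverse (hi ^ ?n) \<partial>\<nu>) \<le> J"
      unfolding J
    proof (rule integral_mono[OF _ intJ])
      fix \<xi> assume \<xi>: "\<xi> \<in> space \<nu>"
      show "inverse (hi ^ ?n) \<le> inverse (V \<xi> ^ ?n)"
        using Vb(2)[OF \<xi>] Vpos[OF \<xi>] by (intro le_imp_inverse_le power_mono) auto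
    qed simp
    moreover have "0 < inverse (hi ^ ?n)" using hi by simp
    moreover have "(\<integral>\<xi>. inverse (hi ^ ?n) \<partial>\<nu>) = inverse (hi ^ ?n)" by (simp add: meas1)
    ultimately show ?thesis by linarith
  qed
  then have Jpos: "0 < J" .
  show "0 \<le> I"
    unfolding I using W0 Vpos by (intro Bochner_Integration.integral_nonneg mult_nonneg_nonneg) (auto intro: less_imp_le)
  define \<Phi> where "\<Phi> z = C * z powr (- 1 / real ?n)" for z
  have aq: "affine_quermass \<nu> j K = \<Phi> J" by (simp add: affine_quermass_def \<Phi>_def C_def J_def)
  define l where "l = C * J powr (- 1 / real ?n - 1) * (real j / left_slope) * I"
  have seq: "(\<lambda>k. (affine_quermass \<nu> j (comb (\<epsilon> k)) - affine_quermass \<nu> j K) / \<epsilon> k) \<longlonglongrightarrow> l"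
    if e: "\<And>k. 0 < \<epsilon> k" "\<And>k. \<epsilon> k \<le> 1" "\<And>k. growth_const * \<epsilon> k \<le> 1" "\<epsilon> \<longlonglongrightarrow> 0" for \<epsilon>
  proof -
    have bd: "V \<xi> \<le> V' (\<epsilon> k) \<xi>" "V' (\<epsilon> k) \<xi> \<le> (1 + growth_const * \<epsilon> k) ^ j * V \<xi>"
      and lim: "(\<lambda>k. (V' (\<epsilon> k) \<xi> - V \<xi>) / \<epsilon> k) \<longlonglongrightarrow> real j / left_slope * W \<xi>" if "\<xi> \<in> space \<nu>" for k \<xi>
      using pvd(1)[of \<xi> \<epsilon>] pvd(2,3)[of \<xi> \<epsilon> k] that e sp(1) by auto
    let ?q = "\<lambda>k \<xi>. (inverse (V' (\<epsilon> k) \<xi> ^ ?n) - inverse (V \<xi> ^ ?n)) / \<epsilon> k"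
    define J' where "J' k = (\<integral>\<xi>. inverse (V' (\<epsilon> k) \<xi> ^ ?n) \<partial>\<nu>)" for k
    define w where "w = inverse (lo ^ ?n) * (real (j * ?n) * growth_const)"
    note [measurable] = V'm[OF e(1)]
    have qb: "\<bar>?q k \<xi>\<bar> \<le> w" if \<xi>: "\<xi> \<in> space \<nu>" for k \<xi>
    proof -
      have "\<bar>inverse (V' (\<epsilon> k) \<xi> ^ ?n) - inverse (V \<xi> ^ ?n)\<bar> \<le>
          inverse (V \<xi> ^ ?n) * (real (j * ?n) * (growth_const * \<epsilon> k))"
        using e gc bd[OF \<xi>] Vpos[OF \<xi>] by (intro inverse_power_decrease) (auto intro: less_imp_le)
      also have "\<dots> \<le> inverse (lo ^ ?n) * (real (j * ?n) * (growth_const * \<epsilon> k))"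
        using Vb(1)[OF \<xi>] lo gc e(1)[of k] by (intro mult_right_mono le_imp_inverse_le power_mono) auto
      also have "\<dots> = w * \<epsilon> k" by (simp add: w_def)
      finally show ?thesis using e(1)[of k] by (simp add: pos_divide_le_eq)
    qed
    have int': "integrable \<nu> (\<lambda>\<xi>. inverse (V' (\<epsilon> k) \<xi> ^ ?n))" for k
    proof (rule \<nu>.integrable_const_bound[where B = "inverse (lo ^ ?n)"])
      show "AE \<xi> in \<nu>. norm (inverse (V' (\<epsilon> k) \<xi> ^ ?n)) \<le> inverse (lo ^ ?n)"
      proof (rule AE_I2)
        fix \<xi> assume \<xi>: "\<xi> \<in> space \<nu>"
        have "lo \<le> V' (\<epsilon> k) \<xi>" using Vb(1)[OF \<xi>] bd(1)[OF \<xi>, of k] by simp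
        then show "norm (inverse (V' (\<epsilon> k) \<xi> ^ ?n)) \<le> inverse (lo ^ ?n)"
          using lo by (simp add: le_imp_inverse_le power_mono)
      qed
    qed measurable
    have "(\<lambda>k. \<integral>\<xi>. ?q k \<xi> \<partial>\<nu>) \<longlonglongrightarrow> (\<integral>\<xi>. - (real ?n * (real j / left_slope)) * (W \<xi> * inverse (V \<xi> ^ (?n + 1))) \<partial>\<nu>)"
    proof (rule integral_dominated_convergence[where w = "\<lambda>_. w"])
      show "AE \<xi> in \<nu>. (\<lambda>k. ?q k \<xi>) \<longlonglongrightarrow> - (real ?n * (real j / left_slope)) * (W \<xi> * inverse (V \<xi> ^ (?n + 1)))"
      proof (rule AE_I2)
        fix \<xi> assume \<xi>: "\<xi> \<in> space \<nu>"
        have der: "((\<lambda>z. inverse (z ^ ?n)) has_real_derivative - real ?n * inverse (V \<xi> ^ (?n + 1))) (at (V \<xi>))"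
        proof -
          have a: "((\<lambda>z. inverse (z ^ ?n)) has_real_derivative - (inverse (V \<xi> ^ ?n) * (real ?n * V \<xi> ^ (?n - 1)) * inverse (V \<xi> ^ ?n))) (at (V \<xi>))"
            using Vpos[OF \<xi>] by (auto intro!: derivative_eq_intros)
          have b: "inverse (V \<xi> ^ ?n) * (real ?n * V \<xi> ^ (?n - 1)) * inverse (V \<xi> ^ ?n) = real ?n * inverse (V \<xi> ^ (?n + 1))"
          proof -
            have "V \<xi> ^ ?n = V \<xi> ^ (?n - 1) * V \<xi>" by (rule power_minus_mult[symmetric]) simp
            then show ?thesis using Vpos[OF \<xi>] by (simp add: field_simps)
          qed
          show ?thesis using a unfolding b mult_minus_left .
        qed
        have Vlim: "(\<lambda>k. V' (\<epsilon> k) \<xi>) \<longlonglongrightarrow> V \<xi>"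
        proof -
          have "(\<lambda>k. \<epsilon> k * ((V' (\<epsilon> k) \<xi> - V \<xi>) / \<epsilon> k) + V \<xi>) \<longlonglongrightarrow> 0 * (real j / left_slope * W \<xi>) + V \<xi>"
            by (intro tendsto_intros e lim[OF \<xi>])
          then show ?thesis using e(1) by (simp add: less_imp_neq[symmetric])
        qed
        from derivative_along_sequence[OF der Vlim lim[OF \<xi>]]
        show "(\<lambda>k. ?q k \<xi>) \<longlonglongrightarrow> - (real ?n * (real j / left_slope)) * (W \<xi> * inverse (V \<xi> ^ (?n + 1)))"
          by (simp add: mult_ac)
      qed
      show "AE \<xi> in \<nu>. norm (?q k \<xi>) \<le> w" for k using qb by (intro AE_I2) simp
      show "(\<lambda>\<xi>. - (real ?n * (real j / left_slope)) * (W \<xi> * inverse (V \<xi> ^ (?n + 1)))) \<in> borel_measurable \<nu>"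
        by measurable
      show "?q k \<in> borel_measurable \<nu>" for k by measurable
      show "integrable \<nu> (\<lambda>_. w)" by simp
    qed
    also have "(\<integral>\<xi>. - (real ?n * (real j / left_slope)) * (W \<xi> * inverse (V \<xi> ^ (?n + 1))) \<partial>\<nu>) = - (real ?n * (real j / left_slope)) * I"
      unfolding I by (rule integral_mult_right_zero)
    also have "(\<lambda>k. \<integral>\<xi>. ?q k \<xi> \<partial>\<nu>) = (\<lambda>k. (J' k - J) / \<epsilon> k)"
      unfolding J J'_def using int' intJ by simp
    finally have Jq: "(\<lambda>k. (J' k - J) / \<epsilon> k) \<longlonglongrightarrow> - (real ?n * (real j / left_slope)) * I" .
    have Jlim: "J' \<longlonglongrightarrow> J"
    proof -
      have "(\<lambda>k. \<epsilon> k * ((J' k - J) / \<epsilon> k) + J) \<longlonglongrightarrow> 0 * (- (real ?n * (real j / left_slope)) * I) + J"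
        by (intro tendsto_add tendsto_mult e Jq tendsto_const)
      then show ?thesis using e(1) by (simp add: less_imp_neq[symmetric])
    qed
    have der: "(\<Phi> has_real_derivative C * ((- 1 / real ?n) * J powr (- 1 / real ?n - 1))) (at J)"
      unfolding \<Phi>_def[abs_def] by (intro DERIV_cmult has_real_derivative_powr Jpos)
    have n0: "real ?n \<noteq> 0" by simp
    have "C * ((- 1 / real ?n) * J powr (- 1 / real ?n - 1)) * (- (real ?n * (real j / left_slope)) * I) = l"
      using n0 by (simp add: l_def)
    with derivative_along_sequence[OF der Jlim Jq]
    have "(\<lambda>k. (\<Phi> (J' k) - \<Phi> J) / \<epsilon> k) \<longlonglongrightarrow> l" by simp
    moreover have "affine_quermass \<nu> j (comb (\<epsilon> k)) = \<Phi> (J' k)" for k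
      by (simp add: affine_quermass_def \<Phi>_def C_def J'_def V'_def)
    ultimately show ?thesis by (simp add: aq)
  qed
  have "((\<lambda>\<epsilon>. (affine_quermass \<nu> j (comb \<epsilon>) - affine_quermass \<nu> j K) / \<epsilon>) \<longlongrightarrow> l) (at_right 0)"
    unfolding tendsto_at_iff_sequentially
  proof (intro allI impI)
    fix X :: "nat \<Rightarrow> real" assume X: "\<forall>i. X i \<in> {0<..} - {0}" "X \<longlonglongrightarrow> 0"
    have "\<forall>\<^sub>F i in sequentially. X i < 1 / (1 + growth_const)"
      using order_tendstoD(2)[OF X(2)] gc by simp
    then obtain N where N: "\<And>i. i \<ge> N \<Longrightarrow> X i < 1 / (1 + growth_const)"
      unfolding eventually_sequentially by blast
    have small: "X (i + N) \<le> 1" "growth_const * X (i + N) \<le> 1" for i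
    proof -
      have x: "0 < X (i + N)" "X (i + N) * (1 + growth_const) < 1"
        using X(1) N[of "i + N"] gc by (auto simp: pos_less_divide_eq)
      have "0 < X (i + N) * growth_const" using x gc by simp
      then show "X (i + N) \<le> 1" "growth_const * X (i + N) \<le> 1" using x by (auto simp: algebra_simps)
    qed
    have "(\<lambda>i. (affine_quermass \<nu> j (comb (X (i + N))) - affine_quermass \<nu> j K) / X (i + N)) \<longlonglongrightarrow> l"
      using X small LIMSEQ_ignore_initial_segment[OF X(2), of N] by (intro seq) auto
    then show "((\<lambda>\<epsilon>. (affine_quermass \<nu> j (comb \<epsilon>) - affine_quermass \<nu> j K) / \<epsilon>) \<circ> X) \<longlonglongrightarrow> l"
      unfolding comp_def by (rule LIMSEQ_offset)
  qed
  then show "((\<lambda>\<epsilon>. (affine_quermass \<nu> j (comb \<epsilon>) - affine_quermass \<nu> j K) / \<epsilon>) \<longlongrightarrow>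
       C * J powr (- 1 / real CARD('n) - 1) * (real j / left_slope) * I) (at_right 0)"
    by (simp add: l_def)
qed

end

theorem proposition2p4:
  fixes \<phi> :: "real \<Rightarrow> real" and K L :: "(real^'n) set" and j :: nat
    and \<nu> :: "(real^'n) set measure"
  assumes "\<phi> \<in> orlicz_functions"
    and "K \<in> convex_bodies_o" and "L \<in> convex_bodies_o"
    and "1 \<le> j" and "j \<le> CARD('n)"
    and "haar_prob_grassmannian j \<nu>"
  shows "\<exists>l. ((\<lambda>\<epsilon>. (affine_quermass \<nu> j (orlicz_comb \<phi> \<epsilon> K L) - affine_quermass \<nu> j K) / \<epsilon>)
                \<longlongrightarrow> l) (at_right 0) \<and>
             ereal (affine_quermass \<nu> j K ^ (CARD('n) + 1)) *
               inverse (orlicz_mixed_affine_quermass \<phi> \<nu> j K L ^ CARD('n)) =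
             ereal (left_deriv \<phi> 1 / real j * l)"
proof -
  obtain r R where rR: "0 < r" "cball 0 r \<subseteq> K" "K \<subseteq> cball 0 R" by (rule convex_body_balls[OF assms(2)])
  obtain rL RL where rRL: "0 < rL" "cball 0 rL \<subseteq> L" "L \<subseteq> cball 0 RL" by (rule convex_body_balls[OF assms(3)])
  interpret orlicz_pair \<phi> K L r R rL RL
    by unfold_locales (fact assms rR rRL)+
  let ?n = "CARD('n)"
  define J where "J = (LINT \<xi> | \<nu>. inverse (vol_in \<xi> (orth_proj \<xi> ` K) ^ ?n))"
  define I where "I = (LINT \<xi> | \<nu>. orlicz_mixed_vol \<phi> \<xi> (orth_proj \<xi> ` K) (orth_proj \<xi> ` L) *
                            inverse (vol_in \<xi> (orth_proj \<xi> ` K) ^ (?n + 1)))"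
  define C where "C = unit_ball_vol (real ?n) / unit_ball_vol (real j)"
  define l where "l = C * J powr (- 1 / real ?n - 1) * (real j / left_slope) * I"
  note d = affine_quermass_right_derivative[OF assms(4,6), folded J_def I_def C_def]
  have Cpos: "0 < C" by (simp add: C_def)
  have n: "0 < ?n" by simp
  \<comment> \<open>the powers in the statement undo the root in the definition of the functionals\<close>
  have root: "(x powr (- 1 / real ?n)) ^ ?n = inverse x" if "0 < x" for x
  proof -
    have "(x powr (- 1 / real ?n)) ^ ?n = (x powr (- 1 / real ?n)) powr real ?n"
      using that by (intro powr_realpow[symmetric]) simp
    also have "\<dots> = x powr (- 1 / real ?n * real ?n)" by (rule powr_powr)
    also have "- 1 / real ?n * real ?n = - 1" using n by simp
    finally show ?thesis using that by (simp add: powr_minus)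
  qed
  have right: "left_deriv \<phi> 1 / real j * l = C * J powr (- 1 / real ?n - 1) * I"
    using left_slope_ge_1 assms(4) by (simp add: left_deriv_phi l_def)
  have aq: "affine_quermass \<nu> j K = C * J powr (- 1 / real ?n)"
    by (simp add: affine_quermass_def J_def C_def)
  have "ereal (affine_quermass \<nu> j K ^ (?n + 1)) * inverse (orlicz_mixed_affine_quermass \<phi> \<nu> j K L ^ ?n) =
      ereal (C * J powr (- 1 / real ?n - 1) * I)"
  proof (cases "I = 0")
    case True
    then have "orlicz_mixed_affine_quermass \<phi> \<nu> j K L = \<infinity>"
      unfolding orlicz_mixed_affine_quermass_def Let_def I_def[symmetric] by simp
    then show ?thesis using True n by (simp add: zero_ereal_def[symmetric])
  next
    case False
    then have I: "0 < I" using d(3) by simp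
    have "orlicz_mixed_affine_quermass \<phi> \<nu> j K L = ereal (C * I powr (- 1 / real ?n))"
      unfolding orlicz_mixed_affine_quermass_def Let_def I_def[symmetric] C_def[symmetric] using False by simp
    then have "orlicz_mixed_affine_quermass \<phi> \<nu> j K L ^ ?n = ereal (C ^ ?n * inverse I)"
      using root[OF I] by (simp add: power_mult_distrib)
    then have inv: "inverse (orlicz_mixed_affine_quermass \<phi> \<nu> j K L ^ ?n) = ereal (inverse (C ^ ?n) * I)"
      using Cpos I by simp
    have "affine_quermass \<nu> j K ^ (?n + 1) = C ^ ?n * C * (inverse J * J powr (- 1 / real ?n))"
      unfolding aq using root[OF d(2)] by (simp add: power_mult_distrib)
    also have "inverse J * J powr (- 1 / real ?n) = J powr (- 1 / real ?n - 1)"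
      unfolding powr_diff using d(2) by (simp add: divide_inverse mult.commute)
    finally have "affine_quermass \<nu> j K ^ (?n + 1) * (inverse (C ^ ?n) * I) = C * J powr (- 1 / real ?n - 1) * I"
      using Cpos by (simp add: field_simps)
    then show ?thesis unfolding inv by simp
  qed
  then show ?thesis
    using d(1) unfolding l_def[symmetric] comb_def right[symmetric] by blast
qed

end
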